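(* Let $\gamma$ be a non-degenerate centred Gaussian measure on an infinite dimensional separable Banach space $X$, and let $\mu,\nu\in\mathcal P(X)$ with $\mu,\nu\ll\gamma$ be such that some plan in $\Pi(\mu,\nu)$ has finite cost $\int\|x-y\|_{H(\gamma)}\,d\pi$. For $d\in\mathbb N$ let $\gamma_d,\mu_d,\nu_d,T_d$ be as in the context, $\Gamma_d=\mathrm{graph}(T_d)$ and $\pi_d=(\mathrm{Id},T_d)_\sharp\mu_d$, and let $\pi$ be a weak limit of $(\pi_d)$ (along a subsequence if necessary). Let $t\in[0,1]$ and assume that there exists $C>0$ such that for all $d\in\mathbb N$ and all compact sets $A\subset X$ $$\gamma_d\big(T_t(\Gamma_d\cap (A\times X))\big)\ \ge\ C\,\mu_d(A).$$ Then there is a $\|\cdot\|_{H(\gamma)}$-cyclically monotone set $\Gamma\subset X\times X$ with $\pi(\Gamma)=1$ such that for all compact sets $A\subset X$ $$\gamma\big(T_t(\Gamma\cap (A\times X))\big)\ \ge\ C\,\mu(A).$$ The set $\Gamma$ does not depend on $t$.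
   Context: **Wiener space.** $\gamma$ is a non-degenerate centred Gaussian probability measure on $X$. $\mathscr H$ is the closure in $L^2(X,\gamma)$ of $\{x\mapsto\langle x^*,x\rangle : x^*\in X^*\}$, $R_\gamma\hat h=\int_X\hat h(x)\,x\,\gamma(dx)$ for $\hat h\in\mathscr H$, and $H(\gamma)=R_\gamma\mathscr H$ is the Cameron–Martin space, with $\|R_\gamma\hat h\|_{H(\gamma)}=\|\hat h\|_{L^2(\gamma)}$; $\|h\|_{H(\gamma)}=+\infty$ for $h\in X\setminus H(\gamma)$. Fix an orthonormal basis $\{e_i\}$ of $H(\gamma)$ with $e_i=R_\gamma\hat e_i$ and $\hat e_i\in X^*$, and let $P_dx=\sum_{i=1}^d\langle\hat e_i,x\rangle e_i$. Put $\gamma_d=P_{d\,\sharp}\gamma$, $\mu_d=P_{d\,\sharp}\mu$, $\nu_d=P_{d\,\sharp}\nu$. These are regarded as measures on $X$ concentrated on $P_dX=\mathrm{span}(e_1,\dots,e_d)\subset H(\gamma)$, identified with $\mathbb R^d$, on which $\|\cdot\|_{H(\gamma)}$ is the Euclidean norm $\|\cdot\|_d$. **Plans.** $\Pi(\alpha,\beta)$ is the set of probability measures on the product with marginals $\alpha,\beta$. A set $\Gamma\subset X\times X$ is $\|\cdot\|_{H(\gamma)}$-cyclically monotone if $\sum_{i=0}^n\|x_i-y_i\|_{H(\gamma)}\le\sum_{i=0}^n\|x_{i+1}-y_i\|_{H(\gamma)}$ (with $x_{n+1}=x_0$) for all finite families $(x_i,y_i)\in\Gamma$. **The maps $T_d$.**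 $T_d$ is the optimal transport map from $\mu_d$ to $\nu_d$ with cost $\|x-y\|_d$ obtained by gluing the monotone rearrangements along the transport rays: $T_{d\,\sharp}\mu_d=\nu_d$, $(\mathrm{Id},T_d)_\sharp\mu_d$ minimizes $\int\|x-y\|_d\,d\pi$ over $\Pi(\mu_d,\nu_d)$, and on each transport ray (maximal segment along which optimal plans move mass) $T_d$ is the nondecreasing map, in the direction of transport, pushing the conditional measure of $\mu_d$ on that ray onto that of $\nu_d$. It is Borel and invertible (up to negligible sets). **Evolution.** $T_t(x,y)=(1-t)x+ty$ and $T_t(E)$ denotes the image of $E\subset X\times X$. *)

theory Defs
  imports "HOL-Probability.Probability"
begin

section \<open>Gaussian measures and the Cameron--Martin space\<close>

definition borel_prob :: "'a::topological_space measure \<Rightarrow> bool" where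
  "borel_prob M \<longleftrightarrow> prob_space M \<and> sets M = sets borel"

text \<open>The Dirac mass at 0 is the centred Gaussian law of variance 0.\<close>
definition centred_gaussian :: "'a::real_normed_vector measure \<Rightarrow> bool" where
  "centred_gaussian \<gamma> \<longleftrightarrow> borel_prob \<gamma> \<and>
     (\<forall>f :: 'a \<Rightarrow>\<^sub>L real.
        distr \<gamma> borel (blinfun_apply f) = return borel 0 \<or>
        (\<exists>\<sigma>>0. distr \<gamma> borel (blinfun_apply f) = density lborel (normal_density 0 \<sigma>)))"

definition nondegenerate :: "'a::real_normed_vector measure \<Rightarrow> bool" where
  "nondegenerate \<gamma> \<longleftrightarrow> (\<forall>f :: 'a \<Rightarrow>\<^sub>L real. f \<noteq> 0 \<longrightarrow> (\<integral>x. (blinfun_apply f x)\<^sup>2 \<partial>\<gamma>) > 0)"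

definition l2_norm :: "'a measure \<Rightarrow> ('a \<Rightarrow> real) \<Rightarrow> real" where
  "l2_norm \<gamma> g = sqrt (\<integral>x. (g x)\<^sup>2 \<partial>\<gamma>)"

text \<open>The closure of the dual space in \<open>L\<^sup>2(\<gamma>)\<close>; its elements are functions,
  not equivalence classes modulo equality almost everywhere.\<close>
definition dual_closure :: "'a::real_normed_vector measure \<Rightarrow> ('a \<Rightarrow> real) set" where
  "dual_closure \<gamma> = {g \<in> borel_measurable \<gamma>. integrable \<gamma> (\<lambda>x. (g x)\<^sup>2) \<and>
     (\<forall>\<epsilon>>0. \<exists>f :: 'a \<Rightarrow>\<^sub>L real. l2_norm \<gamma> (\<lambda>x. g x - blinfun_apply f x) < \<epsilon>)}"

definition R_op :: "'a::{banach,second_countable_topology} measure \<Rightarrow> ('a \<Rightarrow> real) \<Rightarrow> 'a" where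
  "R_op \<gamma> g = (\<integral>x. g x *\<^sub>R x \<partial>\<gamma>)"

definition cameron_martin :: "'a::{banach,second_countable_topology} measure \<Rightarrow> 'a set" where
  "cameron_martin \<gamma> = R_op \<gamma> ` dual_closure \<gamma>"

text \<open>A chosen \<open>h\<close>-hat with \<open>R_op \<gamma>\<close> of it equal to \<open>h\<close>. It is unique up to equality
  \<open>\<gamma>\<close>-almost everywhere, so norm and inner product below do not depend on the choice.\<close>
definition cm_hat :: "'a::{banach,second_countable_topology} measure \<Rightarrow> 'a \<Rightarrow> 'a \<Rightarrow> real" where
  "cm_hat \<gamma> h = (SOME g. g \<in> dual_closure \<gamma> \<and> R_op \<gamma> g = h)"

definition cm_norm :: "'a::{banach,second_countable_topology} measure \<Rightarrow> 'a \<Rightarrow> ennreal" where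
  "cm_norm \<gamma> h = (if h \<in> cameron_martin \<gamma> then ennreal (l2_norm \<gamma> (cm_hat \<gamma> h)) else \<infinity>)"

definition cm_inner :: "'a::{banach,second_countable_topology} measure \<Rightarrow> 'a \<Rightarrow> 'a \<Rightarrow> real" where
  "cm_inner \<gamma> h k = (\<integral>x. cm_hat \<gamma> h x * cm_hat \<gamma> k x \<partial>\<gamma>)"

definition cm_orthonormal_basis ::
  "'a::{banach,second_countable_topology} measure \<Rightarrow> (nat \<Rightarrow> 'a) \<Rightarrow> bool" where
  "cm_orthonormal_basis \<gamma> e \<longleftrightarrow>
     range e \<subseteq> cameron_martin \<gamma> \<and>
     (\<forall>i j. cm_inner \<gamma> (e i) (e j) = (if i = j then 1 else 0)) \<and>
     (\<forall>h\<in>cameron_martin \<gamma>. \<forall>\<epsilon>>0. \<exists>v\<in>span (range e). cm_norm \<gamma> (h - v) < \<epsilon>)"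

text \<open>Indices start at 0, so \<open>proj_d e' e d\<close> uses the first \<open>d\<close> basis vectors.\<close>
definition proj_d ::
  "(nat \<Rightarrow> 'a \<Rightarrow>\<^sub>L real) \<Rightarrow> (nat \<Rightarrow> 'a) \<Rightarrow> nat \<Rightarrow> 'a::real_normed_vector \<Rightarrow> 'a" where
  "proj_d e' e d x = (\<Sum>i<d. blinfun_apply (e' i) x *\<^sub>R e i)"

section \<open>Transport plans\<close>

definition plans :: "'a::topological_space measure \<Rightarrow> 'a measure \<Rightarrow> ('a \<times> 'a) measure set" where
  "plans \<alpha> \<beta> = {\<pi>. borel_prob \<pi> \<and> distr \<pi> borel fst = \<alpha> \<and> distr \<pi> borel snd = \<beta>}"

definition transport_cost ::
  "'a::{banach,second_countable_topology} measure \<Rightarrow> ('a \<times> 'a) measure \<Rightarrow> ennreal" where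
  "transport_cost \<gamma> \<pi> = (\<integral>\<^sup>+(x, y). cm_norm \<gamma> (x - y) \<partial>\<pi>)"

definition optimal_plan :: "'a::{banach,second_countable_topology} measure \<Rightarrow>
    'a measure \<Rightarrow> 'a measure \<Rightarrow> ('a \<times> 'a) measure \<Rightarrow> bool" where
  "optimal_plan \<gamma> \<alpha> \<beta> \<pi> \<longleftrightarrow> \<pi> \<in> plans \<alpha> \<beta> \<and>
     (\<forall>\<pi>'\<in>plans \<alpha> \<beta>. transport_cost \<gamma> \<pi> \<le> transport_cost \<gamma> \<pi>')"

definition cm_cyclically_monotone ::
  "'a::{banach,second_countable_topology} measure \<Rightarrow> ('a \<times> 'a) set \<Rightarrow> bool" where
  "cm_cyclically_monotone \<gamma> \<Gamma> \<longleftrightarrow>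
     (\<forall>(n::nat) x y. (\<forall>i\<le>n. (x i, y i) \<in> \<Gamma>) \<longrightarrow>
        (\<Sum>i\<le>n. cm_norm \<gamma> (x i - y i)) \<le>
        (\<Sum>i\<le>n. cm_norm \<gamma> (x (if i = n then 0 else Suc i) - y i)))"

definition weakly_converges ::
  "(nat \<Rightarrow> 'b::topological_space measure) \<Rightarrow> 'b measure \<Rightarrow> bool" where
  "weakly_converges M L \<longleftrightarrow>
     (\<forall>f :: 'b \<Rightarrow> real. continuous_on UNIV f \<and> bounded (range f) \<longrightarrow>
        (\<lambda>n. \<integral>x. f x \<partial>M n) \<longlonglongrightarrow> (\<integral>x. f x \<partial>L))"

section \<open>Monotone transport along the transport rays\<close>

text \<open>Below, \<open>V\<close> is the finite-dimensional subspace carrying \<open>\<alpha>\<close> and \<open>\<beta>\<close>, on which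
  the Cameron--Martin norm is the Euclidean norm. A Kantorovich potential is normalised so
  that optimal plans move mass in the direction in which it decreases at unit rate.\<close>
definition kantorovich_potential :: "'a::{banach,second_countable_topology} measure \<Rightarrow>
    'a set \<Rightarrow> 'a measure \<Rightarrow> 'a measure \<Rightarrow> ('a \<Rightarrow> real) \<Rightarrow> bool" where
  "kantorovich_potential \<gamma> V \<alpha> \<beta> \<phi> \<longleftrightarrow>
     (\<forall>x\<in>V. \<forall>y\<in>V. ennreal \<bar>\<phi> x - \<phi> y\<bar> \<le> cm_norm \<gamma> (x - y)) \<and>
     (\<forall>\<pi>. optimal_plan \<gamma> \<alpha> \<beta> \<pi> \<longrightarrow>
        (AE (x, y) in \<pi>. ennreal (\<phi> x - \<phi> y) = cm_norm \<gamma> (x - y)))"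

text \<open>A convex set isometric to a subset of the line through \<open>\<phi>\<close> is a (possibly unbounded)
  segment.\<close>
definition slope_one_segment :: "'a::{banach,second_countable_topology} measure \<Rightarrow>
    'a set \<Rightarrow> ('a \<Rightarrow> real) \<Rightarrow> 'a set \<Rightarrow> bool" where
  "slope_one_segment \<gamma> V \<phi> S \<longleftrightarrow> S \<subseteq> V \<and> convex S \<and> (\<exists>x\<in>S. \<exists>y\<in>S. x \<noteq> y) \<and>
     (\<forall>x\<in>S. \<forall>y\<in>S. ennreal \<bar>\<phi> x - \<phi> y\<bar> = cm_norm \<gamma> (x - y))"

definition transport_ray :: "'a::{banach,second_countable_topology} measure \<Rightarrow>
    'a set \<Rightarrow> ('a \<Rightarrow> real) \<Rightarrow> 'a set \<Rightarrow> bool" where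
  "transport_ray \<gamma> V \<phi> S \<longleftrightarrow> slope_one_segment \<gamma> V \<phi> S \<and>
     (\<forall>S'. slope_one_segment \<gamma> V \<phi> S' \<and> S \<subseteq> S' \<longrightarrow> S' = S)"

text \<open>\<open>q\<close> labels the rays: off the exceptional set \<open>N\<close> (which absorbs the common end points
  of different rays) its fibres are the rays, and single points outside all rays.\<close>
definition ray_labelling :: "'a::{banach,second_countable_topology} measure \<Rightarrow>
    'a set \<Rightarrow> ('a \<Rightarrow> real) \<Rightarrow> 'a set \<Rightarrow> ('a \<Rightarrow> 'a) \<Rightarrow> bool" where
  "ray_labelling \<gamma> V \<phi> N q \<longleftrightarrow> q \<in> borel_measurable borel \<and>
     (\<forall>x\<in>V - N. \<forall>y\<in>V - N.
        q x = q y \<longleftrightarrow> x = y \<or> (\<exists>S. transport_ray \<gamma> V \<phi> S \<and> x \<in> S \<and> y \<in> S))"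

definition disintegration ::
  "'a::t2_space measure \<Rightarrow> ('a \<Rightarrow> 'a) \<Rightarrow> ('a \<Rightarrow> 'a measure) \<Rightarrow> bool" where
  "disintegration M q \<kappa> \<longleftrightarrow>
     \<kappa> \<in> measurable borel (prob_algebra borel) \<and>
     (\<forall>A\<in>sets borel. emeasure M A = (\<integral>\<^sup>+z. emeasure (\<kappa> z) A \<partial>distr M borel q)) \<and>
     (AE z in distr M borel q. emeasure (\<kappa> z) (q -` {z}) = 1)"

text \<open>The order on a ray in the direction of transport is that of decreasing \<open>\<phi>\<close>.\<close>
definition monotone_on_rays :: "'a::{banach,second_countable_topology} measure \<Rightarrow>
    'a set \<Rightarrow> ('a \<Rightarrow> real) \<Rightarrow> 'a measure \<Rightarrow> ('a \<Rightarrow> 'a) \<Rightarrow> bool" where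
  "monotone_on_rays \<gamma> V \<phi> \<alpha> T \<longleftrightarrow>
     (\<exists>Z\<in>null_sets \<alpha>. \<forall>S. transport_ray \<gamma> V \<phi> S \<longrightarrow>
        (\<forall>x\<in>S - Z. T x \<in> S) \<and>
        (\<forall>x\<in>S - Z. \<forall>y\<in>S - Z. \<phi> x \<ge> \<phi> y \<longrightarrow> \<phi> (T x) \<ge> \<phi> (T y)))"

definition rearranges_along_rays :: "'a::{banach,second_countable_topology} measure \<Rightarrow>
    'a set \<Rightarrow> 'a measure \<Rightarrow> 'a measure \<Rightarrow> ('a \<Rightarrow> 'a) \<Rightarrow> bool" where
  "rearranges_along_rays \<gamma> V \<alpha> \<beta> T \<longleftrightarrow>
     (\<exists>\<phi> N q \<kappa> \<kappa>'.
        kantorovich_potential \<gamma> V \<alpha> \<beta> \<phi> \<and>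
        N \<in> null_sets \<alpha> \<and> N \<in> null_sets \<beta> \<and> ray_labelling \<gamma> V \<phi> N q \<and>
        disintegration \<alpha> q \<kappa> \<and> disintegration \<beta> q \<kappa>' \<and>
        (AE z in distr \<alpha> borel q. distr (\<kappa> z) borel T = \<kappa>' z) \<and>
        monotone_on_rays \<gamma> V \<phi> \<alpha> T)"

definition essentially_invertible ::
  "'a::topological_space measure \<Rightarrow> 'a measure \<Rightarrow> ('a \<Rightarrow> 'a) \<Rightarrow> bool" where
  "essentially_invertible \<alpha> \<beta> T \<longleftrightarrow>
     (\<exists>S\<in>borel_measurable borel. (AE x in \<alpha>. S (T x) = x) \<and> (AE y in \<beta>. T (S y) = y))"

definition ray_monotone_optimal_map :: "'a::{banach,second_countable_topology} measure \<Rightarrow>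
    'a set \<Rightarrow> 'a measure \<Rightarrow> 'a measure \<Rightarrow> ('a \<Rightarrow> 'a) \<Rightarrow> bool" where
  "ray_monotone_optimal_map \<gamma> V \<alpha> \<beta> T \<longleftrightarrow>
     T \<in> borel_measurable borel \<and> T ` V \<subseteq> V \<and>
     distr \<alpha> borel T = \<beta> \<and>
     optimal_plan \<gamma> \<alpha> \<beta> (distr \<alpha> borel (\<lambda>x. (x, T x))) \<and>
     rearranges_along_rays \<gamma> V \<alpha> \<beta> T \<and>
     essentially_invertible \<alpha> \<beta> T"

section \<open>Evolution\<close>

definition graph_on :: "'a set \<Rightarrow> ('a \<Rightarrow> 'a) \<Rightarrow> ('a \<times> 'a) set" where
  "graph_on V T = {(x, T x) |x. x \<in> V}"

definition interp :: "real \<Rightarrow> 'a::real_vector \<times> 'a \<Rightarrow> 'a" where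
  "interp t = (\<lambda>(x, y). (1 - t) *\<^sub>R x + t *\<^sub>R y)"

text \<open>Images under \<open>interp t\<close> of Borel sets are analytic, hence universally measurable but
  not always Borel: \<open>M\<close> has to be evaluated through its completion.\<close>
definition evolution_bound :: "'a::real_normed_vector measure \<Rightarrow> 'a measure \<Rightarrow>
    ('a \<times> 'a) set \<Rightarrow> real \<Rightarrow> real \<Rightarrow> bool" where
  "evolution_bound M \<alpha> \<Gamma> t C \<longleftrightarrow>
     (\<forall>A. compact A \<longrightarrow>
        emeasure (completion M) (interp t ` (\<Gamma> \<inter> (A \<times> UNIV))) \<ge> ennreal C * emeasure \<alpha> A)"

end

theory Submission
  imports Defs
begin

text \<open>The hypotheses on \<open>T d\<close> supply a Kantorovich potential for the projected problem. Pulled back by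
\<open>P d\<close> it becomes a function \<open>u\<close> on the whole space with \<open>\<bar>u x - u y\<bar> \<le> \<parallel>P d (x - y)\<parallel>\<close>, hence at most
the Cameron--Martin norm of \<open>x - y\<close>, and with \<open>u x - u y = \<parallel>x - y\<parallel>\<close> almost everywhere for the
optimal plan. The integral of \<open>u x - u y\<close> depends only on the projected marginals, so its integral
under \<open>\<pi>\<close> is the optimal projected cost. These costs converge, along the subsequence, to the cost of
\<open>\<pi>\<close>: they are at most the cost of \<open>\<pi>\<close> because \<open>\<pi>\<close> projects to a competitor, and lower
semicontinuity under weak convergence gives the opposite bound. Thus the nonnegative functions
\<open>\<parallel>x - y\<parallel> - (u x - u y)\<close> tend to 0 in \<open>L\<^sup>1(\<pi>)\<close>, and along a further subsequence they do so pointwise on a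
set of full measure. On that set a sum of distances is the limit of sums \<open>\<Sum> u (x i) - u (y i)\<close>, which
do not change when the \<open>x i\<close> are rotated, and this is cyclical monotonicity
(\<open>ex_cyclically_monotone_AE\<close>). Inner regularity then yields a \<open>\<sigma>\<close>-compact \<open>\<Gamma>\<close> inside it, chosen
before \<open>t\<close> and \<open>C\<close>; being \<open>\<sigma>\<close>-compact, it has Borel images under the evolution.

For the evolution bound let \<open>L\<close> be a compact part of \<open>\<Gamma>\<close> over \<open>A\<close> and \<open>U\<close> an open neighbourhood of its
image. By weak convergence the approximating plans eventually give the preimage of \<open>U\<close> almost the mass
\<open>\<pi> L\<close>, and the assumed bound turns this into \<open>\<gamma> (P d -` U) \<ge> C * (\<pi> L - \<epsilon>)\<close>. It remains to shrink
\<open>U\<close> to the image of \<open>L\<close>. For a continuous functional \<open>f\<close>, the functions \<open>f (P d x)\<close> are the Fourier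
partial sums of \<open>f\<close> in \<open>L\<^sup>2(\<gamma>)\<close> and converge to \<open>f\<close>; neighbourhoods described by finitely many functionals
are therefore almost preserved by \<open>P d\<close>, and countably many of them cut out the compact image
(\<open>compact_measure_ge\<close>).

The same convergence identifies the marginals of \<open>\<pi>\<close> as \<open>\<mu>\<close> and \<open>\<nu>\<close>, since a Borel probability measure
on a separable Banach space is determined by its characteristic functional
(\<open>measure_eqI_characteristic_functional\<close>). That theorem also gives the rotation invariance of a Gaussian
measure and with it the integrability of the squared norm (\<open>gaussian_norm_square_integrable\<close>), on which
the meaning of \<open>R_op\<close> as a convergent Bochner integral rests.

One point needs care: the functionals \<open>e' i\<close> span a dense subspace of the closure of the dual space in
\<open>L\<^sup>2(\<gamma>)\<close> but need not separate points, so the supremum of the projected norms can be finite outside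
the Cameron--Martin space. It agrees with the Cameron--Martin norm for differences of points of a set of
full measure (\<open>cm_norm_diff_eq_cm_sup_AE\<close>), which suffices as \<open>\<mu>\<close> and \<open>\<nu>\<close> are absolutely continuous.\<close>

section \<open>The Hahn--Banach theorem\<close>

definition sublinear :: "('a::real_vector \<Rightarrow> real) \<Rightarrow> bool" where
  "sublinear p \<longleftrightarrow> (\<forall>x y. p (x + y) \<le> p x + p y) \<and> (\<forall>c\<ge>0. \<forall>x. p (c *\<^sub>R x) = c * p x)"

lemma sublinear_add: "sublinear p \<Longrightarrow> p (x + y) \<le> p x + p y"
  and sublinear_scale: "sublinear p \<Longrightarrow> c \<ge> 0 \<Longrightarrow> p (c *\<^sub>R x) = c * p x"
  by (auto simp: sublinear_def)

lemma sublinear_zero: "sublinear p \<Longrightarrow> p 0 = 0"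
  using sublinear_scale[of p 0 0] by simp

lemma sublinear_lower: "sublinear p \<Longrightarrow> - p (- x) \<le> p x"
  using sublinear_add[of p x "- x"] sublinear_zero[of p] by simp

text \<open>A minimal sublinear functional is unchanged when lowered in any direction, and this
  forces it to be additive.\<close>
definition lower_along :: "('a::real_vector \<Rightarrow> real) \<Rightarrow> 'a \<Rightarrow> 'a \<Rightarrow> real" where
  "lower_along p z x = (INF t\<in>{0..}. p (x + t *\<^sub>R z) - t * p z)"

lemma lower_along_bdd:
  assumes "sublinear p"
  shows "bdd_below ((\<lambda>t. p (x + t *\<^sub>R z) - t * p z) ` {0..})"
proof (rule bdd_belowI2)
  fix t :: real assume "t \<in> {0..}"
  then have "t * p z = p (t *\<^sub>R z)" using sublinear_scale[OF assms] by simp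
  also have "\<dots> \<le> p (x + t *\<^sub>R z) + p (- x)"
    using sublinear_add[OF assms, of "x + t *\<^sub>R z" "- x"] by simp
  finally show "- p (- x) \<le> p (x + t *\<^sub>R z) - t * p z" by simp
qed

lemma lower_along_le:
  assumes "sublinear p" "t \<ge> 0"
  shows "lower_along p z x \<le> p (x + t *\<^sub>R z) - t * p z"
  unfolding lower_along_def by (rule cINF_lower[OF lower_along_bdd[OF assms(1)]]) (use assms in auto)

lemma lower_along_greatest:
  assumes "\<And>t. t \<ge> 0 \<Longrightarrow> a \<le> p (x + t *\<^sub>R z) - t * p z"
  shows "a \<le> lower_along p z x"
  unfolding lower_along_def by (rule cINF_greatest) (use assms in auto)

lemma sublinear_lower_along:
  assumes p: "sublinear p"
  shows "sublinear (lower_along p z)"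
proof -
  let ?q = "lower_along p z"
  have add: "?q (x + y) \<le> ?q x + ?q y" for x y
  proof -
    have "?q (x + y) - ?q x \<le> p (y + t *\<^sub>R z) - t * p z" if t: "t \<ge> 0" for t
    proof -
      have "?q (x + y) - (p (y + t *\<^sub>R z) - t * p z) \<le> p (x + s *\<^sub>R z) - s * p z" if s: "s \<ge> 0" for s
      proof -
        have "?q (x + y) \<le> p ((x + y) + (s + t) *\<^sub>R z) - (s + t) * p z"
          using lower_along_le[OF p] s t by simp
        also have "(x + y) + (s + t) *\<^sub>R z = (x + s *\<^sub>R z) + (y + t *\<^sub>R z)"
          by (simp add: algebra_simps)
        also have "p \<dots> \<le> p (x + s *\<^sub>R z) + p (y + t *\<^sub>R z)" by (rule sublinear_add[OF p])
        finally show ?thesis by (simp add: algebra_simps)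
      qed
      from lower_along_greatest[OF this] show ?thesis by simp
    qed
    from lower_along_greatest[OF this] show ?thesis by simp
  qed
  have half: "c * ?q x \<le> ?q (c *\<^sub>R x)" if c: "c > 0" for c x
  proof (rule lower_along_greatest)
    fix t :: real assume t: "t \<ge> 0"
    have "c * ?q x \<le> c * (p (x + (t / c) *\<^sub>R z) - t / c * p z)"
      using lower_along_le[OF p, of "t / c" z x] c t by simp
    also have "\<dots> = p (c *\<^sub>R (x + (t / c) *\<^sub>R z)) - t * p z"
      using sublinear_scale[OF p, of c] c by (simp add: right_diff_distrib)
    finally show "c * ?q x \<le> p (c *\<^sub>R x + t *\<^sub>R z) - t * p z"
      using c by (simp add: scaleR_add_right)
  qed
  have zero: "?q 0 = 0"
  proof (rule antisym)
    show "?q 0 \<le> 0" using lower_along_le[OF p, of 0 z 0] sublinear_zero[OF p] by simp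
    show "0 \<le> ?q 0" by (rule lower_along_greatest) (simp add: sublinear_scale[OF p])
  qed
  have "?q (c *\<^sub>R x) = c * ?q x" if c: "c \<ge> 0" for c x
  proof (cases "c = 0")
    case False
    then have c: "c > 0" using c by simp
    have "inverse c * ?q (c *\<^sub>R x) \<le> ?q x" using half[of "inverse c" "c *\<^sub>R x"] c by simp
    then show ?thesis using half[OF c, of x] c by (simp add: field_simps)
  qed (simp add: zero)
  then show ?thesis using add by (auto simp: sublinear_def)
qed

text \<open>Lowering \<open>p\<close> along \<open>z\<close> gives a sublinear functional below \<open>p\<close>, so by minimality \<open>p\<close> itself; the
  choice \<open>t = 1\<close> in the infimum then reads \<open>p x + p z \<le> p (x + z)\<close>.\<close>
lemma minimal_sublinear_linear:
  assumes p: "sublinear p" and min: "\<And>q. sublinear q \<Longrightarrow> q \<le> p \<Longrightarrow> q = p"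
  shows "linear p"
proof -
  have le: "lower_along p z \<le> p" for z
    using lower_along_le[OF p, of 0] by (auto simp: le_fun_def)
  have eq: "lower_along p z = p" for z
    by (rule min[OF sublinear_lower_along[OF p] le])
  have add: "p (x + z) = p x + p z" for x z
    using lower_along_le[OF p, of 1 z x] sublinear_add[OF p, of x z] by (simp add: eq)
  have neg: "p (- x) = - p x" for x
    using add[of x "- x"] sublinear_zero[OF p] by simp
  show ?thesis
  proof (rule linearI)
    fix c :: real and x
    show "p (c *\<^sub>R x) = c *\<^sub>R p x"
    proof (cases "c \<ge> 0")
      case False
      then have "p (c *\<^sub>R x) = - p ((- c) *\<^sub>R x)" using neg[of "(- c) *\<^sub>R x"] by simp
      then show ?thesis using False sublinear_scale[OF p, of "- c" x] by simp
    qed (simp add: sublinear_scale[OF p])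
  qed (rule add)
qed

text \<open>Zorn's lemma applies because the pointwise infimum of a chain of sublinear functionals below \<open>p\<close> is
  again sublinear; it is finite since every such functional is bounded below by \<open>- p (- x)\<close>.\<close>
lemma ex_minimal_sublinear:
  assumes p: "sublinear p"
  obtains q where "sublinear q" "q \<le> p" "\<And>q'. sublinear q' \<Longrightarrow> q' \<le> q \<Longrightarrow> q' = q"
proof -
  let ?A = "{q. sublinear q \<and> q \<le> p}"
  have "\<exists>m\<in>?A. \<forall>a\<in>?A. (\<lambda>a b. b \<le> a) m a \<longrightarrow> a = m"
  proof (rule predicate_Zorn)
    show "partial_order_on ?A (relation_of (\<lambda>a b. b \<le> a) ?A)"
      by (auto simp: partial_order_on_def preorder_on_def refl_on_def trans_def antisym_def relation_of_def)
    fix C assume "C \<in> Chains (relation_of (\<lambda>a b. b \<le> a) ?A)"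
    then have C: "\<And>q. q \<in> C \<Longrightarrow> sublinear q \<and> q \<le> p"
      "\<And>q q'. q \<in> C \<Longrightarrow> q' \<in> C \<Longrightarrow> q \<le> q' \<or> q' \<le> q"
      by (auto simp: Chains_def relation_of_def)
    show "\<exists>u\<in>?A. \<forall>a\<in>C. u \<le> a"
    proof (cases "C = {}")
      case True then show ?thesis using p by auto
    next
      case ne: False
      define u where "u x = (INF q\<in>C. q x)" for x
      have lower: "- p (- x) \<le> q x" if "q \<in> C" for q x
        using C(1)[OF that] sublinear_lower[of q x] by (auto simp: le_fun_def intro: order_trans[of _ "- q (- x)"])
      have bdd: "bdd_below ((\<lambda>q. q x) ` C)" for x
        by (rule bdd_belowI2[of _ "- p (- x)"]) (rule lower)
      have ule: "u x \<le> q x" if "q \<in> C" for q x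
        unfolding u_def by (rule cINF_lower[OF bdd that])
      have ugr: "a \<le> u x" if "\<And>q. q \<in> C \<Longrightarrow> a \<le> q x" for a x
        unfolding u_def by (rule cINF_greatest[OF ne that])
      have add: "u (x + y) \<le> u x + u y" for x y
      proof -
        have "u (x + y) - u x \<le> q y" if q: "q \<in> C" for q
        proof -
          have "u (x + y) - q y \<le> q' x" if q': "q' \<in> C" for q'
          proof -
            have "u (x + y) \<le> q' x + q y"
              using C(2)[OF q q']
            proof
              assume "q \<le> q'"
              then show ?thesis using ule[OF q, of "x + y"] sublinear_add[of q x y] C(1)[OF q]
                by (smt (verit) le_fun_def)
            next
              assume "q' \<le> q"
              then show ?thesis using ule[OF q', of "x + y"] sublinear_add[of q' x y] C(1)[OF q']
                by (smt (verit) le_fun_def)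
            qed
            then show ?thesis by simp
          qed
          then have "u (x + y) - q y \<le> u x" by (rule ugr)
          then show ?thesis by simp
        qed
        then have "u (x + y) - u x \<le> u y" by (rule ugr)
        then show ?thesis by simp
      qed
      have half: "c * u x \<le> u (c *\<^sub>R x)" if c: "c > 0" for c x
        by (rule ugr) (use C(1) ule c sublinear_scale in \<open>metis less_imp_le mult_left_mono\<close>)
      have scale: "u (c *\<^sub>R x) = c * u x" if c: "c \<ge> 0" for c x
      proof (cases "c = 0")
        case True
        have "q 0 = 0" if "q \<in> C" for q using C(1)[OF that] sublinear_zero by blast
        then have "(\<lambda>q. q 0) ` C = (\<lambda>q. 0) ` C" by (intro image_cong) auto
        then have "u 0 = 0" using ne by (simp add: u_def)
        then show ?thesis using True by simp
      next
        case False
        then have c: "c > 0" using c by simp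
        have "inverse c * u (c *\<^sub>R x) \<le> u x" using half[of "inverse c" "c *\<^sub>R x"] c by simp
        then show ?thesis using half[OF c, of x] c by (simp add: field_simps)
      qed
      have "u \<le> p" using ne ule C(1) by (metis all_not_in_conv le_fun_def order_trans)
      moreover have "sublinear u" using add scale by (auto simp: sublinear_def)
      moreover have "u \<le> a" if "a \<in> C" for a using ule[OF that] by (simp add: le_fun_def)
      ultimately show ?thesis by blast
    qed
  qed
  then obtain m where m: "sublinear m" "m \<le> p" "\<And>a. sublinear a \<Longrightarrow> a \<le> p \<Longrightarrow> a \<le> m \<Longrightarrow> a = m"
    by auto
  show thesis by (rule that[of m]) (use m order_trans in blast)+
qed

text \<open>A linear functional below the norm lowered along \<open>x\<close> satisfies \<open>q (- x) \<le> - \<parallel>x\<parallel>\<close>, which forces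
  equality at \<open>x\<close>.\<close>
lemma norming_functional:
  fixes x :: "'a::real_normed_vector"
  obtains f :: "'a \<Rightarrow>\<^sub>L real" where "blinfun_apply f x = norm x" "\<And>y. \<bar>blinfun_apply f y\<bar> \<le> norm y"
proof -
  have p: "sublinear (norm :: 'a \<Rightarrow> real)" by (simp add: sublinear_def norm_triangle_ineq)
  obtain q where q: "sublinear q" "q \<le> lower_along norm x"
      "\<And>q'. sublinear q' \<Longrightarrow> q' \<le> q \<Longrightarrow> q' = q"
    using ex_minimal_sublinear[OF sublinear_lower_along[OF p]] by blast
  have lin: "linear q" by (rule minimal_sublinear_linear[OF q(1,3)])
  have le: "q y \<le> norm y" for y
    using q(2) lower_along_le[OF p, of 0 x y] by (auto simp: le_fun_def intro: order_trans)
  have neg: "q (- y) = - q y" for y using linear_neg[OF lin] .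
  have abs: "\<bar>q y\<bar> \<le> norm y" for y using le[of y] le[of "- y"] by (simp add: neg)
  have "q (- x) \<le> - norm x"
    using q(2) lower_along_le[OF p, of 1 x "- x"] by (auto simp: le_fun_def intro: order_trans)
  then have qx: "q x = norm x" using le[of x] by (simp add: neg)
  have "bounded_linear q"
    by (rule bounded_linear_intro[of _ 1]) (use lin abs in \<open>auto simp: linear_add linear_scale\<close>)
  then show thesis using that[of "Blinfun q"] qx abs by (simp add: bounded_linear_Blinfun_apply)
qed

lemma separating_functional:
  fixes x y :: "'a::real_normed_vector"
  assumes "x \<noteq> y"
  obtains f :: "'a \<Rightarrow>\<^sub>L real" where "blinfun_apply f x \<noteq> blinfun_apply f y"
proof -
  obtain f :: "'a \<Rightarrow>\<^sub>L real" where "blinfun_apply f (x - y) = norm (x - y)"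
    using norming_functional by blast
  with assms show thesis by (intro that[of f]) (auto simp: blinfun.diff_right)
qed

text \<open>Functionals norming the points of a dense sequence separate points: if all of them vanish at \<open>z\<close> and
  \<open>d\<close> is a point of the sequence with norming functional \<open>f\<close>, then \<open>\<parallel>d\<parallel> = f (d - z) \<le> \<parallel>d - z\<parallel>\<close>, and \<open>d\<close>
  can be taken arbitrarily close to \<open>z\<close>.\<close>
lemma countable_separating_functionals:
  obtains f :: "nat \<Rightarrow> 'a::{real_normed_vector,second_countable_topology} \<Rightarrow>\<^sub>L real"
  where "\<And>x y. (\<And>j. blinfun_apply (f j) x = blinfun_apply (f j) y) \<Longrightarrow> x = y"
proof -
  obtain D :: "'a set" where D: "countable D" "\<And>U. open U \<Longrightarrow> U \<noteq> {} \<Longrightarrow> \<exists>d\<in>D. d \<in> U"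
    using countable_dense_setE by blast
  have "D \<noteq> {}" using D(2)[of UNIV] by auto
  define f where "f j = (SOME f :: 'a \<Rightarrow>\<^sub>L real. blinfun_apply f (from_nat_into D j) = norm (from_nat_into D j)
      \<and> (\<forall>y. \<bar>blinfun_apply f y\<bar> \<le> norm y))" for j
  have f: "blinfun_apply (f j) (from_nat_into D j) = norm (from_nat_into D j)
      \<and> (\<forall>y. \<bar>blinfun_apply (f j) y\<bar> \<le> norm y)" for j
    unfolding f_def by (rule someI_ex) (metis norming_functional)
  show thesis
  proof (rule that[of f])
    fix x y assume eq: "\<And>j. blinfun_apply (f j) x = blinfun_apply (f j) y"
    show "x = y"
    proof (rule ccontr)
      assume "x \<noteq> y"
      then have "ball (x - y) (norm (x - y) / 3) \<noteq> {}" by simp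
      then obtain d where d: "d \<in> D" "dist (x - y) d < norm (x - y) / 3"
        using D(2)[of "ball (x - y) (norm (x - y) / 3)"] by auto
      then obtain j where j: "d = from_nat_into D j"
        using D(1) by (metis from_nat_into_surj)
      have "norm d = blinfun_apply (f j) (d - (x - y))"
        using f[of j] eq[of j] j by (simp add: blinfun.diff_right)
      also have "\<dots> \<le> norm (d - (x - y))" using f[of j] by (metis abs_le_D1)
      also have "\<dots> < norm (x - y) / 3" using d by (simp add: dist_norm norm_minus_commute)
      finally have "norm d < norm (x - y) / 3" .
      moreover have "norm (x - y) \<le> norm d + norm (d - (x - y))"
        using norm_triangle_ineq[of d "(x - y) - d"] by (simp add: norm_minus_commute)
      ultimately show False using \<open>norm (d - (x - y)) < norm (x - y) / 3\<close> norm_ge_zero[of "x - y"] by linarith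
    qed
  qed
qed

section \<open>Borel measures and their characteristic functionals\<close>

lemma borel_prob_sets: "borel_prob M \<Longrightarrow> sets M = sets borel"
  by (simp add: borel_prob_def)

lemma borel_prob_space: "borel_prob M \<Longrightarrow> space M = UNIV"
  using sets_eq_imp_space_eq[of M borel] by (simp add: borel_prob_def)

lemma continuous_on_blinfun_apply: "continuous_on S (blinfun_apply f)"
  by (intro linear_continuous_on blinfun.bounded_linear_right)

lemma inner_regular_compact:
  fixes M :: "'a::{banach,second_countable_topology} measure"
  assumes M: "borel_prob M" and B: "B \<in> sets borel" and \<epsilon>: "\<epsilon> > 0"
  obtains K where "compact K" "K \<subseteq> B" "measure M B < measure M K + \<epsilon>"
proof -
  interpret prob_space M using M by (simp add: borel_prob_def)
  have sets: "sets M = sets borel" using M by (simp add: borel_prob_def)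
  have sup: "emeasure M B = (SUP K\<in>{K. K \<subseteq> B \<and> compact K}. emeasure M K)"
    by (rule inner_regular[OF sets _ B]) simp
  show thesis
  proof (cases "measure M B < \<epsilon>")
    case True
    then show thesis using that[of "{}"] by simp
  next
    case False
    have "ennreal (measure M B - \<epsilon>) < emeasure M B"
      unfolding emeasure_eq_measure using False \<epsilon> by (intro ennreal_lessI) (auto intro: ccontr)
    then obtain K where K: "K \<subseteq> B" "compact K" "ennreal (measure M B - \<epsilon>) < emeasure M K"
      unfolding sup less_SUP_iff by auto
    then have "measure M B - \<epsilon> < measure M K"
      unfolding emeasure_eq_measure using False by (simp add: ennreal_less_iff)
    then show thesis using that[of K] K by simp
  qed
qed

text \<open>The algebra of trigonometric polynomials in continuous functionals. It suits the Stone--Weierstrass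
  theorem, and the integrals of its elements are read off the characteristic functional.\<close>
inductive_set trig_poly :: "('a::real_normed_vector \<Rightarrow> real) set" where
  base: "(\<lambda>x. a * cos (blinfun_apply f x) + b * sin (blinfun_apply f x)) \<in> trig_poly"
| add: "g \<in> trig_poly \<Longrightarrow> h \<in> trig_poly \<Longrightarrow> (\<lambda>x. g x + h x) \<in> trig_poly"

lemma trig_poly_const: "(\<lambda>x. c) \<in> trig_poly"
  using trig_poly.base[of c 0 0] by simp

lemma trig_poly_continuous: "g \<in> trig_poly \<Longrightarrow> continuous_on S g"
  by (induction rule: trig_poly.induct)
     (auto intro!: continuous_intros continuous_on_blinfun_apply)

lemma trig_poly_bounded: "g \<in> trig_poly \<Longrightarrow> \<exists>B. \<forall>x. \<bar>g x\<bar> \<le> B"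
proof (induction rule: trig_poly.induct)
  case (base a f b)
  have "\<bar>a * cos s + b * sin s\<bar> \<le> \<bar>a\<bar> + \<bar>b\<bar>" for s
    using abs_cos_le_one[of s] abs_sin_le_one[of s]
    by (intro order_trans[OF abs_triangle_ineq] add_mono) (auto simp: abs_mult mult_left_le)
  then show ?case by blast
next
  case (add g h)
  then obtain B C where "\<forall>x. \<bar>g x\<bar> \<le> B" "\<forall>x. \<bar>h x\<bar> \<le> C" by blast
  then have "\<forall>x. \<bar>g x + h x\<bar> \<le> B + C"
    by (intro allI order_trans[OF abs_triangle_ineq] add_mono) auto
  then show ?case by blast
qed

lemma trig_poly_mult:
  assumes "g \<in> trig_poly" "h \<in> trig_poly"
  shows "(\<lambda>x. g x * h x) \<in> trig_poly"
  using assms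
proof (induction arbitrary: h rule: trig_poly.induct)
  case (base a f b)
  from base show ?case
  proof (induction rule: trig_poly.induct)
    case (base c k d)
    have "(\<lambda>x. (a * cos (blinfun_apply f x) + b * sin (blinfun_apply f x)) *
               (c * cos (blinfun_apply k x) + d * sin (blinfun_apply k x)))
        = (\<lambda>x. ((a * c - b * d) / 2 * cos (blinfun_apply (f + k) x) + (b * c + a * d) / 2 * sin (blinfun_apply (f + k) x))
             + ((a * c + b * d) / 2 * cos (blinfun_apply (f - k) x) + (b * c - a * d) / 2 * sin (blinfun_apply (f - k) x)))"
    proof
      fix x
      have *: "(a * c1 + b * s1) * (c * c2 + d * s2) =
          ((a * c - b * d) / 2 * (c1 * c2 - s1 * s2) + (b * c + a * d) / 2 * (s1 * c2 + c1 * s2)) +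
          ((a * c + b * d) / 2 * (c1 * c2 + s1 * s2) + (b * c - a * d) / 2 * (s1 * c2 - c1 * s2))" for c1 s1 c2 s2
        by (simp add: field_simps)
      show "(a * cos (blinfun_apply f x) + b * sin (blinfun_apply f x)) *
               (c * cos (blinfun_apply k x) + d * sin (blinfun_apply k x))
        = ((a * c - b * d) / 2 * cos (blinfun_apply (f + k) x) + (b * c + a * d) / 2 * sin (blinfun_apply (f + k) x))
             + ((a * c + b * d) / 2 * cos (blinfun_apply (f - k) x) + (b * c - a * d) / 2 * sin (blinfun_apply (f - k) x))"
        unfolding blinfun.add_left blinfun.diff_left cos_add cos_diff sin_add sin_diff by (rule *)
    qed
    then show ?case by (simp only: trig_poly.intros)
  next
    case (add g h)
    then show ?case using trig_poly.add[OF add(3,4)] by (simp add: distrib_left)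
  qed
next
  case (add g g')
  then show ?case using trig_poly.add[OF add(3,4)] by (simp add: distrib_right)
qed

lemma trig_poly_polynomial:
  assumes "real_polynomial_function p" "h \<in> trig_poly"
  shows "(\<lambda>x. p (h x)) \<in> trig_poly"
  using assms
proof (induction rule: real_polynomial_function.induct)
  case (linear p)
  have "p s = p 1 * s" for s
    using linear_scale[OF bounded_linear.linear[OF linear(1)], of s 1] by simp
  then have "(\<lambda>x. p (h x)) = (\<lambda>x. p 1 * h x)" by (rule ext)
  then show ?case using trig_poly_mult[OF trig_poly_const linear(2), of "p 1"] by simp
qed (simp_all add: trig_poly_const trig_poly_mult trig_poly.add)

lemma integrable_bounded_continuous:
  fixes g :: "'a::topological_space \<Rightarrow> 'b::{banach,second_countable_topology}"
  assumes M: "borel_prob M" and g: "continuous_on UNIV g" "\<And>x. norm (g x) \<le> B"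
  shows "integrable M g"
proof -
  interpret prob_space M using M by (simp add: borel_prob_def)
  have "g \<in> borel_measurable M"
    using M borel_measurable_continuous_onI[OF g(1)] by (simp add: borel_prob_def cong: measurable_cong_sets)
  then show ?thesis by (rule integrable_const_bound[of _ B, rotated]) (use g in auto)
qed

lemma integrable_trig_poly:
  assumes "borel_prob M" "g \<in> trig_poly"
  shows "integrable M g"
proof -
  obtain B where "\<forall>x. \<bar>g x\<bar> \<le> B" using trig_poly_bounded[OF assms(2)] by blast
  then show ?thesis
    by (intro integrable_bounded_continuous[OF assms(1) trig_poly_continuous[OF assms(2)], of B]) auto
qed

lemma integral_trig_poly_cong:
  assumes M: "borel_prob M" and N: "borel_prob N"
    and eq: "\<And>f :: 'a::real_normed_vector \<Rightarrow>\<^sub>L real.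
        (\<integral>x. cis (blinfun_apply f x) \<partial>M) = (\<integral>x. cis (blinfun_apply f x) \<partial>N)"
    and g: "g \<in> trig_poly"
  shows "(\<integral>x. g x \<partial>M) = (\<integral>x. g x \<partial>N)"
  using g
proof (induction rule: trig_poly.induct)
  case (base a f b)
  have c: "integrable L (\<lambda>x. cis (blinfun_apply f x))" if "borel_prob L" for L
    by (rule integrable_bounded_continuous[OF that, of _ 1])
       (auto simp: cis_conv_exp intro!: continuous_intros continuous_on_blinfun_apply)
  have *: "(\<integral>x. a * cos (blinfun_apply f x) + b * sin (blinfun_apply f x) \<partial>L) =
      a * Re (\<integral>x. cis (blinfun_apply f x) \<partial>L) + b * Im (\<integral>x. cis (blinfun_apply f x) \<partial>L)" if "borel_prob L" for L
    using integrable_Re[OF c[OF that]] integrable_Im[OF c[OF that]]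
    by (simp add: integral_Re[OF c[OF that], symmetric] integral_Im[OF c[OF that], symmetric])
  show ?case unfolding *[OF M] *[OF N] eq ..
next
  case (add g h)
  then show ?case using integrable_trig_poly[OF M] integrable_trig_poly[OF N] by simp
qed

text \<open>On a large compact set a trigonometric polynomial approximates \<open>g\<close>. Elsewhere, where only
  the mass is small, it may be large, so it is composed with a polynomial that is close to the
  truncation to \<open>[0, 1]\<close> on its whole range. The composition is still a trigonometric polynomial.\<close>
lemma integral_continuous_cong:
  fixes M N :: "'a::{banach,second_countable_topology} measure"
  assumes M: "borel_prob M" and N: "borel_prob N"
    and eq: "\<And>f :: 'a \<Rightarrow>\<^sub>L real. (\<integral>x. cis (blinfun_apply f x) \<partial>M) = (\<integral>x. cis (blinfun_apply f x) \<partial>N)"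
    and g: "continuous_on UNIV g" "\<And>x. 0 \<le> g x" "\<And>x. g x \<le> (1::real)"
  shows "(\<integral>x. g x \<partial>M) = (\<integral>x. g x \<partial>N)"
proof -
  have "\<bar>(\<integral>x. g x \<partial>M) - (\<integral>x. g x \<partial>N)\<bar> \<le> 8 * \<epsilon>" if \<epsilon>: "0 < \<epsilon>" "\<epsilon> \<le> 1" for \<epsilon>
  proof -
    obtain K1 where K1: "compact K1" "measure M UNIV < measure M K1 + \<epsilon>"
      using inner_regular_compact[OF M _ \<epsilon>(1), of UNIV] by auto
    obtain K2 where K2: "compact K2" "measure N UNIV < measure N K2 + \<epsilon>"
      using inner_regular_compact[OF N _ \<epsilon>(1), of UNIV] by auto
    define K where "K = K1 \<union> K2"
    have K: "compact K" using K1 K2 by (auto simp: K_def)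
    interpret function_ring_on trig_poly K
    proof
      fix x y :: 'a assume "x \<noteq> y"
      then obtain f :: "'a \<Rightarrow>\<^sub>L real" where f: "blinfun_apply f x \<noteq> blinfun_apply f y"
        using separating_functional by blast
      \<comment> \<open>After this scaling the two values of the functional differ by 1, which is not a multiple of \<open>2 * pi\<close>.\<close>
      define c where "c = 1 / (blinfun_apply f x - blinfun_apply f y)"
      have "blinfun_apply (c *\<^sub>R f) x = blinfun_apply (c *\<^sub>R f) y + 1"
        using f by (simp add: c_def blinfun.scaleR_left field_simps)
      moreover have "\<not> (cos (s + 1) = cos s \<and> sin (s + 1) = sin s)" for s :: real
      proof
        assume "cos (s + 1) = cos s \<and> sin (s + 1) = sin s"
        then have "cos ((s + 1) - s) = cos s * cos s + sin s * sin s" unfolding cos_diff by simp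
        then have "cos (1::real) = 1" using sin_cos_squared_add3[of s] by simp
        then show False using cos_monotone_0_pi[of 0 1] pi_gt3 by simp
      qed
      ultimately have "cos (blinfun_apply (c *\<^sub>R f) x) \<noteq> cos (blinfun_apply (c *\<^sub>R f) y) \<or>
          sin (blinfun_apply (c *\<^sub>R f) x) \<noteq> sin (blinfun_apply (c *\<^sub>R f) y)" by (simp only: de_Morgan_conj[symmetric]) simp
      then show "\<exists>f\<in>trig_poly. f x \<noteq> f y"
      proof
        assume "cos (blinfun_apply (c *\<^sub>R f) x) \<noteq> cos (blinfun_apply (c *\<^sub>R f) y)"
        then show ?thesis by (intro bexI[OF _ trig_poly.base[of 1 "c *\<^sub>R f" 0]]) simp
      next
        assume "sin (blinfun_apply (c *\<^sub>R f) x) \<noteq> sin (blinfun_apply (c *\<^sub>R f) y)"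
        then show ?thesis by (intro bexI[OF _ trig_poly.base[of 0 "c *\<^sub>R f" 1]]) simp
      qed
    qed (auto intro: K trig_poly_continuous trig_poly_mult trig_poly.add trig_poly_const)
    obtain h where h: "h \<in> trig_poly" "\<forall>x\<in>K. \<bar>g x - h x\<bar> < \<epsilon>"
      using Stone_Weierstrass_basic[of g \<epsilon>] \<epsilon>(1) g(1) continuous_on_subset by blast
    obtain B where B: "\<forall>x. \<bar>h x\<bar> \<le> B" using trig_poly_bounded[OF h(1)] by blast
    define clip :: "real \<Rightarrow> real" where "clip s = max 0 (min 1 s)" for s
    have "continuous_on {-B..B} clip" unfolding clip_def by (intro continuous_intros)
    then obtain p where p: "real_polynomial_function p" "\<And>s. s \<in> {-B..B} \<Longrightarrow> \<bar>clip s - p s\<bar> < \<epsilon>"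
      using Stone_Weierstrass_real_polynomial_function[of "{-B..B}" clip \<epsilon>] \<epsilon>(1) by auto
    define w where "w x = p (h x)" for x
    have w: "w \<in> trig_poly" unfolding w_def by (rule trig_poly_polynomial[OF p(1) h(1)])
    have pw: "\<bar>clip (h x) - w x\<bar> < \<epsilon>" for x unfolding w_def by (rule p(2)) (use spec[OF B, of x] in \<open>auto simp: abs_le_iff\<close>)
    have close: "\<bar>w x - g x\<bar> \<le> 2 * \<epsilon> + 2 * indicator (- K) x" for x
    proof (cases "x \<in> K")
      case True
      have "\<bar>clip (h x) - g x\<bar> \<le> \<bar>h x - g x\<bar>" using g(2,3)[of x] by (auto simp: clip_def)
      then show ?thesis using pw[of x] h(2) True by (auto simp: abs_minus_commute)
    next
      case False
      have "\<bar>clip (h x) - g x\<bar> \<le> 1" using g(2,3)[of x] by (auto simp: clip_def)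
      then show ?thesis using pw[of x] False \<epsilon> by simp
    qed
    have bd: "\<bar>(\<integral>x. w x \<partial>L) - (\<integral>x. g x \<partial>L)\<bar> \<le> 4 * \<epsilon>"
      if L: "borel_prob L" and K': "compact K'" "K' \<subseteq> K" "measure L UNIV < measure L K' + \<epsilon>" for L K'
    proof -
      interpret prob_space L using L by (simp add: borel_prob_def)
      note [simp] = borel_prob_sets[OF L] borel_prob_space[OF L]
      have iw: "integrable L w" by (rule integrable_trig_poly[OF L w])
      have ig: "integrable L g"
        by (rule integrable_bounded_continuous[OF L g(1), of 1]) (use g(2,3) in auto)
      have Kb: "K \<in> sets borel" "K' \<in> sets borel" using K K' by (auto intro: borel_compact)
      have "measure L (- K) \<le> \<epsilon>"
      proof -
        have "measure L K' \<le> measure L K" using K' Kb by (intro finite_measure_mono) auto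
        moreover have "measure L (- K) = 1 - measure L K"
          using prob_compl[of K] Kb by (simp add: Compl_eq_Diff_UNIV)
        ultimately show ?thesis using K'(3) prob_space by simp
      qed
      have ii: "integrable L (\<lambda>x. 2 * \<epsilon> + 2 * indicator (- K) x :: real)"
        using Kb by (intro Bochner_Integration.integrable_add integrable_const integrable_mult_right) 
          (auto simp: emeasure_eq_measure)
      have "\<bar>(\<integral>x. w x \<partial>L) - (\<integral>x. g x \<partial>L)\<bar> = \<bar>\<integral>x. w x - g x \<partial>L\<bar>"
        using iw ig by simp
      also have "\<dots> \<le> (\<integral>x. \<bar>w x - g x\<bar> \<partial>L)" by (rule integral_abs_bound)
      also have "\<dots> \<le> (\<integral>x. 2 * \<epsilon> + 2 * indicator (- K) x \<partial>L)"
        by (rule integral_mono[OF _ ii]) (use iw ig close in auto)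
      also have "\<dots> = 2 * \<epsilon> + 2 * measure L (- K)"
        using Kb prob_space by (subst Bochner_Integration.integral_add) (auto simp: emeasure_eq_measure)
      also have "\<dots> \<le> 4 * \<epsilon>" using \<open>measure L (- K) \<le> \<epsilon>\<close> by simp
      finally show ?thesis .
    qed
    have "(\<integral>x. w x \<partial>M) = (\<integral>x. w x \<partial>N)" by (rule integral_trig_poly_cong[OF M N eq w])
    then show ?thesis
      using bd[OF M K1(1) _ K1(2)] bd[OF N K2(1) _ K2(2)] by (simp add: K_def abs_le_iff)
  qed
  note bd = this
  have "\<bar>(\<integral>x. g x \<partial>M) - (\<integral>x. g x \<partial>N)\<bar> \<le> 0 + \<delta>" if "0 < \<delta>" for \<delta>
  proof -
    have "\<bar>(\<integral>x. g x \<partial>M) - (\<integral>x. g x \<partial>N)\<bar> \<le> 8 * min (\<delta> / 8) 1" by (rule bd) (use that in auto)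
    also have "8 * min (\<delta> / 8) 1 \<le> \<delta>" by (simp add: min_def)
    finally show ?thesis by simp
  qed
  then have "\<bar>(\<integral>x. g x \<partial>M) - (\<integral>x. g x \<partial>N)\<bar> \<le> 0" by (rule field_le_epsilon)
  then show ?thesis by simp
qed

theorem measure_eqI_characteristic_functional:
  fixes M N :: "'a::{banach,second_countable_topology} measure"
  assumes M: "borel_prob M" and N: "borel_prob N"
    and eq: "\<And>f :: 'a \<Rightarrow>\<^sub>L real. (\<integral>x. cis (blinfun_apply f x) \<partial>M) = (\<integral>x. cis (blinfun_apply f x) \<partial>N)"
  shows "M = N"
proof -
  have closed_eq: "emeasure M F = emeasure N F" if F: "closed F" for F
  proof (cases "F = {}")
    case False
    define g where "g n x = max 0 (1 - real n * infdist x F)" for n x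
    have lim: "(\<lambda>n. \<integral>x. g n x \<partial>L) \<longlonglongrightarrow> measure L F" if L: "borel_prob L" for L
    proof -
      interpret prob_space L using L by (simp add: borel_prob_def)
      note [simp] = borel_prob_sets[OF L] borel_prob_space[OF L]
      have Fb: "F \<in> sets borel" using F by auto
      have "(\<lambda>n. \<integral>x. g n x \<partial>L) \<longlonglongrightarrow> (\<integral>x. indicator F x \<partial>L)"
      proof (rule integral_dominated_convergence[where w="\<lambda>_. 1"])
        have "g n \<in> borel_measurable borel" for n
          unfolding g_def by (intro borel_measurable_continuous_onI continuous_intros)
        then show "g n \<in> borel_measurable L" for n by (simp cong: measurable_cong_sets)
        show "AE x in L. (\<lambda>n. g n x) \<longlonglongrightarrow> indicator F x"
        proof (rule AE_I2)
          fix x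
          show "(\<lambda>n. g n x) \<longlonglongrightarrow> indicator F x"
          proof (cases "x \<in> F")
            case True
            then show ?thesis by (simp add: g_def)
          next
            case xF: False
            then have d: "infdist x F > 0"
              using in_closed_iff_infdist_zero[OF F False] infdist_nonneg[of x F] by fastforce
            obtain n0 :: nat where n0: "1 / infdist x F < n0" using reals_Archimedean2 by blast
            have "eventually (\<lambda>n. g n x = 0) sequentially"
            proof (rule eventually_sequentiallyI[of n0])
              fix n assume "n0 \<le> n"
              then have "1 / infdist x F < n" using n0 by linarith
              then show "g n x = 0" using d by (simp add: g_def field_simps)
            qed
            then show ?thesis using xF by (simp add: tendsto_eventually)
          qed
        qed
      qed (use Fb in \<open>auto simp: g_def infdist_nonneg cong: measurable_cong_sets\<close>)
      then show ?thesis using Fb by simp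
    qed
    have "(\<integral>x. g n x \<partial>M) = (\<integral>x. g n x \<partial>N)" for n
      by (rule integral_continuous_cong[OF M N eq]) (auto simp: g_def infdist_nonneg intro!: continuous_intros)
    then have "measure M F = measure N F" using lim[OF M] lim[OF N] LIMSEQ_unique by simp
    moreover have "finite_measure M" "finite_measure N"
      using M N by (auto simp: borel_prob_def intro: prob_space.finite_measure)
    ultimately show ?thesis by (simp add: finite_measure.emeasure_eq_measure)
  qed simp
  from M have fin: "emeasure M (space M) \<noteq> \<infinity>" by (simp add: borel_prob_def prob_space.emeasure_space_1)
  show ?thesis
  proof (rule measure_eqI_generator_eq[where E="Collect closed" and \<Omega>=UNIV and A="\<lambda>_. UNIV"])
    show "Int_stable (Collect (closed :: 'a set \<Rightarrow> bool))" by (auto simp: Int_stable_def)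
    show "sets M = sigma_sets UNIV (Collect closed)" "sets N = sigma_sets UNIV (Collect closed)"
      using M N by (simp_all add: borel_prob_def borel_eq_closed)
    show "emeasure M UNIV \<noteq> \<infinity>" using fin by (simp add: borel_prob_space[OF M])
  qed (auto simp: closed_eq)
qed

section \<open>Rotation invariance and square integrability of Gaussian measures\<close>

lemma
  fixes f :: "'a::real_normed_vector \<Rightarrow>\<^sub>L real"
  assumes \<gamma>: "centred_gaussian \<gamma>"
  shows gaussian_square_integrable: "integrable \<gamma> (\<lambda>x. (blinfun_apply f x)\<^sup>2)"
    and gaussian_char: "(\<integral>x. cis (blinfun_apply f x) \<partial>\<gamma>) = of_real (exp (- (\<integral>x. (blinfun_apply f x)\<^sup>2 \<partial>\<gamma>) / 2))"
proof -
  have b: "borel_prob \<gamma>" using \<gamma> by (simp add: centred_gaussian_def)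
  interpret prob_space \<gamma> using b by (simp add: borel_prob_def)
  have f[measurable]: "blinfun_apply f \<in> borel_measurable \<gamma>"
    using borel_measurable_continuous_onI[OF continuous_on_blinfun_apply, of f] borel_prob_sets[OF b]
    by (simp cong: measurable_cong_sets)
  have cis[measurable]: "cis \<in> borel_measurable borel"
    by (intro borel_measurable_continuous_onI) (auto simp: cis_conv_exp intro!: continuous_intros)
  have "integrable \<gamma> (\<lambda>x. (blinfun_apply f x)\<^sup>2) \<and>
    (\<integral>x. cis (blinfun_apply f x) \<partial>\<gamma>) = of_real (exp (- (\<integral>x. (blinfun_apply f x)\<^sup>2 \<partial>\<gamma>) / 2))"
  proof (cases "distr \<gamma> borel (blinfun_apply f) = return borel 0")
    case True
    have "AE s in distr \<gamma> borel (blinfun_apply f). s = 0"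
      unfolding True by (subst AE_return) auto
    then have "AE x in \<gamma>. blinfun_apply f x = 0"
      by (subst (asm) AE_distr_iff) auto
    then have ae: "AE x in \<gamma>. (blinfun_apply f x)\<^sup>2 = 0" "AE x in \<gamma>. cis (blinfun_apply f x) = 1" by auto
    have "integrable \<gamma> (\<lambda>x. (blinfun_apply f x)\<^sup>2) \<longleftrightarrow> integrable \<gamma> (\<lambda>x. 0 :: real)"
      by (rule integrable_cong_AE) (use ae in auto)
    moreover have "(\<integral>x. (blinfun_apply f x)\<^sup>2 \<partial>\<gamma>) = (\<integral>x. 0 \<partial>\<gamma>)"
      by (rule integral_cong_AE) (use ae in auto)
    moreover have "(\<integral>x. cis (blinfun_apply f x) \<partial>\<gamma>) = (\<integral>x. 1 \<partial>\<gamma>)"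
      by (rule integral_cong_AE) (use ae in auto)
    ultimately show ?thesis by (simp add: prob_space)
  next
    case False
    then obtain \<sigma> where \<sigma>: "\<sigma> > 0" "distr \<gamma> borel (blinfun_apply f) = density lborel (normal_density 0 \<sigma>)"
      using \<gamma> by (auto simp: centred_gaussian_def)
    have D: "distributed \<gamma> lborel (blinfun_apply f) (normal_density 0 \<sigma>)"
      unfolding distributed_def using \<sigma>(2) by (simp cong: distr_cong)
    have int2: "integrable \<gamma> (\<lambda>x. (blinfun_apply f x)\<^sup>2)"
      using distributed_integrable[OF D, of "\<lambda>s. s\<^sup>2"] integrable_normal_moment[OF \<sigma>(1), of 0 2] by simp
    have var: "(\<integral>x. (blinfun_apply f x)\<^sup>2 \<partial>\<gamma>) = \<sigma>\<^sup>2"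
      using normal_distributed_variance[OF \<sigma>(1) D] normal_distributed_expectation[OF \<sigma>(1) D] by simp
    have "distributed \<gamma> lborel (\<lambda>x. (blinfun_apply f x - 0) / \<sigma>) std_normal_density"
      using D normal_standard_normal_convert[OF \<sigma>(1)] by blast
    then have d: "distr \<gamma> borel (\<lambda>x. blinfun_apply f x / \<sigma>) = std_normal_distribution"
      by (simp add: distributed_def cong: distr_cong)
    have "(\<integral>x. cis (blinfun_apply f x) \<partial>\<gamma>) = (\<integral>x. cis (\<sigma> * (blinfun_apply f x / \<sigma>)) \<partial>\<gamma>)"
      using \<sigma>(1) by simp
    also have "\<dots> = (\<integral>s. cis (\<sigma> * s) \<partial>distr \<gamma> borel (\<lambda>x. blinfun_apply f x / \<sigma>))"
      by (subst integral_distr) auto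
    also have "\<dots> = char std_normal_distribution \<sigma>"
      unfolding d char_def by (simp add: cis_conv_exp)
    also have "\<dots> = of_real (exp (- \<sigma>\<^sup>2 / 2))" by (simp add: char_std_normal_distribution)
    finally show ?thesis using int2 var by simp
  qed
  then show "integrable \<gamma> (\<lambda>x. (blinfun_apply f x)\<^sup>2)"
    "(\<integral>x. cis (blinfun_apply f x) \<partial>\<gamma>) = of_real (exp (- (\<integral>x. (blinfun_apply f x)\<^sup>2 \<partial>\<gamma>) / 2))" by auto
qed

lemma borel_prob_pair:
  fixes M N :: "'a::second_countable_topology measure"
  assumes "borel_prob M" "borel_prob N"
  shows "borel_prob (M \<Otimes>\<^sub>M N)"
proof -
  interpret M: prob_space M using assms by (simp add: borel_prob_def)
  interpret N: prob_space N using assms by (simp add: borel_prob_def)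
  interpret pair_prob_space M N ..
  have "sets (M \<Otimes>\<^sub>M N) = sets (borel \<Otimes>\<^sub>M borel)"
    using assms by (intro sets_pair_measure_cong) (auto simp: borel_prob_def)
  then show ?thesis unfolding borel_prob_def borel_prod by (simp add: P.prob_space_axioms)
qed

lemma borel_prob_distr:
  assumes "borel_prob M" "f \<in> borel_measurable borel"
  shows "borel_prob (distr M borel f)"
proof -
  interpret prob_space M using assms by (simp add: borel_prob_def)
  show ?thesis unfolding borel_prob_def
    by (intro conjI prob_space_distr) (use assms in \<open>auto simp: borel_prob_def cong: measurable_cong_sets\<close>)
qed

lemma continuous_on_cis_blinfun: "continuous_on S (\<lambda>x. cis (blinfun_apply f x))"
  by (auto simp: cis_conv_exp intro!: continuous_intros continuous_on_blinfun_apply)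

definition blinfun_fst_part :: "(('a::real_normed_vector \<times> 'a) \<Rightarrow>\<^sub>L real) \<Rightarrow> 'a \<Rightarrow>\<^sub>L real" where
  "blinfun_fst_part F = Blinfun (\<lambda>x. blinfun_apply F (x, 0))"

definition blinfun_snd_part :: "(('a::real_normed_vector \<times> 'a) \<Rightarrow>\<^sub>L real) \<Rightarrow> 'a \<Rightarrow>\<^sub>L real" where
  "blinfun_snd_part F = Blinfun (\<lambda>x. blinfun_apply F (0, x))"

lemma blinfun_parts_apply:
  "blinfun_apply (blinfun_fst_part F) x = blinfun_apply F (x, 0)"
  "blinfun_apply (blinfun_snd_part F) x = blinfun_apply F (0, x)"
  unfolding blinfun_fst_part_def blinfun_snd_part_def
  by (subst bounded_linear_Blinfun_apply;
      auto intro!: bounded_linear_compose[OF blinfun.bounded_linear_right]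
        bounded_linear_Pair bounded_linear_ident bounded_linear_zero)+

lemma blinfun_pair_split:
  "blinfun_apply F (x, y) = blinfun_apply (blinfun_fst_part F) x + blinfun_apply (blinfun_snd_part F) y"
  by (simp add: blinfun_parts_apply blinfun.add_right[symmetric])

lemma char_pair_measure:
  fixes M N :: "'a::{banach,second_countable_topology} measure"
  assumes M: "borel_prob M" and N: "borel_prob N"
  shows "(\<integral>z. cis (blinfun_apply F z) \<partial>(M \<Otimes>\<^sub>M N)) =
    (\<integral>x. cis (blinfun_apply (blinfun_fst_part F) x) \<partial>M) * (\<integral>y. cis (blinfun_apply (blinfun_snd_part F) y) \<partial>N)"
proof -
  interpret M: prob_space M using M by (simp add: borel_prob_def)
  interpret N: prob_space N using N by (simp add: borel_prob_def)
  interpret pair_prob_space M N ..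
  have int: "integrable (M \<Otimes>\<^sub>M N) (\<lambda>z. cis (blinfun_apply F z))"
    by (rule integrable_bounded_continuous[OF borel_prob_pair[OF M N] continuous_on_cis_blinfun, where B=1]) simp
  have "(\<integral>z. cis (blinfun_apply F z) \<partial>(M \<Otimes>\<^sub>M N)) = (\<integral>x. (\<integral>y. cis (blinfun_apply F (x, y)) \<partial>N) \<partial>M)"
    by (rule integral_fst'[OF int, symmetric])
  also have "\<dots> = (\<integral>x. (\<integral>y. cis (blinfun_apply (blinfun_fst_part F) x) * cis (blinfun_apply (blinfun_snd_part F) y) \<partial>N) \<partial>M)"
    by (simp add: blinfun_pair_split cis_mult)
  finally show ?thesis by simp
qed

definition rot45 :: "'a::real_normed_vector \<times> 'a \<Rightarrow> 'a \<times> 'a" where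
  "rot45 z = ((1 / sqrt 2) *\<^sub>R (fst z - snd z), (1 / sqrt 2) *\<^sub>R (fst z + snd z))"

lemma bounded_linear_rot45: "bounded_linear rot45"
  unfolding rot45_def
  by (intro bounded_linear_Pair bounded_linear_scaleR_right[THEN bounded_linear_compose]
      bounded_linear_sub bounded_linear_add bounded_linear_fst bounded_linear_snd)

text \<open>A functional \<open>(x, y) \<mapsto> f x + g y\<close> becomes, after rotation, the pair \<open>(f + g) / sqrt 2\<close>,
  \<open>(g - f) / sqrt 2\<close>. By the parallelogram law the variances have the same sum, and the characteristic
  functional of a Gaussian product measure depends on that sum only.\<close>
lemma gaussian_pair_rot45:
  fixes \<gamma> :: "'a::{banach,second_countable_topology} measure"
  assumes \<gamma>: "centred_gaussian \<gamma>"
  shows "distr (\<gamma> \<Otimes>\<^sub>M \<gamma>) borel rot45 = \<gamma> \<Otimes>\<^sub>M \<gamma>"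
proof (rule measure_eqI_characteristic_functional)
  have b: "borel_prob \<gamma>" using \<gamma> by (simp add: centred_gaussian_def)
  have rm: "rot45 \<in> borel_measurable borel"
    by (intro borel_measurable_continuous_onI linear_continuous_on bounded_linear_rot45)
  show bp: "borel_prob (\<gamma> \<Otimes>\<^sub>M \<gamma>)" by (rule borel_prob_pair[OF b b])
  show "borel_prob (distr (\<gamma> \<Otimes>\<^sub>M \<gamma>) borel rot45)" by (rule borel_prob_distr[OF bp rm])
  fix F :: "('a \<times> 'a) \<Rightarrow>\<^sub>L real"
  define G where "G = F o\<^sub>L Blinfun rot45"
  have G: "blinfun_apply G z = blinfun_apply F (rot45 z)" for z
    by (simp add: G_def bounded_linear_Blinfun_apply[OF bounded_linear_rot45])
  define f g where "f = blinfun_fst_part F" and "g = blinfun_snd_part F"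
  let ?V = "\<lambda>h. \<integral>x. (blinfun_apply h x)\<^sup>2 \<partial>\<gamma>"
  have F: "blinfun_apply F (x, y) = blinfun_apply f x + blinfun_apply g y" for x y
    unfolding f_def g_def by (rule blinfun_pair_split)
  have G1: "blinfun_apply (blinfun_fst_part G) x = (1 / sqrt 2) * (blinfun_apply f x + blinfun_apply g x)" for x
    by (simp add: blinfun_parts_apply G rot45_def F blinfun.scaleR_right add_divide_distrib)
  have G2: "blinfun_apply (blinfun_snd_part G) x = (1 / sqrt 2) * (blinfun_apply g x - blinfun_apply f x)" for x
    by (simp add: blinfun_parts_apply G rot45_def F blinfun.scaleR_right blinfun.minus_right diff_divide_distrib)
  have V: "?V (blinfun_fst_part G) + ?V (blinfun_snd_part G) = ?V f + ?V g"
  proof -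
    have "?V (blinfun_fst_part G) + ?V (blinfun_snd_part G)
        = (\<integral>x. (blinfun_apply (blinfun_fst_part G) x)\<^sup>2 + (blinfun_apply (blinfun_snd_part G) x)\<^sup>2 \<partial>\<gamma>)"
      by (simp add: gaussian_square_integrable[OF \<gamma>])
    also have "\<dots> = (\<integral>x. (blinfun_apply f x)\<^sup>2 + (blinfun_apply g x)\<^sup>2 \<partial>\<gamma>)"
      by (intro Bochner_Integration.integral_cong)
         (simp_all add: G1 G2 power2_eq_square field_simps)
    finally show ?thesis by (simp add: gaussian_square_integrable[OF \<gamma>])
  qed
  have "(\<integral>z. cis (blinfun_apply F z) \<partial>distr (\<gamma> \<Otimes>\<^sub>M \<gamma>) borel rot45) = (\<integral>z. cis (blinfun_apply G z) \<partial>(\<gamma> \<Otimes>\<^sub>M \<gamma>))"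
    unfolding G using rm borel_prob_sets[OF bp]
    by (intro integral_distr borel_measurable_continuous_onI continuous_on_cis_blinfun) (simp cong: measurable_cong_sets)
  also have "\<dots> = of_real (exp (- (?V (blinfun_fst_part G) + ?V (blinfun_snd_part G)) / 2))"
    by (simp add: char_pair_measure[OF b b] gaussian_char[OF \<gamma>] exp_add[symmetric] of_real_mult[symmetric] add_divide_distrib del: of_real_mult)
  also have "\<dots> = (\<integral>z. cis (blinfun_apply F z) \<partial>(\<gamma> \<Otimes>\<^sub>M \<gamma>))"
    unfolding V by (simp add: char_pair_measure[OF b b] gaussian_char[OF \<gamma>] f_def g_def exp_add[symmetric] of_real_mult[symmetric] add_divide_distrib del: of_real_mult)
  finally show "(\<integral>z. cis (blinfun_apply F z) \<partial>distr (\<gamma> \<Otimes>\<^sub>M \<gamma>) borel rot45) = (\<integral>z. cis (blinfun_apply F z) \<partial>(\<gamma> \<Otimes>\<^sub>M \<gamma>))" .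
qed

text \<open>If \<open>\<parallel>x - y\<parallel> \<le> s * sqrt 2\<close> and \<open>\<parallel>x + y\<parallel> > t * sqrt 2\<close> then both \<open>x\<close> and \<open>y\<close> have norm above
  \<open>(t - s) / sqrt 2\<close>. Rotation invariance turns the left-hand side into the probability of the former
  event, and independence turns the latter into a square.\<close>
lemma gaussian_tail_squared:
  fixes \<gamma> :: "'a::{banach,second_countable_topology} measure"
  assumes \<gamma>: "centred_gaussian \<gamma>"
  shows "measure \<gamma> {x. norm x \<le> s} * measure \<gamma> {x. norm x > t} \<le> (measure \<gamma> {x. norm x > (t - s) / sqrt 2})\<^sup>2"
proof -
  have b: "borel_prob \<gamma>" using \<gamma> by (simp add: centred_gaussian_def)
  interpret G: prob_space \<gamma> using b by (simp add: borel_prob_def)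
  interpret pair_prob_space \<gamma> \<gamma> ..
  note bs = borel_prob_sets[OF b]
  have bp: "borel_prob (\<gamma> \<Otimes>\<^sub>M \<gamma>)" by (rule borel_prob_pair[OF b b])
  have S[measurable]: "{x. norm x \<le> s} \<in> sets \<gamma>" "{x. norm x > t} \<in> sets \<gamma>" "{x. norm x > u} \<in> sets \<gamma>" for s t u
    unfolding bs by measurable
  have rm: "rot45 \<in> measurable (\<gamma> \<Otimes>\<^sub>M \<gamma>) borel"
    using borel_measurable_continuous_onI[OF linear_continuous_on[OF bounded_linear_rot45]] borel_prob_sets[OF bp]
    by (simp cong: measurable_cong_sets)
  have prod: "measure (\<gamma> \<Otimes>\<^sub>M \<gamma>) (A \<times> B) = measure \<gamma> A * measure \<gamma> B" if "A \<in> sets \<gamma>" "B \<in> sets \<gamma>" for A B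
    using G.emeasure_pair_measure_Times[OF that] by (simp add: measure_def enn2real_mult)
  let ?u = "(t - s) / sqrt 2"
  have "measure \<gamma> {x. norm x \<le> s} * measure \<gamma> {x. norm x > t} = measure (\<gamma> \<Otimes>\<^sub>M \<gamma>) ({x. norm x \<le> s} \<times> {x. norm x > t})"
    by (simp add: prod)
  also have "\<dots> = measure (distr (\<gamma> \<Otimes>\<^sub>M \<gamma>) borel rot45) ({x. norm x \<le> s} \<times> {x. norm x > t})"
    by (simp add: gaussian_pair_rot45[OF \<gamma>])
  also have "\<dots> = measure (\<gamma> \<Otimes>\<^sub>M \<gamma>) (rot45 -` ({x. norm x \<le> s} \<times> {x. norm x > t}) \<inter> space (\<gamma> \<Otimes>\<^sub>M \<gamma>))"
    by (rule measure_distr[OF rm]) (auto simp: borel_prob_sets[OF bp, symmetric] intro!: pair_measureI)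
  also have "\<dots> \<le> measure (\<gamma> \<Otimes>\<^sub>M \<gamma>) ({x. norm x > ?u} \<times> {x. norm x > ?u})"
  proof (rule P.finite_measure_mono)
    show "rot45 -` ({x. norm x \<le> s} \<times> {x. norm x > t}) \<inter> space (\<gamma> \<Otimes>\<^sub>M \<gamma>) \<subseteq> {x. norm x > ?u} \<times> {x. norm x > ?u}"
    proof
      fix z assume z: "z \<in> rot45 -` ({x. norm x \<le> s} \<times> {x. norm x > t}) \<inter> space (\<gamma> \<Otimes>\<^sub>M \<gamma>)"
      obtain x y where xy: "z = (x, y)" by (cases z)
      have "rot45 (x, y) \<in> {x. norm x \<le> s} \<times> {x. norm x > t}" using z xy by simp
      then have "norm (x - y) / sqrt 2 \<le> s" "t < norm (x + y) / sqrt 2"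
        by (auto simp: rot45_def)
      then have 1: "norm (x - y) \<le> s * sqrt 2" "t * sqrt 2 < norm (x + y)"
        by (simp_all add: field_simps)
      have "x + y = 2 *\<^sub>R x - (x - y)" "x + y = 2 *\<^sub>R y + (x - y)" by (simp_all add: scaleR_2)
      then have "norm (x + y) \<le> 2 * norm x + norm (x - y)" "norm (x + y) \<le> 2 * norm y + norm (x - y)"
        using norm_triangle_ineq4[of "2 *\<^sub>R x" "x - y"] norm_triangle_ineq[of "2 *\<^sub>R y" "x - y"] by (metis norm_scaleR abs_numeral, metis norm_scaleR abs_numeral)
      with 1 have "(t - s) * sqrt 2 < 2 * norm x" "(t - s) * sqrt 2 < 2 * norm y" by (simp_all add: left_diff_distrib)
      moreover have "?u = (t - s) * sqrt 2 / 2"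
        by (simp add: field_simps)
      ultimately have "?u < norm x" "?u < norm y" by linarith+
      then show "z \<in> {x. norm x > ?u} \<times> {x. norm x > ?u}" by (simp add: xy)
    qed
  qed (auto intro!: pair_measureI)
  also have "\<dots> = (measure \<gamma> {x. norm x > ?u})\<^sup>2" by (simp add: prod power2_eq_square)
  finally show ?thesis .
qed

text \<open>A weak form of Fernique's theorem. Far out, the tail at level \<open>2 * t\<close> is at most the square of the tail
  at \<open>t\<close> up to a constant, hence at most a fixed small fraction of it, and the tails decay fast enough for a
  second moment.\<close>
lemma gaussian_norm_square_integrable:
  fixes \<gamma> :: "'a::{banach,second_countable_topology} measure"
  assumes \<gamma>: "centred_gaussian \<gamma>"
  shows "integrable \<gamma> (\<lambda>x. (norm x)\<^sup>2)"
proof -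
  have b: "borel_prob \<gamma>" using \<gamma> by (simp add: centred_gaussian_def)
  interpret prob_space \<gamma> using b by (simp add: borel_prob_def)
  note bs = borel_prob_sets[OF b] and bsp = borel_prob_space[OF b]
  have S[measurable]: "{x. norm x \<le> s} \<in> sets \<gamma>" "{x. norm x > s} \<in> sets \<gamma>" for s
    unfolding bs by measurable
  define Q where "Q t = measure \<gamma> {x. norm x > t}" for t
  have Qc: "measure \<gamma> {x. norm x \<le> s} = 1 - Q s" for s
  proof -
    have "{x. norm x \<le> s} = space \<gamma> - {x. norm x > s}" by (auto simp: bsp)
    then show ?thesis using prob_compl[OF S(2)] by (simp add: Q_def)
  qed
  have Qmono: "Q t \<le> Q s" if "s \<le> t" for s t
    unfolding Q_def by (rule finite_measure_mono) (use that in auto)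
  have Q0: "0 \<le> Q t" for t by (simp add: Q_def)
  have "(\<lambda>n. Q (real n)) \<longlonglongrightarrow> measure \<gamma> (\<Inter>n. {x. norm x > real n})"
    unfolding Q_def by (rule finite_Lim_measure_decseq) (auto simp: decseq_def)
  also have "(\<Inter>n. {x::'a. norm x > real n}) = {}" using reals_Archimedean2 less_asym by fastforce
  finally have lim: "(\<lambda>n. Q (real n)) \<longlonglongrightarrow> 0" by simp
  then have "eventually (\<lambda>n. Q (real n) < 1 / 64) sequentially" by (rule order_tendstoD) simp
  then obtain n where n: "Q (real n) < 1 / 64" by (auto simp: eventually_sequentially)
  define s where "s = real n + 1"
  have s: "s > 0" "Q s < 1 / 64" using n Qmono[of "real n" s] by (auto simp: s_def)
  have step: "Q (2 * t) \<le> Q t / 32" if t: "t \<ge> 2 * s" for t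
  proof -
    \<comment> \<open>For \<open>t \<ge> 2 * s\<close> the shifted and rescaled level \<open>(2 * t - s) / sqrt 2\<close> is at least \<open>t\<close>.\<close>
    have "sqrt 2 \<le> 3 / 2" by (rule real_le_lsqrt) (auto simp: power2_eq_square)
    then have "t * sqrt 2 \<le> t * (3 / 2)" using t s by (intro mult_left_mono) auto
    also have "\<dots> \<le> 2 * t - s" using t by simp
    finally have "t \<le> (2 * t - s) / sqrt 2" by (simp add: field_simps)
    then have "Q ((2 * t - s) / sqrt 2) \<le> Q t" by (rule Qmono)
    then have "(Q ((2 * t - s) / sqrt 2))\<^sup>2 \<le> (Q t)\<^sup>2" using Q0 by (intro power_mono) auto
    then have "(1 - Q s) * Q (2 * t) \<le> Q t * Q t"
      using gaussian_tail_squared[OF \<gamma>, of s "2 * t"] unfolding Qc Q_def[symmetric] power2_eq_square by linarith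
    also have "\<dots> \<le> 1 / 64 * Q t" using Qmono[of s t] s t Q0[of t] by (intro mult_right_mono) auto
    finally have "(1 - Q s) * Q (2 * t) \<le> Q t / 64" by simp
    moreover have "1 / 2 * Q (2 * t) \<le> (1 - Q s) * Q (2 * t)" using s Q0 by (intro mult_right_mono) auto
    ultimately show ?thesis by simp
  qed
  define t0 where "t0 = 2 * s"
  have t0: "t0 > 0" using s by (simp add: t0_def)
  \<comment> \<open>The factor 32 beats the growth of the squared level by 4 in each doubling.\<close>
  have decay: "Q (2 ^ n * t0) \<le> (1 / 32) ^ n" for n
  proof (induction n)
    case 0 then show ?case by (simp add: Q_def)
  next
    case (Suc n)
    have "1 * t0 \<le> 2 ^ n * t0" using t0 by (intro mult_right_mono) auto
    then have "Q (2 * (2 ^ n * t0)) \<le> Q (2 ^ n * t0) / 32" by (intro step) (simp add: t0_def)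
    then show ?case using Suc by (simp add: mult.assoc)
  qed
  have pw: "ennreal ((norm x)\<^sup>2) \<le> ennreal (t0\<^sup>2) + (\<Sum>n. ennreal ((2 ^ Suc n * t0)\<^sup>2) * indicator {x. norm x > 2 ^ n * t0} x)" for x :: 'a
  proof (cases "norm x \<le> t0")
    case True
    then have "ennreal ((norm x)\<^sup>2) \<le> ennreal (t0\<^sup>2)" by (intro ennreal_leI power_mono) auto
    then show ?thesis by (rule order_trans) simp
  next
    case False
    have "\<exists>n. norm x / t0 < 2 ^ n" by (rule real_arch_pow) simp
    then have ex: "\<exists>n. norm x \<le> 2 ^ n * t0" using t0 by (auto simp: field_simps intro: less_imp_le)
    define m where "m = (LEAST n. norm x \<le> 2 ^ n * t0)"
    have m: "norm x \<le> 2 ^ m * t0" unfolding m_def by (rule LeastI_ex[OF ex])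
    have "m \<noteq> 0" using m False by (intro notI) simp
    then obtain k where k: "m = Suc k" by (cases m) auto
    have k': "norm x > 2 ^ k * t0" using not_less_Least[of k "\<lambda>n. norm x \<le> 2 ^ n * t0"] k by (simp add: m_def)
    have "ennreal ((norm x)\<^sup>2) \<le> ennreal ((2 ^ Suc k * t0)\<^sup>2)"
      using m k by (intro ennreal_leI power_mono) auto
    also have "\<dots> = (\<Sum>n\<in>{k}. ennreal ((2 ^ Suc n * t0)\<^sup>2) * indicator {x. norm x > 2 ^ n * t0} x)" using k' by simp
    also have "\<dots> \<le> (\<Sum>n. ennreal ((2 ^ Suc n * t0)\<^sup>2) * indicator {x. norm x > 2 ^ n * t0} x)"
      by (rule sum_le_suminf) auto
    finally show ?thesis by (rule order_trans) simp
  qed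
  have "(\<integral>\<^sup>+x. ennreal ((norm x)\<^sup>2) \<partial>\<gamma>) \<le>
      (\<integral>\<^sup>+x. ennreal (t0\<^sup>2) + (\<Sum>n. ennreal ((2 ^ Suc n * t0)\<^sup>2) * indicator {x. norm x > 2 ^ n * t0} x) \<partial>\<gamma>)"
    by (intro nn_integral_mono pw)
  also have "\<dots> = ennreal (t0\<^sup>2) + (\<Sum>n. ennreal ((2 ^ Suc n * t0)\<^sup>2) * emeasure \<gamma> {x. norm x > 2 ^ n * t0})"
    by (subst nn_integral_add; (subst nn_integral_suminf)?)
       (auto simp: nn_integral_cmult_indicator emeasure_space_1)
  also have "\<dots> \<le> ennreal (t0\<^sup>2) + (\<Sum>n. ennreal (4 * t0\<^sup>2 * (1 / 8) ^ n))"
  proof (intro add_left_mono suminf_le allI)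
    fix n
    have "ennreal ((2 ^ Suc n * t0)\<^sup>2) * emeasure \<gamma> {x. norm x > 2 ^ n * t0} = ennreal ((2 ^ Suc n * t0)\<^sup>2 * Q (2 ^ n * t0))"
      by (simp add: emeasure_eq_measure Q_def ennreal_mult)
    also have "\<dots> \<le> ennreal ((2 ^ Suc n * t0)\<^sup>2 * (1 / 32) ^ n)"
      by (intro ennreal_leI mult_left_mono decay) auto
    also have "(2 ^ Suc n * t0)\<^sup>2 * (1 / 32) ^ n = 4 * t0\<^sup>2 * (1 / 8) ^ n"
    proof -
      have "(2 ^ Suc n * t0)\<^sup>2 * (1 / 32) ^ n = 4 * t0\<^sup>2 * (4 ^ n * (1 / 32) ^ n)"
        by (simp add: power_mult_distrib power2_eq_square) (simp add: power_mult_distrib[symmetric])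
      also have "(4 ^ n * (1 / 32) ^ n :: real) = (1 / 8) ^ n" by (simp add: power_mult_distrib[symmetric])
      finally show ?thesis .
    qed
    finally show "ennreal ((2 ^ Suc n * t0)\<^sup>2) * emeasure \<gamma> {x. norm x > 2 ^ n * t0} \<le> ennreal (4 * t0\<^sup>2 * (1 / 8) ^ n)" .
  qed auto
  also have "\<dots> = ennreal (t0\<^sup>2) + ennreal (\<Sum>n. 4 * t0\<^sup>2 * (1 / 8) ^ n)"
    by (subst suminf_ennreal2) (auto intro!: summable_mult summable_geometric)
  also have "\<dots> < \<infinity>" by simp
  finally have "(\<integral>\<^sup>+x. ennreal ((norm x)\<^sup>2) \<partial>\<gamma>) < \<infinity>" .
  moreover have "(\<lambda>x. (norm x)\<^sup>2) \<in> borel_measurable \<gamma>"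
    using bs by (simp cong: measurable_cong_sets)
  ultimately show ?thesis by (intro integrableI_bounded) auto
qed

section \<open>Square-integrable functions\<close>

definition square_integrable :: "'a measure \<Rightarrow> ('a \<Rightarrow> real) \<Rightarrow> bool" where
  "square_integrable M g \<longleftrightarrow> g \<in> borel_measurable M \<and> integrable M (\<lambda>x. (g x)\<^sup>2)"

lemma square_integrableD:
  "square_integrable M g \<Longrightarrow> g \<in> borel_measurable M"
  "square_integrable M g \<Longrightarrow> integrable M (\<lambda>x. (g x)\<^sup>2)"
  by (auto simp: square_integrable_def)

lemma integrable_mult_square_integrable:
  assumes "square_integrable M f" "square_integrable M g"
  shows "integrable M (\<lambda>x. f x * g x)"
proof (rule Bochner_Integration.integrable_bound)
  show "integrable M (\<lambda>x. (f x)\<^sup>2 + (g x)\<^sup>2)" using assms by (simp add: square_integrable_def)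
  show "(\<lambda>x. f x * g x) \<in> borel_measurable M" using assms by (auto simp: square_integrable_def)
  have "\<bar>a * b\<bar> \<le> a\<^sup>2 + b\<^sup>2" for a b :: real
  proof -
    have "2 * (\<bar>a\<bar> * \<bar>b\<bar>) \<le> a\<^sup>2 + b\<^sup>2" using sum_squares_bound[of "\<bar>a\<bar>" "\<bar>b\<bar>"] by simp
    moreover have "0 \<le> \<bar>a\<bar> * \<bar>b\<bar>" by simp
    ultimately show ?thesis unfolding abs_mult by linarith
  qed
  then show "AE x in M. norm (f x * g x) \<le> norm ((f x)\<^sup>2 + (g x)\<^sup>2)" by simp
qed

lemma square_integrable_add:
  assumes "square_integrable M f" "square_integrable M g"
  shows "square_integrable M (\<lambda>x. f x + g x)"
  using assms integrable_mult_square_integrable[OF assms]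
  by (auto simp: square_integrable_def power2_sum mult.assoc)

lemma square_integrable_scale:
  "square_integrable M f \<Longrightarrow> square_integrable M (\<lambda>x. c * f x)"
  by (auto simp: square_integrable_def power_mult_distrib)

lemma square_integrable_diff:
  assumes "square_integrable M f" "square_integrable M g"
  shows "square_integrable M (\<lambda>x. f x - g x)"
  using square_integrable_add[OF assms(1) square_integrable_scale[OF assms(2), of "-1"]] by simp

lemma l2_norm_nonneg: "0 \<le> l2_norm M g"
  by (simp add: l2_norm_def)

lemma l2_norm_square: "(l2_norm M g)\<^sup>2 = (\<integral>x. (g x)\<^sup>2 \<partial>M)"
  by (simp add: l2_norm_def)

lemma l2_norm_scale: "l2_norm M (\<lambda>x. c * g x) = \<bar>c\<bar> * l2_norm M g"
  by (simp add: l2_norm_def power_mult_distrib real_sqrt_mult)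

lemma l2_Cauchy_Schwarz:
  assumes "square_integrable M f" "square_integrable M g"
  shows "\<bar>\<integral>x. f x * g x \<partial>M\<bar> \<le> l2_norm M f * l2_norm M g"
proof -
  let ?F = "\<integral>x. (f x)\<^sup>2 \<partial>M" and ?G = "\<integral>x. (g x)\<^sup>2 \<partial>M" and ?B = "\<integral>x. f x * g x \<partial>M"
  have *: "0 \<le> s\<^sup>2 * ?F + 2 * (s * t) * ?B + t\<^sup>2 * ?G" for s t
  proof -
    have "0 \<le> (\<integral>x. (s * f x + t * g x)\<^sup>2 \<partial>M)" by simp
    also have "\<dots> = (\<integral>x. s\<^sup>2 * (f x)\<^sup>2 + 2 * (s * t) * (f x * g x) + t\<^sup>2 * (g x)\<^sup>2 \<partial>M)"
      by (simp add: power2_eq_square algebra_simps)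
    also have "\<dots> = s\<^sup>2 * ?F + 2 * (s * t) * ?B + t\<^sup>2 * ?G"
      using assms integrable_mult_square_integrable[OF assms] by (simp add: square_integrable_def)
    finally show ?thesis .
  qed
  have "?B\<^sup>2 \<le> ?F * ?G"
  proof (cases "?G = 0")
    case True
    have "?B = 0"
    proof (rule ccontr)
      assume B: "?B \<noteq> 0"
      have "0 \<le> ?F + 2 * (- (?F + 1) / (2 * ?B)) * ?B" using *[of 1 "- (?F + 1) / (2 * ?B)"] True by simp
      also have "\<dots> = - 1" using B by (simp add: field_simps)
      finally show False by simp
    qed
    then show ?thesis using True by simp
  next
    case False
    moreover have "?G \<ge> 0" by simp
    ultimately have G: "?G > 0" by linarith
    have "0 \<le> ?G * (?F * ?G - ?B\<^sup>2)"
      using *[of ?G "- ?B"] by (simp add: power2_eq_square algebra_simps)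
    then show ?thesis using G by (simp add: zero_le_mult_iff)
  qed
  then have "\<bar>?B\<bar> \<le> sqrt (?F * ?G)" using real_le_rsqrt[of "\<bar>?B\<bar>"] by simp
  then show ?thesis by (simp add: l2_norm_def real_sqrt_mult)
qed

lemma l2_norm_add:
  assumes "square_integrable M f" "square_integrable M g"
  shows "l2_norm M (\<lambda>x. f x + g x) \<le> l2_norm M f + l2_norm M g"
proof (rule power2_le_imp_le)
  have "(l2_norm M (\<lambda>x. f x + g x))\<^sup>2 = (\<integral>x. (f x)\<^sup>2 + 2 * (f x * g x) + (g x)\<^sup>2 \<partial>M)"
    unfolding l2_norm_square by (simp add: power2_eq_square algebra_simps)
  also have "\<dots> = (l2_norm M f)\<^sup>2 + 2 * (\<integral>x. f x * g x \<partial>M) + (l2_norm M g)\<^sup>2"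
    unfolding l2_norm_square
    using assms integrable_mult_square_integrable[OF assms] by (simp add: square_integrable_def)
  also have "\<dots> \<le> (l2_norm M f + l2_norm M g)\<^sup>2"
    using l2_Cauchy_Schwarz[OF assms] by (simp add: power2_sum)
  finally show "(l2_norm M (\<lambda>x. f x + g x))\<^sup>2 \<le> (l2_norm M f + l2_norm M g)\<^sup>2" .
qed (simp add: l2_norm_nonneg)

lemma l2_norm_cong_AE:
  assumes "AE x in M. f x = g x" "f \<in> borel_measurable M" "g \<in> borel_measurable M"
  shows "l2_norm M f = l2_norm M g"
proof -
  have "(\<integral>x. (f x)\<^sup>2 \<partial>M) = (\<integral>x. (g x)\<^sup>2 \<partial>M)"
    by (rule integral_cong_AE) (use assms in auto)
  then show ?thesis by (simp add: l2_norm_def)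
qed

lemma l2_norm_eq_0_imp_AE:
  assumes "square_integrable M g" "l2_norm M g = 0"
  shows "AE x in M. g x = 0"
proof -
  have "(\<integral>x. (g x)\<^sup>2 \<partial>M) = 0" using assms(2) by (simp add: l2_norm_def)
  then have "AE x in M. (g x)\<^sup>2 = 0"
    using integral_nonneg_eq_0_iff_AE[of M "\<lambda>x. (g x)\<^sup>2"] assms(1) by (simp add: square_integrable_def)
  then show ?thesis by simp
qed

section \<open>The Cameron--Martin space\<close>

locale gaussian_measure =
  fixes \<gamma> :: "'a::{banach,second_countable_topology} measure"
  assumes gaussian: "centred_gaussian \<gamma>"
begin

lemma borel_prob_gaussian: "borel_prob \<gamma>"
  using gaussian by (simp add: centred_gaussian_def)

sublocale prob_space \<gamma>
  using borel_prob_gaussian by (simp add: borel_prob_def)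

lemmas sets_gaussian[measurable_cong, simp] = borel_prob_sets[OF borel_prob_gaussian]
lemmas space_gaussian[simp] = borel_prob_space[OF borel_prob_gaussian]

lemma measurable_blinfun[measurable]: "blinfun_apply f \<in> borel_measurable borel"
  by (rule borel_measurable_continuous_onI[OF continuous_on_blinfun_apply])

lemma square_integrable_blinfun: "square_integrable \<gamma> (blinfun_apply f)"
  unfolding square_integrable_def using gaussian_square_integrable[OF gaussian] measurable_blinfun
  by (simp cong: measurable_cong_sets)

lemma dual_closureD: "g \<in> dual_closure \<gamma> \<Longrightarrow> square_integrable \<gamma> g"
  by (simp add: dual_closure_def square_integrable_def)

lemma blinfun_in_dual_closure: "blinfun_apply f \<in> dual_closure \<gamma>"
  using square_integrable_blinfun[of f] unfolding dual_closure_def square_integrable_def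
  by (auto intro!: exI[of _ f] simp: l2_norm_def)

lemma dual_closure_approx:
  assumes "g \<in> dual_closure \<gamma>" "\<epsilon> > 0"
  obtains f where "l2_norm \<gamma> (\<lambda>x. g x - blinfun_apply f x) < \<epsilon>"
  using assms by (auto simp: dual_closure_def)

lemma dual_closure_add:
  assumes "g \<in> dual_closure \<gamma>" "h \<in> dual_closure \<gamma>"
  shows "(\<lambda>x. g x + h x) \<in> dual_closure \<gamma>"
proof -
  note gh = dual_closureD[OF assms(1)] dual_closureD[OF assms(2)]
  have "\<exists>f. l2_norm \<gamma> (\<lambda>x. g x + h x - blinfun_apply f x) < \<epsilon>" if \<epsilon>: "\<epsilon> > 0" for \<epsilon>
  proof -
    obtain f1 where f1: "l2_norm \<gamma> (\<lambda>x. g x - blinfun_apply f1 x) < \<epsilon> / 2"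
      by (rule dual_closure_approx[OF assms(1), of "\<epsilon> / 2"]) (use \<epsilon> in auto)
    obtain f2 where f2: "l2_norm \<gamma> (\<lambda>x. h x - blinfun_apply f2 x) < \<epsilon> / 2"
      by (rule dual_closure_approx[OF assms(2), of "\<epsilon> / 2"]) (use \<epsilon> in auto)
    have "l2_norm \<gamma> (\<lambda>x. g x + h x - blinfun_apply (f1 + f2) x) =
        l2_norm \<gamma> (\<lambda>x. (g x - blinfun_apply f1 x) + (h x - blinfun_apply f2 x))"
      by (simp add: blinfun.add_left algebra_simps)
    also have "\<dots> \<le> l2_norm \<gamma> (\<lambda>x. g x - blinfun_apply f1 x) + l2_norm \<gamma> (\<lambda>x. h x - blinfun_apply f2 x)"
      by (intro l2_norm_add square_integrable_diff gh square_integrable_blinfun)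
    also have "\<dots> < \<epsilon>" using f1 f2 by simp
    finally show ?thesis by blast
  qed
  then show ?thesis using square_integrable_add[OF gh]
    by (simp add: dual_closure_def square_integrable_def)
qed

lemma dual_closure_scale:
  assumes "g \<in> dual_closure \<gamma>"
  shows "(\<lambda>x. c * g x) \<in> dual_closure \<gamma>"
proof -
  have c: "0 < \<bar>c\<bar> + 1" by simp
  have "\<exists>f. l2_norm \<gamma> (\<lambda>x. c * g x - blinfun_apply f x) < \<epsilon>" if \<epsilon>: "\<epsilon> > 0" for \<epsilon>
  proof -
    obtain f where f: "l2_norm \<gamma> (\<lambda>x. g x - blinfun_apply f x) < \<epsilon> / (\<bar>c\<bar> + 1)"
      using dual_closure_approx[OF assms, of "\<epsilon> / (\<bar>c\<bar> + 1)"] \<epsilon> c by auto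
    have "l2_norm \<gamma> (\<lambda>x. c * g x - blinfun_apply (c *\<^sub>R f) x) = \<bar>c\<bar> * l2_norm \<gamma> (\<lambda>x. g x - blinfun_apply f x)"
      by (simp add: l2_norm_scale[symmetric] blinfun.scaleR_left right_diff_distrib)
    also have "\<dots> \<le> \<bar>c\<bar> * (\<epsilon> / (\<bar>c\<bar> + 1))" using f by (intro mult_left_mono) auto
    also have "\<dots> < \<epsilon>" using \<epsilon> c by (simp add: field_simps)
    finally show ?thesis by blast
  qed
  then show ?thesis using square_integrable_scale[OF dual_closureD[OF assms]]
    by (simp add: dual_closure_def square_integrable_def)
qed

lemma dual_closure_diff:
  "g \<in> dual_closure \<gamma> \<Longrightarrow> h \<in> dual_closure \<gamma> \<Longrightarrow> (\<lambda>x. g x - h x) \<in> dual_closure \<gamma>"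
  using dual_closure_add[OF _ dual_closure_scale[of h "-1"], of g] by simp

lemma integrable_scaleR_id:
  assumes "square_integrable \<gamma> g"
  shows "integrable \<gamma> (\<lambda>x. g x *\<^sub>R x)"
proof (rule Bochner_Integration.integrable_bound)
  have g: "g \<in> borel_measurable borel" using assms by (simp add: square_integrable_def cong: measurable_cong_sets)
  have "square_integrable \<gamma> (norm :: 'a \<Rightarrow> real)"
    using gaussian_norm_square_integrable[OF gaussian]
    by (simp add: square_integrable_def cong: measurable_cong_sets)
  then show "integrable \<gamma> (\<lambda>x. g x * norm x)"
    by (rule integrable_mult_square_integrable[OF assms])
  show "(\<lambda>x. g x *\<^sub>R x) \<in> borel_measurable \<gamma>"
    using g by (auto cong: measurable_cong_sets intro!: borel_measurable_scaleR)
qed (simp add: abs_mult)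

lemma R_op_pairing:
  assumes "square_integrable \<gamma> g"
  shows "blinfun_apply f (R_op \<gamma> g) = (\<integral>x. g x * blinfun_apply f x \<partial>\<gamma>)"
  unfolding R_op_def
  using integral_bounded_linear[OF blinfun.bounded_linear_right integrable_scaleR_id[OF assms], of f]
  by (simp add: blinfun.scaleR_right)

lemma R_op_add:
  "square_integrable \<gamma> g \<Longrightarrow> square_integrable \<gamma> h \<Longrightarrow> R_op \<gamma> (\<lambda>x. g x + h x) = R_op \<gamma> g + R_op \<gamma> h"
  by (simp add: R_op_def scaleR_add_left integrable_scaleR_id)

lemma R_op_scale: "R_op \<gamma> (\<lambda>x. c * g x) = c *\<^sub>R R_op \<gamma> g"
  by (simp add: R_op_def flip: scaleR_scaleR)

lemma R_op_diff:
  "square_integrable \<gamma> g \<Longrightarrow> square_integrable \<gamma> h \<Longrightarrow> R_op \<gamma> (\<lambda>x. g x - h x) = R_op \<gamma> g - R_op \<gamma> h"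
  by (simp add: R_op_def scaleR_diff_left integrable_scaleR_id)

text \<open>Pairing with functionals shows that \<open>g\<close> is orthogonal to the whole dual space, in whose closure it lies.\<close>
lemma R_op_eq_0_imp_AE:
  assumes g: "g \<in> dual_closure \<gamma>" and "R_op \<gamma> g = 0"
  shows "AE x in \<gamma>. g x = 0"
proof -
  note sg = dual_closureD[OF g]
  have orth: "(\<integral>x. g x * blinfun_apply f x \<partial>\<gamma>) = 0" for f
    using R_op_pairing[OF sg, of f] assms(2) by (simp add: blinfun.zero_right)
  have le: "l2_norm \<gamma> g \<le> \<epsilon>" if "\<epsilon> > 0" for \<epsilon>
  proof -
    obtain f where f: "l2_norm \<gamma> (\<lambda>x. g x - blinfun_apply f x) < \<epsilon>"
      using dual_closure_approx[OF g \<open>\<epsilon> > 0\<close>] .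
    note sf = square_integrable_blinfun[of f]
    have "(l2_norm \<gamma> g)\<^sup>2 = (\<integral>x. g x * (g x - blinfun_apply f x) \<partial>\<gamma>)"
      using integrable_mult_square_integrable[OF sg sg] integrable_mult_square_integrable[OF sg sf]
      unfolding l2_norm_square by (simp add: right_diff_distrib orth power2_eq_square)
    also have "\<dots> \<le> l2_norm \<gamma> g * l2_norm \<gamma> (\<lambda>x. g x - blinfun_apply f x)"
      using l2_Cauchy_Schwarz[OF sg square_integrable_diff[OF sg sf]] by simp
    also have "\<dots> \<le> l2_norm \<gamma> g * \<epsilon>" using f l2_norm_nonneg by (intro mult_left_mono) auto
    finally show ?thesis using l2_norm_nonneg[of \<gamma> g] \<open>\<epsilon> > 0\<close>
      by (cases "l2_norm \<gamma> g = 0") (auto simp: power2_eq_square)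
  qed
  have "l2_norm \<gamma> g \<le> 0" by (rule field_le_epsilon) (simp add: le)
  then show ?thesis using l2_norm_eq_0_imp_AE[OF sg] l2_norm_nonneg[of \<gamma> g] by simp
qed

lemma cm_hat_R_op:
  assumes g: "g \<in> dual_closure \<gamma>"
  shows "cm_hat \<gamma> (R_op \<gamma> g) \<in> dual_closure \<gamma>" "AE x in \<gamma>. cm_hat \<gamma> (R_op \<gamma> g) x = g x"
proof -
  have *: "cm_hat \<gamma> (R_op \<gamma> g) \<in> dual_closure \<gamma> \<and> R_op \<gamma> (cm_hat \<gamma> (R_op \<gamma> g)) = R_op \<gamma> g"
    unfolding cm_hat_def by (rule someI[of _ g]) (use g in simp)
  then show "cm_hat \<gamma> (R_op \<gamma> g) \<in> dual_closure \<gamma>" by simp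
  have "AE x in \<gamma>. cm_hat \<gamma> (R_op \<gamma> g) x - g x = 0"
    by (rule R_op_eq_0_imp_AE) (use * g in \<open>auto intro: dual_closure_diff simp: R_op_diff dual_closureD\<close>)
  then show "AE x in \<gamma>. cm_hat \<gamma> (R_op \<gamma> g) x = g x" by simp
qed

lemma cm_norm_R_op:
  assumes "g \<in> dual_closure \<gamma>"
  shows "cm_norm \<gamma> (R_op \<gamma> g) = ennreal (l2_norm \<gamma> g)"
proof -
  have "l2_norm \<gamma> (cm_hat \<gamma> (R_op \<gamma> g)) = l2_norm \<gamma> g"
    using cm_hat_R_op[OF assms] dual_closureD assms
    by (intro l2_norm_cong_AE) (auto simp: square_integrable_def)
  then show ?thesis using assms by (auto simp: cm_norm_def cameron_martin_def)
qed

lemma cm_inner_R_op: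
  assumes "g \<in> dual_closure \<gamma>" "h \<in> dual_closure \<gamma>"
  shows "cm_inner \<gamma> (R_op \<gamma> g) (R_op \<gamma> h) = (\<integral>x. g x * h x \<partial>\<gamma>)"
  unfolding cm_inner_def
  using cm_hat_R_op[OF assms(1)] cm_hat_R_op[OF assms(2)] dual_closureD assms
  by (intro integral_cong_AE borel_measurable_times) (auto simp: square_integrable_def)

end

section \<open>Fourier expansion along an orthonormal basis\<close>

locale cm_basis = gaussian_measure +
  fixes e :: "nat \<Rightarrow> 'a" and e' :: "nat \<Rightarrow> 'a \<Rightarrow>\<^sub>L real"
  assumes basis: "cm_orthonormal_basis \<gamma> e"
    and e_eq: "e i = R_op \<gamma> (blinfun_apply (e' i))"
begin

abbreviation hat :: "nat \<Rightarrow> 'a \<Rightarrow> real" where "hat i \<equiv> blinfun_apply (e' i)"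

lemma hat_orthonormal: "(\<integral>x. hat i x * hat j x \<partial>\<gamma>) = (if i = j then 1 else 0)"
proof -
  have "cm_inner \<gamma> (e i) (e j) = (\<integral>x. hat i x * hat j x \<partial>\<gamma>)"
    unfolding e_eq by (rule cm_inner_R_op) (rule blinfun_in_dual_closure)+
  then show ?thesis using basis by (simp add: cm_orthonormal_basis_def)
qed

lemma blinfun_e: "blinfun_apply f (e i) = (\<integral>x. hat i x * blinfun_apply f x \<partial>\<gamma>)"
  unfolding e_eq by (rule R_op_pairing[OF square_integrable_blinfun])

lemma hat_e: "hat i (e j) = (if i = j then 1 else 0)"
  using hat_orthonormal[of j i] by (simp add: blinfun_e)

definition fourier_sum :: "(nat \<Rightarrow> real) \<Rightarrow> nat \<Rightarrow> 'a \<Rightarrow> real" where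
  "fourier_sum a k x = (\<Sum>i<k. a i * hat i x)"

lemma fourier_sum_blinfun: "fourier_sum a k = blinfun_apply (\<Sum>i<k. a i *\<^sub>R e' i)"
  by (simp add: fourier_sum_def fun_eq_iff blinfun.sum_left blinfun.scaleR_left)

lemma fourier_sum_dual_closure: "fourier_sum a k \<in> dual_closure \<gamma>"
  unfolding fourier_sum_blinfun by (rule blinfun_in_dual_closure)

lemmas square_integrable_fourier_sum = dual_closureD[OF fourier_sum_dual_closure]

lemma integral_mult_fourier_sum:
  assumes "square_integrable \<gamma> g"
  shows "(\<integral>x. g x * fourier_sum a k x \<partial>\<gamma>) = (\<Sum>i<k. a i * (\<integral>x. g x * hat i x \<partial>\<gamma>))"
proof -
  have "integrable \<gamma> (\<lambda>x. g x * hat i x)" for i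
    by (rule integrable_mult_square_integrable[OF assms square_integrable_blinfun])
  then show ?thesis by (simp add: fourier_sum_def sum_distrib_left mult.left_commute[of "g _"])
qed

lemma integral_fourier_sum_mult_hat:
  assumes "i < k"
  shows "(\<integral>x. fourier_sum a k x * hat i x \<partial>\<gamma>) = a i"
proof -
  have "(\<integral>x. hat i x * fourier_sum a k x \<partial>\<gamma>) = a i"
    unfolding integral_mult_fourier_sum[OF square_integrable_blinfun] hat_orthonormal
    using assms by (simp add: if_distrib[of "\<lambda>s. a _ * s"] cong: if_cong)
  then show ?thesis by (simp add: mult.commute)
qed

lemma integral_fourier_sum_square: "(\<integral>x. (fourier_sum a k x)\<^sup>2 \<partial>\<gamma>) = (\<Sum>i<k. (a i)\<^sup>2)"
proof -
  have "(\<integral>x. fourier_sum a k x * hat i x \<partial>\<gamma>) = a i" if "i < k" for i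
    using that by (rule integral_fourier_sum_mult_hat)
  then have "(\<integral>x. fourier_sum a k x * fourier_sum a k x \<partial>\<gamma>) = (\<Sum>i<k. a i * a i)"
    unfolding integral_mult_fourier_sum[OF square_integrable_fourier_sum] by simp
  then show ?thesis by (simp add: power2_eq_square)
qed

lemma integral_diff_fourier_sum_square:
  assumes g: "square_integrable \<gamma> g"
  shows "(\<integral>x. (g x - fourier_sum a k x)\<^sup>2 \<partial>\<gamma>) =
    (\<integral>x. (g x)\<^sup>2 \<partial>\<gamma>) - 2 * (\<Sum>i<k. a i * (\<integral>x. g x * hat i x \<partial>\<gamma>)) + (\<Sum>i<k. (a i)\<^sup>2)"
proof -
  have "(\<integral>x. (g x - fourier_sum a k x)\<^sup>2 \<partial>\<gamma>) =
      (\<integral>x. (g x)\<^sup>2 - 2 * (g x * fourier_sum a k x) + (fourier_sum a k x)\<^sup>2 \<partial>\<gamma>)"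
    by (simp add: power2_eq_square algebra_simps)
  also have "\<dots> = (\<integral>x. (g x)\<^sup>2 \<partial>\<gamma>) - 2 * (\<integral>x. g x * fourier_sum a k x \<partial>\<gamma>) + (\<integral>x. (fourier_sum a k x)\<^sup>2 \<partial>\<gamma>)"
    using integrable_mult_square_integrable[OF g square_integrable_fourier_sum, of a k]
      square_integrableD(2)[OF g] square_integrableD(2)[OF square_integrable_fourier_sum, of a k] by simp
  finally show ?thesis unfolding integral_mult_fourier_sum[OF g] integral_fourier_sum_square .
qed

lemma R_op_fourier_sum: "R_op \<gamma> (fourier_sum a k) = (\<Sum>i<k. a i *\<^sub>R e i)"
proof (induction k)
  case 0
  then show ?case by (simp add: fourier_sum_def R_op_def)
next
  case (Suc k)
  have "fourier_sum a (Suc k) = (\<lambda>x. fourier_sum a k x + a k * hat k x)"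
    by (simp add: fourier_sum_def fun_eq_iff)
  then show ?case
    by (simp add: Suc R_op_add square_integrable_fourier_sum square_integrable_scale square_integrable_blinfun R_op_scale e_eq)
qed

text \<open>The Cameron--Martin norm of \<open>P k x\<close>, in coordinates; unlike \<open>cm_norm\<close> it is finite and continuous on
  the whole space.\<close>
definition proj_norm :: "nat \<Rightarrow> 'a \<Rightarrow> real" where
  "proj_norm k x = sqrt (\<Sum>i<k. (hat i x)\<^sup>2)"

lemma proj_norm_nonneg: "0 \<le> proj_norm k x"
  by (simp add: proj_norm_def sum_nonneg)

lemma proj_norm_mono: "k \<le> m \<Longrightarrow> proj_norm k x \<le> proj_norm m x"
  unfolding proj_norm_def by (intro real_sqrt_le_mono sum_mono2) auto

lemma continuous_proj_norm: "continuous_on S (proj_norm k)"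
  unfolding proj_norm_def by (intro continuous_intros continuous_on_blinfun_apply)

text \<open>Bessel's inequality, from the nonnegativity of the squared distance to the Fourier partial sum.\<close>
lemma proj_norm_le_l2_norm:
  assumes g: "square_integrable \<gamma> g"
  shows "proj_norm k (R_op \<gamma> g) \<le> l2_norm \<gamma> g"
proof -
  have "0 \<le> (\<integral>x. (g x - fourier_sum (\<lambda>i. \<integral>x. g x * hat i x \<partial>\<gamma>) k x)\<^sup>2 \<partial>\<gamma>)" by simp
  then have "(\<Sum>i<k. (\<integral>x. g x * hat i x \<partial>\<gamma>)\<^sup>2) \<le> (\<integral>x. (g x)\<^sup>2 \<partial>\<gamma>)"
    unfolding integral_diff_fourier_sum_square[OF g] by (simp add: power2_eq_square)
  then show ?thesis by (simp add: proj_norm_def l2_norm_def R_op_pairing[OF g])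
qed

lemma proj_norm_le_cm_norm: "ennreal (proj_norm k x) \<le> cm_norm \<gamma> x"
proof (cases "x \<in> cameron_martin \<gamma>")
  case True
  then obtain g where "g \<in> dual_closure \<gamma>" "x = R_op \<gamma> g" by (auto simp: cameron_martin_def)
  then show ?thesis using proj_norm_le_l2_norm[of g k]
    by (simp add: cm_norm_R_op dual_closureD ennreal_leI)
qed (simp add: cm_norm_def)

abbreviation P :: "nat \<Rightarrow> 'a \<Rightarrow> 'a" where "P \<equiv> proj_d e' e"

lemma hat_P: "hat i (P d x) = (if i < d then hat i x else 0)"
  by (simp add: proj_d_def blinfun.sum_right blinfun.scaleR_right hat_e if_distrib[of "\<lambda>s. _ * s"] cong: if_cong)

lemma P_P: "P d (P d x) = P d x"
  unfolding proj_d_def[of e' e d "P d x"] hat_P by (simp add: proj_d_def)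

lemma bounded_linear_P: "bounded_linear (P d)"
  unfolding proj_d_def
  by (intro bounded_linear_sum bounded_linear_scaleR_left[THEN bounded_linear_compose] blinfun.bounded_linear_right)

lemma continuous_P: "continuous_on S (P d)"
  by (rule linear_continuous_on[OF bounded_linear_P])

lemma P_diff: "P d (x - y) = P d x - P d y"
  by (rule linear_diff[OF bounded_linear.linear[OF bounded_linear_P]])

lemma proj_norm_P: "proj_norm d (P d x) = proj_norm d x"
  by (simp add: proj_norm_def hat_P)

lemma cm_norm_P: "cm_norm \<gamma> (P d x) = ennreal (proj_norm d x)"
proof -
  have "P d x = R_op \<gamma> (fourier_sum (\<lambda>i. hat i x) d)"
    by (simp add: R_op_fourier_sum proj_d_def)
  then show ?thesis
    using cm_norm_R_op[OF fourier_sum_dual_closure] by (simp add: l2_norm_def integral_fourier_sum_square proj_norm_def)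
qed

lemma blinfun_P: "blinfun_apply f (P d x) = fourier_sum (\<lambda>i. blinfun_apply f (e i)) d x"
  by (simp add: proj_d_def fourier_sum_def blinfun.sum_right blinfun.scaleR_right mult.commute)

lemma span_e_explicit:
  assumes "v \<in> span (range e)"
  obtains a d where "v = (\<Sum>i<d. a i *\<^sub>R e i)"
proof -
  from assms have "\<exists>a d. v = (\<Sum>i<d. a i *\<^sub>R e i)"
  proof (induction rule: span_induct_alt)
    case base
    show ?case by (intro exI[of _ "\<lambda>_. 0"] exI[of _ 0]) simp
  next
    case (step c x y)
    obtain j where j: "x = e j" using step(1) by auto
    obtain a d where y: "y = (\<Sum>i<d. a i *\<^sub>R e i)" using step(2) by blast
    define D where "D = max d (Suc j)"
    define b where "b i = (if i < d then a i else 0) + (if i = j then c else 0)" for i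
    have "(\<Sum>i<D. (if i < d then a i else 0) *\<^sub>R e i) = (\<Sum>i<d. a i *\<^sub>R e i)"
      by (rule sum.mono_neutral_cong_right) (auto simp: D_def)
    moreover have "j < D" by (simp add: D_def)
    then have "(\<Sum>i<D. (if i = j then c else 0) *\<^sub>R e i) = c *\<^sub>R e j"
      by (simp add: if_distrib[of "\<lambda>s. s *\<^sub>R _"] cong: if_cong)
    ultimately have "c *\<^sub>R x + y = (\<Sum>i<D. b i *\<^sub>R e i)"
      unfolding b_def scaleR_add_left sum.distrib by (simp add: y j)
    then show ?case by blast
  qed
  then show thesis using that by blast
qed

text \<open>Density of the span of the basis in the Cameron--Martin space gives some combination of the \<open>e' i\<close>
  close to \<open>f\<close>; the Fourier partial sum of the same or larger length is the best approximation.\<close>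
lemma blinfun_P_tendsto_L2:
  "(\<lambda>d. l2_norm \<gamma> (\<lambda>x. blinfun_apply f x - blinfun_apply f (P d x))) \<longlonglongrightarrow> 0"
proof (rule LIMSEQ_I)
  fix \<epsilon> :: real assume \<epsilon>: "\<epsilon> > 0"
  let ?c = "\<lambda>i. \<integral>x. blinfun_apply f x * hat i x \<partial>\<gamma>"
  note sf = square_integrable_blinfun[of f]
  have c: "blinfun_apply f (e i) = ?c i" for i by (simp add: blinfun_e mult.commute)
  have "R_op \<gamma> (blinfun_apply f) \<in> cameron_martin \<gamma>"
    unfolding cameron_martin_def using blinfun_in_dual_closure by blast
  moreover have "0 < ennreal \<epsilon>" using \<epsilon> by simp
  ultimately obtain v where v: "v \<in> span (range e)" "cm_norm \<gamma> (R_op \<gamma> (blinfun_apply f) - v) < ennreal \<epsilon>"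
    using basis unfolding cm_orthonormal_basis_def by blast
  obtain a k where a: "v = (\<Sum>i<k. a i *\<^sub>R e i)" using span_e_explicit[OF v(1)] .
  have "R_op \<gamma> (blinfun_apply f) - v = R_op \<gamma> (\<lambda>x. blinfun_apply f x - fourier_sum a k x)"
    by (simp add: a R_op_fourier_sum R_op_diff sf square_integrable_fourier_sum)
  then have lt: "l2_norm \<gamma> (\<lambda>x. blinfun_apply f x - fourier_sum a k x) < \<epsilon>"
    using v(2)
    by (simp add: ennreal_less_iff[OF l2_norm_nonneg] cm_norm_R_op dual_closure_diff blinfun_in_dual_closure fourier_sum_dual_closure)
  show "\<exists>n0. \<forall>d\<ge>n0. norm (l2_norm \<gamma> (\<lambda>x. blinfun_apply f x - blinfun_apply f (P d x)) - 0) < \<epsilon>"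
  proof (intro exI[of _ k] allI impI)
    fix d assume "d \<ge> k"
    have "(\<integral>x. (blinfun_apply f x - blinfun_apply f (P d x))\<^sup>2 \<partial>\<gamma>) = (\<integral>x. (blinfun_apply f x)\<^sup>2 \<partial>\<gamma>) - (\<Sum>i<d. (?c i)\<^sup>2)"
      unfolding blinfun_P c integral_diff_fourier_sum_square[OF sf] by (simp add: power2_eq_square)
    also have "\<dots> \<le> (\<integral>x. (blinfun_apply f x)\<^sup>2 \<partial>\<gamma>) - (\<Sum>i<k. (?c i)\<^sup>2)"
      using \<open>d \<ge> k\<close> by (intro diff_left_mono sum_mono2) auto
    also have "\<dots> \<le> (\<integral>x. (blinfun_apply f x)\<^sup>2 \<partial>\<gamma>) - 2 * (\<Sum>i<k. a i * ?c i) + (\<Sum>i<k. (a i)\<^sup>2)"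
    proof -
      have "0 \<le> (\<Sum>i<k. (a i - ?c i)\<^sup>2)" by (simp add: sum_nonneg)
      also have "\<dots> = (\<Sum>i<k. (a i)\<^sup>2) - 2 * (\<Sum>i<k. a i * ?c i) + (\<Sum>i<k. (?c i)\<^sup>2)"
        by (simp add: power2_diff sum.distrib sum_subtractf sum_distrib_left mult.assoc)
      finally show ?thesis by simp
    qed
    also have "\<dots> = (\<integral>x. (blinfun_apply f x - fourier_sum a k x)\<^sup>2 \<partial>\<gamma>)"
      by (rule integral_diff_fourier_sum_square[OF sf, symmetric])
    finally have "l2_norm \<gamma> (\<lambda>x. blinfun_apply f x - blinfun_apply f (P d x)) \<le> l2_norm \<gamma> (\<lambda>x. blinfun_apply f x - fourier_sum a k x)"
      unfolding l2_norm_def by (rule real_sqrt_le_mono)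
    then show "norm (l2_norm \<gamma> (\<lambda>x. blinfun_apply f x - blinfun_apply f (P d x)) - 0) < \<epsilon>"
      using lt l2_norm_nonneg[of \<gamma> "\<lambda>x. blinfun_apply f x - blinfun_apply f (P d x)"] by simp
  qed
qed

end

section \<open>The Cameron--Martin norm as a supremum of projected norms\<close>

context cm_basis
begin

lemma prob_UNIV: "measure \<gamma> UNIV = 1"
  using prob_space by simp

lemma l2_dist_fourier_sum:
  "(\<integral>x. (fourier_sum a m x - fourier_sum a k x)\<^sup>2 \<partial>\<gamma>) = \<bar>(\<Sum>i<m. (a i)\<^sup>2) - (\<Sum>i<k. (a i)\<^sup>2)\<bar>"
proof -
  have *: "(\<integral>x. (fourier_sum a m x - fourier_sum a k x)\<^sup>2 \<partial>\<gamma>) = \<bar>(\<Sum>i<m. (a i)\<^sup>2) - (\<Sum>i<k. (a i)\<^sup>2)\<bar>"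
    if "k \<le> m" for k m
  proof -
    have "(\<integral>x. fourier_sum a m x * hat i x \<partial>\<gamma>) = a i" if "i < m" for i
      using that by (rule integral_fourier_sum_mult_hat)
    then have "(\<integral>x. (fourier_sum a m x - fourier_sum a k x)\<^sup>2 \<partial>\<gamma>) = (\<Sum>i<m. (a i)\<^sup>2) - (\<Sum>i<k. (a i)\<^sup>2)"
      using that unfolding integral_diff_fourier_sum_square[OF square_integrable_fourier_sum] integral_fourier_sum_square
      by (simp add: power2_eq_square)
    moreover have "(\<Sum>i<k. (a i)\<^sup>2) \<le> (\<Sum>i<m. (a i)\<^sup>2)" using that by (intro sum_mono2) auto
    ultimately show ?thesis by simp
  qed
  show ?thesis
  proof (cases "k \<le> m")
    case False
    then show ?thesis using *[of m k] by (simp add: power2_commute abs_minus_commute)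
  qed (rule *)
qed

text \<open>The Riesz--Fischer theorem: the limit is constructed almost everywhere along a fast subsequence, and
  Fatou's lemma bounds its distance from all partial sums.\<close>
lemma fourier_series_converges:
  assumes bdd: "\<And>k. (\<Sum>i<k. (a i)\<^sup>2) \<le> B"
  obtains g where "g \<in> dual_closure \<gamma>" "(\<lambda>k. l2_norm \<gamma> (\<lambda>x. g x - fourier_sum a k x)) \<longlonglongrightarrow> 0"
proof -
  define S where "S k = (\<Sum>i<k. (a i)\<^sup>2)" for k
  have Smono: "mono S" unfolding S_def by (intro monoI sum_mono2) auto
  obtain L where L: "S \<longlonglongrightarrow> L" "\<And>k. S k \<le> L"
    using incseq_convergent[of S B] Smono bdd by (auto simp: S_def)
  \<comment> \<open>Squared tails below \<open>(1 / 4) ^ n\<close> make consecutive distances at most \<open>(1 / 2) ^ n\<close>, which is summable.\<close>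
  have "\<exists>k. L - S k < (1 / 4) ^ n" for n
  proof -
    have "eventually (\<lambda>k. L - (1 / 4) ^ n < S k) sequentially"
      using L(1) by (rule order_tendstoD) simp
    then obtain k where "L - (1 / 4) ^ n < S k" by (auto simp: eventually_sequentially)
    then show ?thesis by (intro exI[of _ k]) simp
  qed
  then obtain r where r: "\<And>n. L - S (r n) < (1 / 4) ^ n" by metis
  define u where "u n = fourier_sum a (r n)" for n
  note sq = square_integrable_fourier_sum
  have um[measurable]: "u n \<in> borel_measurable \<gamma>" for n unfolding u_def using sq by (simp only: square_integrable_def)
  have fm[measurable]: "fourier_sum a k \<in> borel_measurable \<gamma>" for k using sq by (simp only: square_integrable_def)
  have step: "(\<integral>\<^sup>+x. ennreal \<bar>u (Suc n) x - u n x\<bar> \<partial>\<gamma>) \<le> ennreal ((1 / 2) ^ n)" for n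
  proof -
    have sqd: "square_integrable \<gamma> (\<lambda>x. \<bar>u (Suc n) x - u n x\<bar>)"
      using square_integrable_diff[OF sq sq, of a "r (Suc n)" a "r n"]
      by (auto simp: square_integrable_def u_def)
    have one: "square_integrable \<gamma> (\<lambda>x. 1)" by (simp add: square_integrable_def)
    have "integrable \<gamma> (\<lambda>x. \<bar>u (Suc n) x - u n x\<bar>)"
      using integrable_mult_square_integrable[OF sqd one] by simp
    then have "(\<integral>\<^sup>+x. ennreal \<bar>u (Suc n) x - u n x\<bar> \<partial>\<gamma>) = ennreal (\<integral>x. \<bar>u (Suc n) x - u n x\<bar> \<partial>\<gamma>)"
      by (rule nn_integral_eq_integral) simp
    also have "(\<integral>x. \<bar>u (Suc n) x - u n x\<bar> \<partial>\<gamma>) \<le> l2_norm \<gamma> (\<lambda>x. \<bar>u (Suc n) x - u n x\<bar>)"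
      using l2_Cauchy_Schwarz[OF sqd one] by (simp add: l2_norm_def prob_UNIV)
    also have "\<dots> = sqrt \<bar>S (r (Suc n)) - S (r n)\<bar>"
      by (simp add: l2_norm_def u_def l2_dist_fourier_sum S_def)
    also have "\<dots> \<le> sqrt ((1 / 4) ^ n)"
    proof (rule real_sqrt_le_mono)
      have "L - S (r (Suc n)) \<le> (1 / 4) ^ n"
        using r[of "Suc n"] by (simp add: field_simps)
      then show "\<bar>S (r (Suc n)) - S (r n)\<bar> \<le> (1 / 4) ^ n"
        using r[of n] L(2)[of "r n"] L(2)[of "r (Suc n)"] by linarith
    qed
    also have "sqrt ((1 / 4) ^ n) = (1 / 2) ^ n"
      by (simp add: real_sqrt_power real_sqrt_divide)
    finally show ?thesis by (simp add: ennreal_leI)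
  qed
  have "(\<integral>\<^sup>+x. (\<Sum>n. ennreal \<bar>u (Suc n) x - u n x\<bar>) \<partial>\<gamma>) = (\<Sum>n. \<integral>\<^sup>+x. ennreal \<bar>u (Suc n) x - u n x\<bar> \<partial>\<gamma>)"
    by (rule nn_integral_suminf) measurable
  also have "\<dots> \<le> (\<Sum>n. ennreal ((1 / 2) ^ n))" by (intro suminf_le step) auto
  also have "\<dots> = ennreal (\<Sum>n. (1 / 2) ^ n)" by (rule suminf_ennreal2) (auto intro: summable_geometric)
  also have "\<dots> < \<infinity>" by simp
  finally have "(\<integral>\<^sup>+x. (\<Sum>n. ennreal \<bar>u (Suc n) x - u n x\<bar>) \<partial>\<gamma>) \<noteq> \<infinity>" by simp
  then have "AE x in \<gamma>. (\<Sum>n. ennreal \<bar>u (Suc n) x - u n x\<bar>) \<noteq> \<infinity>"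
    by (intro nn_integral_PInf_AE) auto
  then have conv: "AE x in \<gamma>. convergent (\<lambda>n. u n x)"
  proof eventually_elim
    fix x assume "(\<Sum>n. ennreal \<bar>u (Suc n) x - u n x\<bar>) \<noteq> \<infinity>"
    then have "summable (\<lambda>n. \<bar>u (Suc n) x - u n x\<bar>)" by (intro summable_suminf_not_top) auto
    then have "summable (\<lambda>n. u (Suc n) x - u n x)" by (rule summable_rabs_cancel)
    then have "convergent (\<lambda>n. \<Sum>i<n. u (Suc i) x - u i x)" by (simp add: summable_iff_convergent)
    then have "convergent (\<lambda>n. u n x - u 0 x)"
      unfolding sum_lessThan_telescope[of "\<lambda>i. u i x"] .
    from convergent_add[OF this convergent_const[of "u 0 x"]]
    show "convergent (\<lambda>n. u n x)" by simp
  qed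
  define g where "g x = lim (\<lambda>n. u n x)" for x
  have gm[measurable]: "g \<in> borel_measurable \<gamma>" unfolding g_def by measurable
  have fatou: "(\<integral>\<^sup>+x. ennreal ((g x - fourier_sum a k x)\<^sup>2) \<partial>\<gamma>) \<le> ennreal (L - S k)" for k
  proof -
    have "(\<integral>\<^sup>+x. ennreal ((g x - fourier_sum a k x)\<^sup>2) \<partial>\<gamma>) =
        (\<integral>\<^sup>+x. liminf (\<lambda>n. ennreal ((u n x - fourier_sum a k x)\<^sup>2)) \<partial>\<gamma>)"
    proof (rule nn_integral_cong_AE)
      show "AE x in \<gamma>. ennreal ((g x - fourier_sum a k x)\<^sup>2) = liminf (\<lambda>n. ennreal ((u n x - fourier_sum a k x)\<^sup>2))"
        using conv
      proof eventually_elim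
        fix x assume "convergent (\<lambda>n. u n x)"
        then have "(\<lambda>n. u n x) \<longlonglongrightarrow> g x" by (simp add: g_def convergent_LIMSEQ_iff)
        then have "(\<lambda>n. ennreal ((u n x - fourier_sum a k x)\<^sup>2)) \<longlonglongrightarrow> ennreal ((g x - fourier_sum a k x)\<^sup>2)"
          by (intro tendsto_ennrealI tendsto_intros)
        then show "ennreal ((g x - fourier_sum a k x)\<^sup>2) = liminf (\<lambda>n. ennreal ((u n x - fourier_sum a k x)\<^sup>2))"
          using lim_imp_Liminf[OF sequentially_bot] by metis
      qed
    qed
    also have "\<dots> \<le> liminf (\<lambda>n. \<integral>\<^sup>+x. ennreal ((u n x - fourier_sum a k x)\<^sup>2) \<partial>\<gamma>)"
      by (rule nn_integral_liminf) measurable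
    also have "(\<lambda>n. \<integral>\<^sup>+x. ennreal ((u n x - fourier_sum a k x)\<^sup>2) \<partial>\<gamma>) = (\<lambda>n. ennreal \<bar>S (r n) - S k\<bar>)"
    proof
      fix n
      have "integrable \<gamma> (\<lambda>x. (u n x - fourier_sum a k x)\<^sup>2)"
        using square_integrable_diff[OF sq sq, of a "r n" a k] by (simp add: square_integrable_def u_def)
      then have "(\<integral>\<^sup>+x. ennreal ((u n x - fourier_sum a k x)\<^sup>2) \<partial>\<gamma>) = ennreal (\<integral>x. (u n x - fourier_sum a k x)\<^sup>2 \<partial>\<gamma>)"
        by (rule nn_integral_eq_integral) simp
      then show "(\<integral>\<^sup>+x. ennreal ((u n x - fourier_sum a k x)\<^sup>2) \<partial>\<gamma>) = ennreal \<bar>S (r n) - S k\<bar>"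
        by (simp add: u_def l2_dist_fourier_sum S_def)
    qed
    also have "liminf (\<lambda>n. ennreal \<bar>S (r n) - S k\<bar>) = ennreal \<bar>L - S k\<bar>"
    proof (rule lim_imp_Liminf)
      have "(\<lambda>n. S (r n)) \<longlonglongrightarrow> L"
      proof (rule real_tendsto_sandwich)
        show "eventually (\<lambda>n. L - (1 / 4) ^ n \<le> S (r n)) sequentially"
        proof (intro always_eventually allI)
          fix n
          show "L - (1 / 4) ^ n \<le> S (r n)" using r[of n] by linarith
        qed
        have "(\<lambda>n. L - (1 / 4) ^ n) \<longlonglongrightarrow> L - 0" by (intro tendsto_intros LIMSEQ_power_zero) auto
        then show "(\<lambda>n. L - (1 / 4) ^ n) \<longlonglongrightarrow> L" by simp
      qed (use L(2) in auto)
      then show "(\<lambda>n. ennreal \<bar>S (r n) - S k\<bar>) \<longlonglongrightarrow> ennreal \<bar>L - S k\<bar>"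
        by (intro tendsto_ennrealI tendsto_intros)
    qed simp
    also have "\<bar>L - S k\<bar> = L - S k" using L(2) by simp
    finally show ?thesis .
  qed
  have gk: "square_integrable \<gamma> (\<lambda>x. g x - fourier_sum a k x)" for k
    unfolding square_integrable_def
  proof
    show "integrable \<gamma> (\<lambda>x. (g x - fourier_sum a k x)\<^sup>2)"
    proof (rule integrableI_bounded)
      show "(\<integral>\<^sup>+x. ennreal (norm ((g x - fourier_sum a k x)\<^sup>2)) \<partial>\<gamma>) < \<infinity>"
        using fatou[of k] by (simp add: le_less_trans)
    qed measurable
  qed measurable
  have le: "l2_norm \<gamma> (\<lambda>x. g x - fourier_sum a k x) \<le> sqrt (L - S k)" for k
  proof -
    have "ennreal (\<integral>x. (g x - fourier_sum a k x)\<^sup>2 \<partial>\<gamma>) \<le> ennreal (L - S k)"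
      using fatou[of k] nn_integral_eq_integral[OF square_integrableD(2)[OF gk]] by simp
    then have "(\<integral>x. (g x - fourier_sum a k x)\<^sup>2 \<partial>\<gamma>) \<le> L - S k"
      using L(2)[of k] by (simp add: ennreal_le_iff)
    then show ?thesis unfolding l2_norm_def by (rule real_sqrt_le_mono)
  qed
  have lim: "(\<lambda>k. l2_norm \<gamma> (\<lambda>x. g x - fourier_sum a k x)) \<longlonglongrightarrow> 0"
  proof (rule real_tendsto_sandwich)
    show "eventually (\<lambda>k. 0 \<le> l2_norm \<gamma> (\<lambda>x. g x - fourier_sum a k x)) sequentially" by (simp add: l2_norm_nonneg)
    show "eventually (\<lambda>k. l2_norm \<gamma> (\<lambda>x. g x - fourier_sum a k x) \<le> sqrt (L - S k)) sequentially" using le by simp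
    have "(\<lambda>k. sqrt (L - S k)) \<longlonglongrightarrow> sqrt (L - L)" by (intro tendsto_intros L(1))
    then show "(\<lambda>k. sqrt (L - S k)) \<longlonglongrightarrow> 0" by simp
  qed (auto simp: l2_norm_nonneg)
  have "\<exists>f. l2_norm \<gamma> (\<lambda>x. g x - blinfun_apply f x) < \<epsilon>" if \<epsilon>: "\<epsilon> > 0" for \<epsilon>
  proof -
    obtain k where "l2_norm \<gamma> (\<lambda>x. g x - fourier_sum a k x) < \<epsilon>"
      using order_tendstoD(2)[OF lim \<epsilon>] by (auto simp: eventually_sequentially)
    then show ?thesis unfolding fourier_sum_blinfun by blast
  qed
  moreover have "square_integrable \<gamma> g" using gk[of 0] by (simp add: fourier_sum_def)
  ultimately have "g \<in> dual_closure \<gamma>" by (simp add: dual_closure_def square_integrable_def)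
  then show thesis using lim that by blast
qed

definition cm_sup :: "'a \<Rightarrow> ennreal" where
  "cm_sup x = (SUP k. ennreal (proj_norm k x))"

lemma cm_sup_le_cm_norm: "cm_sup x \<le> cm_norm \<gamma> x"
  unfolding cm_sup_def by (intro SUP_least proj_norm_le_cm_norm)

lemma proj_norm_le_cm_sup: "ennreal (proj_norm k x) \<le> cm_sup x"
  unfolding cm_sup_def by (rule SUP_upper) simp

text \<open>If the projected norms stay bounded, the Fourier series with coefficients \<open>hat i x\<close> converges in
  \<open>L\<^sup>2(\<gamma>)\<close> to some \<open>g\<close>, and \<open>P k x\<close> converges weakly to \<open>R_op \<gamma> g\<close>. The assumed convergence along
  subsequences identifies this limit as \<open>x\<close>. The subsequence may depend on the functional because the
  weak limit is already known to exist along the full sequence.\<close>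
lemma cm_norm_eq_cm_sup:
  fixes f :: "nat \<Rightarrow> 'a \<Rightarrow>\<^sub>L real"
  assumes sep: "\<And>x y. (\<And>j. blinfun_apply (f j) x = blinfun_apply (f j) y) \<Longrightarrow> x = y"
    and lim: "\<And>j. \<exists>s. strict_mono s \<and> (\<lambda>k. blinfun_apply (f j) (P (s k) x)) \<longlonglongrightarrow> blinfun_apply (f j) x"
  shows "cm_norm \<gamma> x = cm_sup x"
proof (cases "cm_sup x = \<infinity>")
  case True
  then show ?thesis using cm_sup_le_cm_norm[of x] by (simp add: top_unique)
next
  case False
  then obtain B where B: "B \<ge> 0" "cm_sup x = ennreal B" by (cases "cm_sup x") auto
  have pB: "proj_norm k x \<le> B" for k using proj_norm_le_cm_sup[of k x] B by simp
  have "(\<Sum>i<k. (hat i x)\<^sup>2) \<le> B\<^sup>2" for k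
    using pB[of k] B(1) by (simp add: proj_norm_def real_sqrt_le_iff[of _ "B\<^sup>2", symmetric] del: real_sqrt_le_iff)
  then obtain g where g: "g \<in> dual_closure \<gamma>" "(\<lambda>k. l2_norm \<gamma> (\<lambda>y. g y - fourier_sum (\<lambda>i. hat i x) k y)) \<longlonglongrightarrow> 0"
    by (rule fourier_series_converges)
  note sg = dual_closureD[OF g(1)]
  have "x = R_op \<gamma> g"
  proof (rule sep)
    fix j
    obtain s where s: "strict_mono s" "(\<lambda>k. blinfun_apply (f j) (P (s k) x)) \<longlonglongrightarrow> blinfun_apply (f j) x"
      using lim by blast
    have "(\<lambda>k. blinfun_apply (f j) (P k x)) \<longlonglongrightarrow> blinfun_apply (f j) (R_op \<gamma> g)"
    proof (rule Lim_null_comparison[THEN LIM_zero_cancel])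
      let ?F = "blinfun_apply (f j)"
      have "norm (?F (P k x) - ?F (R_op \<gamma> g)) \<le> l2_norm \<gamma> ?F * l2_norm \<gamma> (\<lambda>y. g y - fourier_sum (\<lambda>i. hat i x) k y)" for k
      proof -
        have "P k x = R_op \<gamma> (fourier_sum (\<lambda>i. hat i x) k)" by (simp add: R_op_fourier_sum proj_d_def)
        then have "?F (R_op \<gamma> g) - ?F (P k x) = ?F (R_op \<gamma> (\<lambda>y. g y - fourier_sum (\<lambda>i. hat i x) k y))"
          by (simp add: R_op_diff sg square_integrable_fourier_sum blinfun.diff_right)
        also have "\<dots> = (\<integral>y. (g y - fourier_sum (\<lambda>i. hat i x) k y) * ?F y \<partial>\<gamma>)"
          by (intro R_op_pairing square_integrable_diff sg square_integrable_fourier_sum)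
        also have "\<bar>\<dots>\<bar> \<le> l2_norm \<gamma> (\<lambda>y. g y - fourier_sum (\<lambda>i. hat i x) k y) * l2_norm \<gamma> ?F"
          by (intro l2_Cauchy_Schwarz square_integrable_diff sg square_integrable_fourier_sum square_integrable_blinfun)
        finally show ?thesis by (simp add: abs_minus_commute mult.commute)
      qed
      then show "eventually (\<lambda>k. norm (?F (P k x) - ?F (R_op \<gamma> g)) \<le> l2_norm \<gamma> ?F * l2_norm \<gamma> (\<lambda>y. g y - fourier_sum (\<lambda>i. hat i x) k y)) sequentially"
        by simp
      show "(\<lambda>k. l2_norm \<gamma> ?F * l2_norm \<gamma> (\<lambda>y. g y - fourier_sum (\<lambda>i. hat i x) k y)) \<longlonglongrightarrow> 0"
        using tendsto_mult_left[OF g(2)] by simp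
    qed
    then have "(\<lambda>k. blinfun_apply (f j) (P (s k) x)) \<longlonglongrightarrow> blinfun_apply (f j) (R_op \<gamma> g)"
      by (rule LIMSEQ_subseq_LIMSEQ[OF _ s(1), unfolded comp_def])
    then show "blinfun_apply (f j) x = blinfun_apply (f j) (R_op \<gamma> g)"
      using s(2) LIMSEQ_unique by blast
  qed
  then have cm: "cm_norm \<gamma> x = ennreal (l2_norm \<gamma> g)" using cm_norm_R_op[OF g(1)] by simp
  have "l2_norm \<gamma> g \<le> B"
  proof (rule LIMSEQ_le_const)
    have "(\<lambda>k. l2_norm \<gamma> (\<lambda>y. g y - fourier_sum (\<lambda>i. hat i x) k y) + B) \<longlonglongrightarrow> 0 + B"
      by (intro tendsto_intros g(2))
    then show "(\<lambda>k. l2_norm \<gamma> (\<lambda>y. g y - fourier_sum (\<lambda>i. hat i x) k y) + B) \<longlonglongrightarrow> B" by simp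
    have "l2_norm \<gamma> g \<le> l2_norm \<gamma> (\<lambda>y. g y - fourier_sum (\<lambda>i. hat i x) k y) + B" for k
    proof -
      have "l2_norm \<gamma> g = l2_norm \<gamma> (\<lambda>y. (g y - fourier_sum (\<lambda>i. hat i x) k y) + fourier_sum (\<lambda>i. hat i x) k y)" by simp
      also have "\<dots> \<le> l2_norm \<gamma> (\<lambda>y. g y - fourier_sum (\<lambda>i. hat i x) k y) + l2_norm \<gamma> (fourier_sum (\<lambda>i. hat i x) k)"
        by (intro l2_norm_add square_integrable_diff sg square_integrable_fourier_sum)
      also have "l2_norm \<gamma> (fourier_sum (\<lambda>i. hat i x) k) = proj_norm k x"
        by (simp add: l2_norm_def integral_fourier_sum_square proj_norm_def)
      finally show ?thesis using pB[of k] by simp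
    qed
    then show "\<exists>N. \<forall>n\<ge>N. l2_norm \<gamma> g \<le> l2_norm \<gamma> (\<lambda>y. g y - fourier_sum (\<lambda>i. hat i x) n y) + B" by blast
  qed
  then have "cm_norm \<gamma> x \<le> cm_sup x" by (simp add: cm B(2) ennreal_leI)
  then show ?thesis using cm_sup_le_cm_norm[of x] by simp
qed

lemma
  fixes f :: "'a \<Rightarrow>\<^sub>L real"
  shows integrable_blinfun_diff_P: "integrable \<gamma> (\<lambda>x. blinfun_apply f x - blinfun_apply f (P d x))"
  and blinfun_P_tendsto_L1: "(\<lambda>d. \<integral>x. \<bar>blinfun_apply f x - blinfun_apply f (P d x)\<bar> \<partial>\<gamma>) \<longlonglongrightarrow> 0"
proof -
  have one: "square_integrable \<gamma> (\<lambda>x. 1)" by (simp add: square_integrable_def)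
  have sq: "square_integrable \<gamma> (\<lambda>x. blinfun_apply f x - blinfun_apply f (P d x))" for d
    unfolding blinfun_P by (intro square_integrable_diff square_integrable_blinfun square_integrable_fourier_sum)
  show "integrable \<gamma> (\<lambda>x. blinfun_apply f x - blinfun_apply f (P d x))" for d
    using integrable_mult_square_integrable[OF sq one] by simp
  have sqa: "square_integrable \<gamma> (\<lambda>x. \<bar>blinfun_apply f x - blinfun_apply f (P d x)\<bar>)" for d
    using sq[of d] by (auto simp: square_integrable_def)
  show "(\<lambda>d. \<integral>x. \<bar>blinfun_apply f x - blinfun_apply f (P d x)\<bar> \<partial>\<gamma>) \<longlonglongrightarrow> 0"
  proof (rule real_tendsto_sandwich[OF _ _ tendsto_const blinfun_P_tendsto_L2])
    show "eventually (\<lambda>d. (\<integral>x. \<bar>blinfun_apply f x - blinfun_apply f (P d x)\<bar> \<partial>\<gamma>) \<le>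
        l2_norm \<gamma> (\<lambda>x. blinfun_apply f x - blinfun_apply f (P d x))) sequentially"
      using l2_Cauchy_Schwarz[OF sqa one] by (intro always_eventually allI) (simp add: l2_norm_def prob_UNIV)
  qed simp
qed

lemma blinfun_P_subseq_AE:
  fixes f :: "'a \<Rightarrow>\<^sub>L real"
  assumes r: "strict_mono (r :: nat \<Rightarrow> nat)"
  obtains s where "strict_mono s" "AE x in \<gamma>. (\<lambda>k. blinfun_apply f (P (r (s k)) x)) \<longlonglongrightarrow> blinfun_apply f x"
proof -
  obtain s :: "nat \<Rightarrow> nat" where s: "strict_mono s"
    "AE x in \<gamma>. (\<lambda>k. blinfun_apply f x - blinfun_apply f (P (r (s k)) x)) \<longlonglongrightarrow> 0"
    using tendsto_L1_AE_subseq[of \<gamma> "\<lambda>n x. blinfun_apply f x - blinfun_apply f (P (r n) x)"]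
      integrable_blinfun_diff_P LIMSEQ_subseq_LIMSEQ[OF blinfun_P_tendsto_L1 r, of f, unfolded comp_def] by auto
  have "AE x in \<gamma>. (\<lambda>k. blinfun_apply f (P (r (s k)) x)) \<longlonglongrightarrow> blinfun_apply f x"
    using s(2)
  proof eventually_elim
    fix x assume "(\<lambda>k. blinfun_apply f x - blinfun_apply f (P (r (s k)) x)) \<longlonglongrightarrow> 0"
    from tendsto_diff[OF tendsto_const[of "blinfun_apply f x"] this]
    show "(\<lambda>k. blinfun_apply f (P (r (s k)) x)) \<longlonglongrightarrow> blinfun_apply f x" by simp
  qed
  then show thesis using that s(1) by blast
qed

text \<open>\<open>G\<close> consists of the points where \<open>f j (P d x)\<close> tends to \<open>f j x\<close>, for each functional of a countable
  separating family, along a subsequence chosen for that functional. This property passes to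
  differences.\<close>
lemma cm_norm_diff_eq_cm_sup_AE:
  obtains G where "AE x in \<gamma>. x \<in> G" "\<And>x y. x \<in> G \<Longrightarrow> y \<in> G \<Longrightarrow> cm_norm \<gamma> (x - y) = cm_sup (x - y)"
proof -
  obtain f :: "nat \<Rightarrow> 'a \<Rightarrow>\<^sub>L real"
    where sep: "\<And>x y. (\<And>j. blinfun_apply (f j) x = blinfun_apply (f j) y) \<Longrightarrow> x = y"
    using countable_separating_functionals by blast
  have "\<exists>s. strict_mono s \<and> (AE x in \<gamma>. (\<lambda>k. blinfun_apply (f j) (P (s k) x)) \<longlonglongrightarrow> blinfun_apply (f j) x)" for j
    by (rule blinfun_P_subseq_AE[of id "f j"]) (auto simp: strict_mono_id)
  then obtain s where s: "\<And>j. strict_mono (s j)"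
    "\<And>j. AE x in \<gamma>. (\<lambda>k. blinfun_apply (f j) (P (s j k) x)) \<longlonglongrightarrow> blinfun_apply (f j) x" by metis
  let ?G = "{x. \<forall>j. (\<lambda>k. blinfun_apply (f j) (P (s j k) x)) \<longlonglongrightarrow> blinfun_apply (f j) x}"
  show thesis
  proof (rule that[of ?G])
    show "AE x in \<gamma>. x \<in> ?G" using s(2) by (simp add: AE_all_countable)
    fix x y assume xy: "x \<in> ?G" "y \<in> ?G"
    show "cm_norm \<gamma> (x - y) = cm_sup (x - y)"
    proof (rule cm_norm_eq_cm_sup[OF sep])
      fix j
      have "(\<lambda>k. blinfun_apply (f j) (P (s j k) x) - blinfun_apply (f j) (P (s j k) y)) \<longlonglongrightarrow> blinfun_apply (f j) x - blinfun_apply (f j) y"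
        using xy by (intro tendsto_diff) auto
      then show "\<exists>s. strict_mono s \<and> (\<lambda>k. blinfun_apply (f j) (P (s k) (x - y))) \<longlonglongrightarrow> blinfun_apply (f j) (x - y)"
        using s(1)[of j] by (auto simp: P_diff blinfun.diff_right)
    qed
  qed
qed

lemma measurable_P[measurable]: "P d \<in> borel_measurable borel"
  by (rule borel_measurable_continuous_onI[OF continuous_P])

lemma blinfun_P_tendsto_prob:
  fixes f :: "'a \<Rightarrow>\<^sub>L real"
  assumes \<delta>: "\<delta> > 0"
  shows "(\<lambda>d. measure \<gamma> {x. \<delta> \<le> \<bar>blinfun_apply f x - blinfun_apply f (P d x)\<bar>}) \<longlonglongrightarrow> 0"
proof (rule real_tendsto_sandwich)
  show "eventually (\<lambda>d. 0 \<le> measure \<gamma> {x. \<delta> \<le> \<bar>blinfun_apply f x - blinfun_apply f (P d x)\<bar>}) sequentially" by simp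
  show "eventually (\<lambda>d. measure \<gamma> {x. \<delta> \<le> \<bar>blinfun_apply f x - blinfun_apply f (P d x)\<bar>} \<le>
      (\<integral>x. \<bar>blinfun_apply f x - blinfun_apply f (P d x)\<bar> \<partial>\<gamma>) / \<delta>) sequentially"
    using integral_Markov_inequality_measure[of \<gamma> "\<lambda>x. \<bar>blinfun_apply f x - blinfun_apply f (P _ x)\<bar>" UNIV \<delta>]
      integrable_blinfun_diff_P \<delta> by (intro always_eventually allI) auto
  show "(\<lambda>d. (\<integral>x. \<bar>blinfun_apply f x - blinfun_apply f (P d x)\<bar> \<partial>\<gamma>) / \<delta>) \<longlonglongrightarrow> 0"
    using tendsto_divide[OF blinfun_P_tendsto_L1 tendsto_const[of \<delta>]] \<delta> by simp
qed auto

text \<open>The sets \<open>W m \<delta>\<close> are neighbourhoods of \<open>K\<close> in the topology of the first \<open>m\<close> functionals. Since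
  \<open>f j (P d x)\<close> tends to \<open>f j x\<close> in probability, \<open>P d -` W m \<delta>\<close> lies in \<open>W m (2 * \<delta>)\<close> up to an event of
  small probability; and \<open>K\<close>, being compact, is the intersection of countably many of these sets.\<close>
lemma compact_measure_ge:
  assumes K: "compact K"
    and nbd: "\<And>U \<epsilon>. open U \<Longrightarrow> K \<subseteq> U \<Longrightarrow> \<epsilon> > 0 \<Longrightarrow> \<exists>\<^sub>F d in sequentially. c - \<epsilon> \<le> measure \<gamma> (P d -` U)"
  shows "c \<le> measure \<gamma> K"
proof -
  obtain f :: "nat \<Rightarrow> 'a \<Rightarrow>\<^sub>L real"
    where sep: "\<And>x y. (\<And>j. blinfun_apply (f j) x = blinfun_apply (f j) y) \<Longrightarrow> x = y"
    using countable_separating_functionals by blast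
  define W where "W m \<delta> = (\<Union>k\<in>K. \<Inter>j<m. {x. \<bar>blinfun_apply (f j) x - blinfun_apply (f j) k\<bar> < \<delta>})" for m and \<delta> :: real
  have Wopen: "open (W m \<delta>)" for m \<delta>
    unfolding W_def
    by (intro open_UN ballI open_INT finite_lessThan open_Collect_less continuous_intros continuous_on_blinfun_apply)
  have Wb[measurable]: "W m \<delta> \<in> sets borel" for m \<delta> using Wopen by auto
  have KW: "K \<subseteq> W m \<delta>" if "\<delta> > 0" for m \<delta> using that by (auto simp: W_def)
  have cW: "c \<le> measure \<gamma> (W m (2 * \<delta>))" if \<delta>: "\<delta> > 0" for m \<delta>
  proof (rule field_le_epsilon)
    fix \<epsilon> :: real assume \<epsilon>: "\<epsilon> > 0"
    let ?B = "\<lambda>d j. {x. \<delta> \<le> \<bar>blinfun_apply (f j) x - blinfun_apply (f j) (P d x)\<bar>}"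
    have "(\<lambda>d. \<Sum>j<m. measure \<gamma> (?B d j)) \<longlonglongrightarrow> (\<Sum>j<m. 0)"
      by (intro tendsto_sum blinfun_P_tendsto_prob \<delta>)
    then have "eventually (\<lambda>d. (\<Sum>j<m. measure \<gamma> (?B d j)) < \<epsilon> / 2) sequentially"
      using \<epsilon> by (intro order_tendstoD(2)) auto
    then have "\<exists>\<^sub>F d in sequentially. (\<Sum>j<m. measure \<gamma> (?B d j)) < \<epsilon> / 2 \<and> c - \<epsilon> / 2 \<le> measure \<gamma> (P d -` W m \<delta>)"
      using nbd[OF Wopen KW[OF \<delta>], of "\<epsilon> / 2" m] \<epsilon> by (intro frequently_eventually_conj) auto
    then obtain d where d: "c - \<epsilon> / 2 \<le> measure \<gamma> (P d -` W m \<delta>)" "(\<Sum>j<m. measure \<gamma> (?B d j)) < \<epsilon> / 2"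
      using frequently_ex by blast
    have Bb: "?B d j \<in> sets \<gamma>" for j by simp
    have "P d -` W m \<delta> \<subseteq> W m (2 * \<delta>) \<union> (\<Union>j<m. ?B d j)"
    proof
      fix x assume x: "x \<in> P d -` W m \<delta>"
      then obtain k where k: "k \<in> K" "\<And>j. j < m \<Longrightarrow> \<bar>blinfun_apply (f j) (P d x) - blinfun_apply (f j) k\<bar> < \<delta>"
        by (auto simp: W_def)
      show "x \<in> W m (2 * \<delta>) \<union> (\<Union>j<m. ?B d j)"
      proof (cases "\<exists>j<m. x \<in> ?B d j")
        case False
        then have "\<bar>blinfun_apply (f j) x - blinfun_apply (f j) k\<bar> < 2 * \<delta>" if "j < m" for j
        proof -
          have "\<bar>blinfun_apply (f j) x - blinfun_apply (f j) (P d x)\<bar> < \<delta>" using False that by auto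
          then show ?thesis using k(2)[OF that] by linarith
        qed
        then show ?thesis using k(1) by (auto simp: W_def)
      qed auto
    qed
    then have "measure \<gamma> (P d -` W m \<delta>) \<le> measure \<gamma> (W m (2 * \<delta>) \<union> (\<Union>j<m. ?B d j))"
      using Bb by (intro finite_measure_mono) auto
    also have "\<dots> \<le> measure \<gamma> (W m (2 * \<delta>)) + measure \<gamma> (\<Union>j<m. ?B d j)"
      using Bb by (intro measure_Un_le) auto
    also have "measure \<gamma> (\<Union>j<m. ?B d j) \<le> (\<Sum>j<m. measure \<gamma> (?B d j))"
      using Bb by (intro measure_UNION_le) auto
    finally show "c \<le> measure \<gamma> (W m (2 * \<delta>)) + \<epsilon>" using d by linarith
  qed
  define V where "V m = W m (1 / real (Suc m))" for m
  have cV: "c \<le> measure \<gamma> (V m)" for m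
  proof -
    have "2 * (1 / (2 * real (Suc m))) = 1 / real (Suc m)" by (simp only: divide_simps) simp
    then show ?thesis using cW[of "1 / (2 * real (Suc m))" m] by (simp only: V_def) simp
  qed
  have "decseq V"
  proof (rule decseq_SucI)
    fix m
    have "1 / real (Suc (Suc m)) \<le> 1 / real (Suc m)" by (simp add: frac_le)
    then have le: "t < 1 / real (Suc m)" if "t < 1 / real (Suc (Suc m))" for t :: real using that by linarith
    show "V (Suc m) \<subseteq> V m"
    proof
      fix x assume "x \<in> V (Suc m)"
      then obtain k where "k \<in> K" "\<And>j. j < Suc m \<Longrightarrow> \<bar>blinfun_apply (f j) x - blinfun_apply (f j) k\<bar> < 1 / real (Suc (Suc m))"
        unfolding V_def W_def by blast
      then show "x \<in> V m" unfolding V_def W_def using le by (blast intro: less_SucI)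
    qed
  qed
  moreover have "range V \<subseteq> sets \<gamma>" unfolding V_def by auto
  ultimately have "(\<lambda>m. measure \<gamma> (V m)) \<longlonglongrightarrow> measure \<gamma> (\<Inter>m. V m)"
    by (intro finite_Lim_measure_decseq)
  moreover have "(\<Inter>m. V m) = K"
  proof
    show "K \<subseteq> (\<Inter>m. V m)" unfolding V_def by (intro INT_greatest KW) simp
    show "(\<Inter>m. V m) \<subseteq> K"
    proof
      fix x assume "x \<in> (\<Inter>m. V m)"
      then have "\<forall>m. \<exists>k\<in>K. \<forall>j<m. \<bar>blinfun_apply (f j) x - blinfun_apply (f j) k\<bar> < 1 / real (Suc m)"
        unfolding V_def W_def by blast
      then obtain k where k: "\<And>m. k m \<in> K" "\<And>m j. j < m \<Longrightarrow> \<bar>blinfun_apply (f j) x - blinfun_apply (f j) (k m)\<bar> < 1 / real (Suc m)"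
        by metis
      obtain l s where l: "l \<in> K" "strict_mono s" "(k \<circ> s) \<longlonglongrightarrow> l"
        using K k(1) unfolding compact_def by metis
      have "x = l"
      proof (rule sep)
        fix j
        have 1: "(\<lambda>n. blinfun_apply (f j) (k (s n))) \<longlonglongrightarrow> blinfun_apply (f j) l"
          using l(3) by (intro blinfun.tendsto tendsto_const) (simp add: comp_def)
        have "(\<lambda>n. blinfun_apply (f j) x - blinfun_apply (f j) (k n)) \<longlonglongrightarrow> 0"
        proof (rule Lim_null_comparison)
          show "eventually (\<lambda>n. norm (blinfun_apply (f j) x - blinfun_apply (f j) (k n)) \<le> 1 / real (Suc n)) sequentially"
            by (rule eventually_sequentiallyI[of "Suc j"]) (use k(2) in \<open>auto intro: less_imp_le\<close>)
          show "(\<lambda>n. 1 / real (Suc n)) \<longlonglongrightarrow> 0" by (rule LIMSEQ_Suc[OF lim_1_over_n])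
        qed
        then have "(\<lambda>n. blinfun_apply (f j) x - blinfun_apply (f j) (k (s n))) \<longlonglongrightarrow> 0"
          using LIMSEQ_subseq_LIMSEQ[OF _ l(2)] by (fastforce simp: comp_def)
        moreover have "(\<lambda>n. blinfun_apply (f j) x - blinfun_apply (f j) (k (s n))) \<longlonglongrightarrow> blinfun_apply (f j) x - blinfun_apply (f j) l"
          by (intro tendsto_intros 1)
        ultimately show "blinfun_apply (f j) x = blinfun_apply (f j) l"
          using LIMSEQ_unique by fastforce
      qed
      then show "x \<in> K" using l(1) by simp
    qed
  qed
  ultimately show ?thesis using cV by (intro LIMSEQ_le_const) auto
qed

end

section \<open>Weak limits and rotations of finite sums\<close>

lemma weakly_converges_cis:
  assumes w: "weakly_converges M L" and g: "continuous_on UNIV (g :: 'b::t2_space \<Rightarrow> real)"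
    and M: "\<And>n. borel_prob (M n)" and L: "borel_prob L"
  shows "(\<lambda>n. \<integral>x. cis (g x) \<partial>M n) \<longlonglongrightarrow> (\<integral>x. cis (g x) \<partial>L)"
proof -
  have c: "continuous_on UNIV (\<lambda>x. cis (g x))"
    unfolding cis_conv_exp by (intro continuous_intros g)
  have int: "integrable N (\<lambda>x. cis (g x))" if "borel_prob N" for N
    by (rule integrable_bounded_continuous[OF that c, of 1]) simp
  have Re: "Re (\<integral>x. cis (g x) \<partial>N) = (\<integral>x. cos (g x) \<partial>N)" if "borel_prob N" for N
    using integral_Re[OF int[OF that]] by simp
  have Im: "Im (\<integral>x. cis (g x) \<partial>N) = (\<integral>x. sin (g x) \<partial>N)" if "borel_prob N" for N
    using integral_Im[OF int[OF that]] by simp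
  have "continuous_on UNIV (\<lambda>x. cos (g x))" "continuous_on UNIV (\<lambda>x. sin (g x))"
    by (intro continuous_intros g)+
  moreover have "bounded (range (\<lambda>x. cos (g x)))" "bounded (range (\<lambda>x. sin (g x)))"
    by (auto intro!: boundedI[of _ 1])
  ultimately show ?thesis
    using w unfolding weakly_converges_def tendsto_complex_iff Re[OF M] Re[OF L] Im[OF M] Im[OF L] by blast
qed

lemma sum_rotate:
  fixes u :: "nat \<Rightarrow> 'a::comm_monoid_add"
  shows "(\<Sum>i\<le>n. u (if i = n then 0 else Suc i)) = (\<Sum>i\<le>n. u i)"
proof -
  have "(\<Sum>i\<le>n. u (if i = n then 0 else Suc i)) = (\<Sum>i<n. u (if i = n then 0 else Suc i)) + u 0"
    by (simp add: lessThan_Suc_atMost[symmetric])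
  also have "(\<Sum>i<n. u (if i = n then 0 else Suc i)) = (\<Sum>i<n. u (Suc i))"
    by (rule sum.cong) auto
  also have "(\<Sum>i<n. u (Suc i)) + u 0 = (\<Sum>i<Suc n. u i)"
    unfolding sum.lessThan_Suc_shift by (simp add: add.commute)
  finally show ?thesis by (simp add: lessThan_Suc_atMost)
qed

definition clip :: "nat \<Rightarrow> real \<Rightarrow> real" where
  "clip m s = max (- real m) (min (real m) s)"

lemma clip_bounded: "\<bar>clip m s\<bar> \<le> real m"
  by (auto simp: clip_def)

lemma clip_lipschitz: "\<bar>clip m s - clip m t\<bar> \<le> \<bar>s - t\<bar>"
  by (auto simp: clip_def)

lemma continuous_on_clip: "continuous_on S g \<Longrightarrow> continuous_on S (\<lambda>x. clip m (g x))"
  unfolding clip_def by (intro continuous_intros)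

lemma clip_tendsto: "(\<lambda>m. clip m s) \<longlonglongrightarrow> s"
proof (rule tendsto_eventually)
  obtain n where "\<bar>s\<bar> \<le> real n" using real_arch_simple by blast
  then show "eventually (\<lambda>m. clip m s = s) sequentially"
    by (intro eventually_sequentiallyI[of n]) (auto simp: clip_def)
qed

text \<open>The potential need not be integrable, only the difference \<open>u x - u y\<close> is. Truncated potentials are
  bounded, and truncation being a contraction lets dominated convergence remove it.\<close>
lemma integral_potential_difference_cong:
  fixes u :: "'a::{banach,second_countable_topology} \<Rightarrow> real"
  assumes \<rho>: "borel_prob \<rho>" and \<rho>': "borel_prob \<rho>'"
    and u: "continuous_on UNIV u"
    and c: "\<And>z. \<bar>u (fst z) - u (snd z)\<bar> \<le> c z" "integrable \<rho> c" "integrable \<rho>' c"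
    and fst: "\<And>m. (\<integral>z. clip m (u (fst z)) \<partial>\<rho>) = (\<integral>z. clip m (u (fst z)) \<partial>\<rho>')"
    and snd: "\<And>m. (\<integral>z. clip m (u (snd z)) \<partial>\<rho>) = (\<integral>z. clip m (u (snd z)) \<partial>\<rho>')"
  shows "(\<integral>z. u (fst z) - u (snd z) \<partial>\<rho>) = (\<integral>z. u (fst z) - u (snd z) \<partial>\<rho>')"
proof -
  have uc: "continuous_on UNIV (\<lambda>z. u (fst z))" "continuous_on UNIV (\<lambda>z. u (snd z))"
    by (intro continuous_on_compose2[OF u] continuous_intros; simp)+
  define g where "g m z = clip m (u (fst z)) - clip m (u (snd z))" for m z
  have lim: "(\<lambda>m. \<integral>z. g m z \<partial>\<tau>) \<longlonglongrightarrow> (\<integral>z. u (fst z) - u (snd z) \<partial>\<tau>)"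
    if \<tau>: "borel_prob \<tau>" "integrable \<tau> c" for \<tau>
  proof (rule integral_dominated_convergence[OF _ _ \<tau>(2)])
    show "(\<lambda>z. u (fst z) - u (snd z)) \<in> borel_measurable \<tau>" "\<And>m. g m \<in> borel_measurable \<tau>"
      unfolding g_def measurable_cong_sets[OF borel_prob_sets[OF \<tau>(1)] refl]
      by (intro borel_measurable_continuous_onI continuous_intros uc continuous_on_clip)+
    show "AE z in \<tau>. (\<lambda>m. g m z) \<longlonglongrightarrow> u (fst z) - u (snd z)"
      unfolding g_def by (intro AE_I2 tendsto_diff clip_tendsto)
    show "AE z in \<tau>. norm (g m z) \<le> c z" for m
    proof (rule AE_I2)
      fix z show "norm (g m z) \<le> c z"
        using order_trans[OF clip_lipschitz c(1)] by (simp add: g_def)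
    qed
  qed
  have split: "(\<integral>z. g m z \<partial>\<tau>) = (\<integral>z. clip m (u (fst z)) \<partial>\<tau>) - (\<integral>z. clip m (u (snd z)) \<partial>\<tau>)"
    if \<tau>: "borel_prob \<tau>" for m \<tau>
    unfolding g_def
    by (intro Bochner_Integration.integral_diff integrable_bounded_continuous[OF \<tau>, of _ "real m"] continuous_on_clip uc)
       (simp_all add: clip_bounded)
  have "(\<lambda>m. \<integral>z. g m z \<partial>\<rho>) = (\<lambda>m. \<integral>z. g m z \<partial>\<rho>')"
    unfolding split[OF \<rho>] split[OF \<rho>'] fst snd ..
  then show ?thesis using lim[OF \<rho> c(2)] lim[OF \<rho>' c(3)] LIMSEQ_unique by metis
qed

section \<open>Marginals of the limit plan and convergence of the costs\<close>

locale transport_limit = cm_basis +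
  fixes \<mu> \<nu> :: "'a measure" and T :: "nat \<Rightarrow> 'a \<Rightarrow> 'a" and \<pi> :: "('a \<times> 'a) measure" and r :: "nat \<Rightarrow> nat"
  assumes prob_mu: "borel_prob \<mu>" and prob_nu: "borel_prob \<nu>"
    and ac_mu: "absolutely_continuous \<gamma> \<mu>" and ac_nu: "absolutely_continuous \<gamma> \<nu>"
    and fin_cost: "\<exists>\<rho>\<in>plans \<mu> \<nu>. transport_cost \<gamma> \<rho> < \<infinity>"
    and T: "\<And>d. d \<ge> 1 \<Longrightarrow> ray_monotone_optimal_map \<gamma> (range (P d)) (distr \<mu> borel (P d)) (distr \<nu> borel (P d)) (T d)"
    and prob_pi: "borel_prob \<pi>" and r: "strict_mono r"
    and weak: "weakly_converges (\<lambda>n. distr (distr \<mu> borel (P (r n))) borel (\<lambda>x. (x, T (r n) x))) \<pi>"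
begin

abbreviation mu_d :: "nat \<Rightarrow> 'a measure" where "mu_d d \<equiv> distr \<mu> borel (P d)"
abbreviation nu_d :: "nat \<Rightarrow> 'a measure" where "nu_d d \<equiv> distr \<nu> borel (P d)"
abbreviation plan :: "nat \<Rightarrow> ('a \<times> 'a) measure" where "plan d \<equiv> distr (mu_d d) borel (\<lambda>x. (x, T d x))"

lemma measurable_P': "borel_prob \<alpha> \<Longrightarrow> P d \<in> measurable \<alpha> borel"
  using measurable_P by (simp add: borel_prob_def cong: measurable_cong_sets)

lemma borel_prob_mu_d: "borel_prob (mu_d d)"
  by (intro borel_prob_distr prob_mu measurable_P)

lemma measurable_T: "d \<ge> 1 \<Longrightarrow> T d \<in> borel_measurable borel"
  using T by (simp add: ray_monotone_optimal_map_def)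

lemma measurable_graph: "d \<ge> 1 \<Longrightarrow> (\<lambda>x. (x, T d x)) \<in> measurable (mu_d d) borel"
  using measurable_T[of d] by (simp add: borel_prod[symmetric] cong: measurable_cong_sets)

lemma plan_optimal: "d \<ge> 1 \<Longrightarrow> optimal_plan \<gamma> (mu_d d) (nu_d d) (plan d)"
  using T by (simp add: ray_monotone_optimal_map_def)

lemma plan_in_plans: "d \<ge> 1 \<Longrightarrow> plan d \<in> plans (mu_d d) (nu_d d)"
  using plan_optimal by (simp add: optimal_plan_def)

lemma borel_prob_plan: "d \<ge> 1 \<Longrightarrow> borel_prob (plan d)"
  using plan_in_plans by (simp add: plans_def)

lemma r_ge: "n \<le> r n"
  by (rule strict_mono_imp_increasing[OF r])

text \<open>Weak convergence gives the limit of \<open>\<integral> cis (f (P (r n) x)) d\<alpha>\<close>. Along a subsequence \<open>f (P (r n) x)\<close>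
  tends to \<open>f x\<close> almost everywhere for \<open>\<gamma>\<close>, hence for \<open>\<alpha>\<close>, so this limit is the characteristic functional
  of \<open>\<alpha>\<close>.\<close>
lemma marginal_of_limit:
  fixes h :: "'a \<times> 'a \<Rightarrow> 'a"
  assumes h: "continuous_on UNIV h" and \<alpha>: "borel_prob \<alpha>" and ac: "absolutely_continuous \<gamma> \<alpha>"
    and marg: "\<And>d. d \<ge> 1 \<Longrightarrow> distr (plan d) borel h = distr \<alpha> borel (P d)"
  shows "distr \<pi> borel h = \<alpha>"
proof (rule measure_eqI_characteristic_functional)
  have hb: "h \<in> borel_measurable borel" by (rule borel_measurable_continuous_onI[OF h])
  show "borel_prob (distr \<pi> borel h)" by (rule borel_prob_distr[OF prob_pi hb])
  interpret \<alpha>: prob_space \<alpha> using \<alpha> by (simp add: borel_prob_def)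
  fix f :: "'a \<Rightarrow>\<^sub>L real"
  have cisb: "(\<lambda>x. cis (blinfun_apply f x)) \<in> borel_measurable borel"
    by (rule borel_measurable_continuous_onI[OF continuous_on_cis_blinfun])
  have push: "(\<integral>x. cis (blinfun_apply f x) \<partial>distr M borel g) = (\<integral>z. cis (blinfun_apply f (g z)) \<partial>M)"
    if "g \<in> measurable M borel" for g M by (rule integral_distr[OF that cisb])
  let ?a = "\<lambda>n. \<integral>z. cis (blinfun_apply f (h z)) \<partial>plan (r (Suc n))"
  have "weakly_converges (\<lambda>n. plan (r (Suc n))) \<pi>"
    using weak unfolding weakly_converges_def by (auto intro: LIMSEQ_Suc)
  moreover have rS: "1 \<le> r (Suc n)" for n using r_ge[of "Suc n"] by simp
  ultimately have "?a \<longlonglongrightarrow> (\<integral>z. cis (blinfun_apply f (h z)) \<partial>\<pi>)"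
    by (intro weakly_converges_cis continuous_on_compose2[OF continuous_on_blinfun_apply h] borel_prob_plan prob_pi) auto
  moreover have "?a n = (\<integral>x. cis (blinfun_apply f (P (r (Suc n)) x)) \<partial>\<alpha>)" for n
  proof -
    have "h \<in> measurable (plan (r (Suc n))) borel" using hb by simp
    then have "?a n = (\<integral>x. cis (blinfun_apply f x) \<partial>distr (plan (r (Suc n))) borel h)" by (rule push[symmetric])
    also have "\<dots> = (\<integral>x. cis (blinfun_apply f x) \<partial>distr \<alpha> borel (P (r (Suc n))))" by (simp only: marg[OF rS])
    also have "\<dots> = (\<integral>x. cis (blinfun_apply f (P (r (Suc n)) x)) \<partial>\<alpha>)" by (rule push[OF measurable_P'[OF \<alpha>]])
    finally show ?thesis .
  qed
  ultimately have lim: "(\<lambda>n. \<integral>x. cis (blinfun_apply f (P (r (Suc n)) x)) \<partial>\<alpha>) \<longlonglongrightarrow> (\<integral>z. cis (blinfun_apply f (h z)) \<partial>\<pi>)" by simp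
  have "strict_mono (\<lambda>n. r (Suc n))" using r by (simp add: strict_mono_def)
  then obtain s where s: "strict_mono s" "AE x in \<gamma>. (\<lambda>k. blinfun_apply f (P (r (Suc (s k))) x)) \<longlonglongrightarrow> blinfun_apply f x"
    by (rule blinfun_P_subseq_AE)
  have ae: "AE x in \<alpha>. (\<lambda>k. blinfun_apply f (P (r (Suc (s k))) x)) \<longlonglongrightarrow> blinfun_apply f x"
    using absolutely_continuous_AE[OF _ ac s(2)] borel_prob_sets[OF \<alpha>] by simp
  have "(\<lambda>k. \<integral>x. cis (blinfun_apply f (P (r (Suc (s k))) x)) \<partial>\<alpha>) \<longlonglongrightarrow> (\<integral>x. cis (blinfun_apply f x) \<partial>\<alpha>)"
  proof (rule integral_dominated_convergence[where w="\<lambda>_. 1"])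
    show "AE x in \<alpha>. (\<lambda>k. cis (blinfun_apply f (P (r (Suc (s k))) x))) \<longlonglongrightarrow> cis (blinfun_apply f x)"
      using ae by eventually_elim (simp add: cis_conv_exp tendsto_exp tendsto_mult tendsto_of_real)
    show "(\<lambda>x. cis (blinfun_apply f x)) \<in> borel_measurable \<alpha>"
      "\<And>k. (\<lambda>x. cis (blinfun_apply f (P (r (Suc (s k))) x))) \<in> borel_measurable \<alpha>"
      using cisb measurable_compose[OF measurable_P'[OF \<alpha>] cisb] borel_prob_sets[OF \<alpha>]
      by (simp_all cong: measurable_cong_sets)
  qed auto
  moreover have "(\<lambda>k. \<integral>x. cis (blinfun_apply f (P (r (Suc (s k))) x)) \<partial>\<alpha>) \<longlonglongrightarrow> (\<integral>z. cis (blinfun_apply f (h z)) \<partial>\<pi>)"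
    using LIMSEQ_subseq_LIMSEQ[OF lim s(1)] by (simp add: comp_def)
  ultimately have "(\<integral>z. cis (blinfun_apply f (h z)) \<partial>\<pi>) = (\<integral>x. cis (blinfun_apply f x) \<partial>\<alpha>)"
    by (rule LIMSEQ_unique[THEN sym])
  moreover have "h \<in> measurable \<pi> borel" using hb borel_prob_sets[OF prob_pi] by (simp cong: measurable_cong_sets)
  ultimately show "(\<integral>x. cis (blinfun_apply f x) \<partial>distr \<pi> borel h) = (\<integral>x. cis (blinfun_apply f x) \<partial>\<alpha>)"
    by (simp add: push)
qed (rule \<alpha>)

lemma pi_in_plans: "\<pi> \<in> plans \<mu> \<nu>"
proof -
  have "distr \<pi> borel fst = \<mu>"
    by (rule marginal_of_limit[OF _ prob_mu ac_mu]) (use plan_in_plans in \<open>auto simp: plans_def intro!: continuous_intros\<close>)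
  moreover have "distr \<pi> borel snd = \<nu>"
    by (rule marginal_of_limit[OF _ prob_nu ac_nu]) (use plan_in_plans in \<open>auto simp: plans_def intro!: continuous_intros\<close>)
  ultimately show ?thesis using prob_pi by (simp add: plans_def)
qed

lemma proj_dist_measurable[measurable]: "(\<lambda>z. proj_norm d (fst z - snd z)) \<in> borel_measurable (borel :: ('a \<times> 'a) measure)"
  by (intro borel_measurable_continuous_onI continuous_on_compose2[OF continuous_proj_norm] continuous_intros) auto

lemma plans_measurable_cong: "\<rho> \<in> plans \<alpha> \<beta> \<Longrightarrow> measurable \<rho> N = measurable borel N"
  by (rule measurable_cong_sets) (auto simp: plans_def borel_prob_def)

lemma plans_AE_fst:
  assumes "\<rho> \<in> plans \<alpha> \<beta>" "AE x in \<alpha>. Q x"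
  shows "AE z in \<rho>. Q (fst z)"
proof -
  have "\<alpha> = distr \<rho> borel fst" using assms(1) by (simp add: plans_def)
  moreover have "fst \<in> measurable \<rho> borel" unfolding plans_measurable_cong[OF assms(1)] by (intro borel_measurable_continuous_onI continuous_intros)
  ultimately show ?thesis using AE_distrD assms(2) by blast
qed

lemma plans_AE_snd:
  assumes "\<rho> \<in> plans \<alpha> \<beta>" "AE x in \<beta>. Q x"
  shows "AE z in \<rho>. Q (snd z)"
proof -
  have "\<beta> = distr \<rho> borel snd" using assms(1) by (simp add: plans_def)
  moreover have "snd \<in> measurable \<rho> borel" unfolding plans_measurable_cong[OF assms(1)] by (intro borel_measurable_continuous_onI continuous_intros)
  ultimately show ?thesis using AE_distrD assms(2) by blast
qed

lemma AE_distr_P: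
  assumes "borel_prob \<alpha>"
  shows "AE x in distr \<alpha> borel (P d). P d x = x"
proof -
  have "{x. P d x = x} \<in> sets borel"
    by (intro borel_closed closed_Collect_eq continuous_P continuous_on_id)
  then show ?thesis by (subst AE_distr_iff[OF measurable_P'[OF assms]]) (simp_all add: P_P)
qed

lemma cm_norm_on_plans:
  assumes "\<rho> \<in> plans (mu_d d) (nu_d d)"
  shows "AE z in \<rho>. cm_norm \<gamma> (fst z - snd z) = ennreal (proj_norm d (fst z - snd z))"
  using plans_AE_fst[OF assms AE_distr_P[OF prob_mu]] plans_AE_snd[OF assms AE_distr_P[OF prob_nu]]
proof eventually_elim
  case (elim z)
  then show ?case using cm_norm_P[of d "fst z - snd z"] by (simp add: P_diff)
qed

lemma transport_cost_on_plans:
  assumes "\<rho> \<in> plans (mu_d d) (nu_d d)"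
  shows "transport_cost \<gamma> \<rho> = (\<integral>\<^sup>+z. ennreal (proj_norm d (fst z - snd z)) \<partial>\<rho>)"
  unfolding transport_cost_def case_prod_beta by (rule nn_integral_cong_AE[OF cm_norm_on_plans[OF assms]])

definition W :: "nat \<Rightarrow> ennreal" where
  "W d = (\<integral>\<^sup>+z. ennreal (proj_norm d (fst z - snd z)) \<partial>plan d)"

text \<open>The image of \<open>\<rho>\<close> under \<open>P d\<close> in both coordinates is a competitor of the optimal plan, and its cost is
  the right-hand side.\<close>
lemma W_le:
  assumes d: "d \<ge> 1" and \<rho>: "\<rho> \<in> plans \<mu> \<nu>"
  shows "W d \<le> (\<integral>\<^sup>+z. ennreal (proj_norm d (fst z - snd z)) \<partial>\<rho>)"
proof -
  let ?PP = "\<lambda>z. (P d (fst z), P d (snd z))"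
  have bp: "borel_prob \<rho>" using \<rho> by (simp add: plans_def)
  have c: "continuous_on UNIV ?PP"
    by (intro continuous_intros continuous_on_compose2[OF continuous_P]) auto
  have m: "?PP \<in> borel_measurable borel" by (rule borel_measurable_continuous_onI[OF c])
  have m': "?PP \<in> measurable \<rho> borel" using m by (simp add: plans_measurable_cong[OF \<rho>])
  have fs: "fst \<in> measurable \<rho> borel" "snd \<in> measurable \<rho> borel"
    unfolding plans_measurable_cong[OF \<rho>] by (intro borel_measurable_continuous_onI continuous_intros)+
  have fs': "(fst :: 'a \<times> 'a \<Rightarrow> 'a) \<in> borel_measurable borel" "(snd :: 'a \<times> 'a \<Rightarrow> 'a) \<in> borel_measurable borel"
    by (intro borel_measurable_continuous_onI continuous_intros)+
  let ?\<rho> = "distr \<rho> borel ?PP"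
  have "distr ?\<rho> borel fst = mu_d d"
  proof -
    have "distr ?\<rho> borel fst = distr \<rho> borel (\<lambda>z. P d (fst z))" by (simp add: distr_distr[OF fs'(1) m'] comp_def)
    also have "\<dots> = distr (distr \<rho> borel fst) borel (P d)" by (simp add: distr_distr[OF measurable_P fs(1)] comp_def)
    finally show ?thesis using \<rho> by (simp add: plans_def)
  qed
  moreover have "distr ?\<rho> borel snd = nu_d d"
  proof -
    have "distr ?\<rho> borel snd = distr \<rho> borel (\<lambda>z. P d (snd z))" by (simp add: distr_distr[OF fs'(2) m'] comp_def)
    also have "\<dots> = distr (distr \<rho> borel snd) borel (P d)" by (simp add: distr_distr[OF measurable_P fs(2)] comp_def)
    finally show ?thesis using \<rho> by (simp add: plans_def)
  qed
  ultimately have pl: "?\<rho> \<in> plans (mu_d d) (nu_d d)" using borel_prob_distr[OF bp m] by (simp add: plans_def)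
  have "W d = transport_cost \<gamma> (plan d)" unfolding W_def by (rule transport_cost_on_plans[OF plan_in_plans[OF d], symmetric])
  also have "\<dots> \<le> transport_cost \<gamma> ?\<rho>" using plan_optimal[OF d] pl by (simp add: optimal_plan_def)
  also have "\<dots> = (\<integral>\<^sup>+z. ennreal (proj_norm d (fst z - snd z)) \<partial>?\<rho>)" by (rule transport_cost_on_plans[OF pl])
  also have "\<dots> = (\<integral>\<^sup>+z. ennreal (proj_norm d (P d (fst z) - P d (snd z))) \<partial>\<rho>)"
    by (subst nn_integral_distr[OF m']) auto
  finally show ?thesis by (simp add: P_diff[symmetric] proj_norm_P)
qed

definition limit_cost :: ennreal where
  "limit_cost = (\<integral>\<^sup>+z. cm_sup (fst z - snd z) \<partial>\<pi>)"

lemma W_le_limit_cost: "d \<ge> 1 \<Longrightarrow> W d \<le> limit_cost"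
  unfolding limit_cost_def
  by (rule order_trans[OF W_le[OF _ pi_in_plans]]) (auto intro!: nn_integral_mono proj_norm_le_cm_sup)

text \<open>The cost is the supremum of bounded continuous functions, namely of the projected distances truncated
  at \<open>k\<close>, and these are dominated by the cost at every level \<open>d \<ge> k\<close>.\<close>
lemma limit_cost_le_Liminf: "limit_cost \<le> liminf (\<lambda>n. W (r n))"
proof -
  let ?h = "\<lambda>k z. min (real k) (proj_norm k (fst z - snd z))"
  have hc: "continuous_on UNIV (?h k)" for k
    by (intro continuous_intros continuous_on_compose2[OF continuous_proj_norm]) auto
  have sup: "cm_sup x = (SUP k. ennreal (min (real k) (proj_norm k x)))" for x
  proof (rule antisym)
    show "cm_sup x \<le> (SUP k. ennreal (min (real k) (proj_norm k x)))"
      unfolding cm_sup_def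
    proof (rule SUP_least)
      fix k
      obtain m where m: "proj_norm k x \<le> real m" using real_arch_simple by blast
      have "ennreal (proj_norm k x) \<le> ennreal (min (real (max k m)) (proj_norm (max k m) x))"
        using m proj_norm_mono[of k "max k m" x] by (intro ennreal_leI) auto
      also have "\<dots> \<le> (SUP k. ennreal (min (real k) (proj_norm k x)))" by (rule SUP_upper) simp
      finally show "ennreal (proj_norm k x) \<le> (SUP k. ennreal (min (real k) (proj_norm k x)))" .
    qed
    show "(SUP k. ennreal (min (real k) (proj_norm k x))) \<le> cm_sup x"
      by (intro SUP_least order_trans[OF ennreal_leI[OF min.cobounded2] proj_norm_le_cm_sup])
  qed
  have "limit_cost = (SUP k. \<integral>\<^sup>+z. ennreal (?h k z) \<partial>\<pi>)"
    unfolding limit_cost_def sup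
  proof (rule nn_integral_monotone_convergence_SUP)
    show "incseq (\<lambda>k z. ennreal (?h k z))"
      by (intro incseq_SucI le_funI ennreal_leI min.mono proj_norm_mono) auto
    show "(\<lambda>z. ennreal (?h k z)) \<in> borel_measurable \<pi>" for k
      using borel_measurable_continuous_onI[OF hc[of k]] borel_prob_sets[OF prob_pi]
      by (simp cong: measurable_cong_sets)
  qed
  also have "\<dots> \<le> liminf (\<lambda>n. W (r n))"
  proof (rule SUP_least)
    fix k
    have bnd: "\<bar>?h k z\<bar> \<le> real k" for z using proj_norm_nonneg[of k "fst z - snd z"] by auto
    have int: "integrable \<rho> (?h k)" if "borel_prob \<rho>" for \<rho>
      by (rule integrable_bounded_continuous[OF that hc, of _ "real k"]) (use bnd in auto)
    have nn: "(\<integral>\<^sup>+z. ennreal (?h k z) \<partial>\<rho>) = ennreal (\<integral>z. ?h k z \<partial>\<rho>)" if "borel_prob \<rho>" for \<rho>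
      by (rule nn_integral_eq_integral[OF int[OF that]]) (simp add: proj_norm_nonneg)
    have "bounded (range (?h k))" using bnd by (intro boundedI[of _ "real k"]) auto
    then have "(\<lambda>n. \<integral>z. ?h k z \<partial>plan (r n)) \<longlonglongrightarrow> (\<integral>z. ?h k z \<partial>\<pi>)"
      using weak hc unfolding weakly_converges_def by blast
    then have "(\<lambda>n. ennreal (\<integral>z. ?h k z \<partial>plan (r n))) \<longlonglongrightarrow> ennreal (\<integral>z. ?h k z \<partial>\<pi>)"
      by (rule tendsto_ennrealI)
    then have "ennreal (\<integral>z. ?h k z \<partial>\<pi>) = liminf (\<lambda>n. ennreal (\<integral>z. ?h k z \<partial>plan (r n)))"
      by (rule lim_imp_Liminf[OF sequentially_bot, symmetric])
    also have "\<dots> \<le> liminf (\<lambda>n. W (r n))"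
    proof (rule Liminf_mono, rule eventually_sequentiallyI[of "Suc k"])
      fix n assume "Suc k \<le> n"
      then have rn: "1 \<le> r n" "k \<le> r n" using r_ge[of n] by auto
      have "ennreal (\<integral>z. ?h k z \<partial>plan (r n)) = (\<integral>\<^sup>+z. ennreal (?h k z) \<partial>plan (r n))"
        by (rule nn[OF borel_prob_plan[OF rn(1)], symmetric])
      also have "\<dots> \<le> W (r n)"
        unfolding W_def using proj_norm_mono[OF rn(2)] by (intro nn_integral_mono ennreal_leI) (simp add: min.coboundedI2)
      finally show "ennreal (\<integral>z. ?h k z \<partial>plan (r n)) \<le> W (r n)" .
    qed
    finally show "(\<integral>\<^sup>+z. ennreal (?h k z) \<partial>\<pi>) \<le> liminf (\<lambda>n. W (r n))" by (simp add: nn[OF prob_pi])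
  qed
  finally show ?thesis .
qed

lemma W_r_tendsto: "(\<lambda>n. W (r n)) \<longlonglongrightarrow> limit_cost"
proof (rule Liminf_eq_Limsup)
  have le: "limsup (\<lambda>n. W (r n)) \<le> limit_cost"
    by (rule Limsup_bounded, rule eventually_sequentiallyI[of 1]) (metis W_le_limit_cost r_ge order_trans)
  have ll: "liminf (\<lambda>n. W (r n)) \<le> limsup (\<lambda>n. W (r n))" by (rule Liminf_le_Limsup) simp
  show "liminf (\<lambda>n. W (r n)) = limit_cost" "limsup (\<lambda>n. W (r n)) = limit_cost"
    using le ll limit_cost_le_Liminf by auto
qed simp

lemma limit_cost_finite: "limit_cost < \<infinity>"
proof -
  obtain \<rho> where \<rho>: "\<rho> \<in> plans \<mu> \<nu>" "transport_cost \<gamma> \<rho> < \<infinity>" using fin_cost by blast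
  have "W d \<le> transport_cost \<gamma> \<rho>" if "d \<ge> 1" for d
    unfolding transport_cost_def case_prod_beta
    by (rule order_trans[OF W_le[OF that \<rho>(1)]]) (intro nn_integral_mono proj_norm_le_cm_norm)
  then have "eventually (\<lambda>n. W (r n) \<le> transport_cost \<gamma> \<rho>) sequentially"
    by (intro eventually_sequentiallyI[of 1]) (metis r_ge order_trans)
  then have "limit_cost \<le> transport_cost \<gamma> \<rho>"
    by (rule tendsto_upperbound[OF W_r_tendsto]) simp
  then show ?thesis using \<rho>(2) by (rule le_less_trans)
qed

end

section \<open>The cyclically monotone set\<close>

context transport_limit
begin

text \<open>The potential of the projected problem lives on the range of \<open>P d\<close>; it is extended to be constant along the
  fibres of \<open>P d\<close>.\<close>
lemma ex_potential:
  assumes d: "d \<ge> 1"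
  shows "\<exists>u. (\<forall>x y. \<bar>u x - u y\<bar> \<le> proj_norm d (x - y)) \<and> (\<forall>x. u (P d x) = u x) \<and>
    (AE z in plan d. u (fst z) - u (snd z) = proj_norm d (fst z - snd z))"
proof -
  obtain \<phi> where \<phi>: "kantorovich_potential \<gamma> (range (P d)) (mu_d d) (nu_d d) \<phi>"
    using T[OF d] unfolding ray_monotone_optimal_map_def rearranges_along_rays_def by blast
  define u where "u x = \<phi> (P d x)" for x
  have lip: "\<bar>u x - u y\<bar> \<le> proj_norm d (x - y)" for x y
  proof -
    have "ennreal \<bar>u x - u y\<bar> \<le> cm_norm \<gamma> (P d x - P d y)"
      using \<phi> unfolding kantorovich_potential_def u_def by blast
    then show ?thesis by (simp add: P_diff[symmetric] cm_norm_P proj_norm_nonneg)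
  qed
  have "AE (x, y) in plan d. ennreal (\<phi> x - \<phi> y) = cm_norm \<gamma> (x - y)"
    using \<phi> plan_optimal[OF d] unfolding kantorovich_potential_def by blast
  then have "AE z in plan d. ennreal (\<phi> (fst z) - \<phi> (snd z)) = cm_norm \<gamma> (fst z - snd z)"
    by (simp add: case_prod_beta)
  then have ae: "AE z in plan d. u (fst z) - u (snd z) = proj_norm d (fst z - snd z)"
    using cm_norm_on_plans[OF plan_in_plans[OF d]]
      plans_AE_fst[OF plan_in_plans[OF d] AE_distr_P[OF prob_mu]]
      plans_AE_snd[OF plan_in_plans[OF d] AE_distr_P[OF prob_nu]]
  proof eventually_elim
    case (elim z)
    \<comment> \<open>A negative difference would be truncated to 0 here; the Lipschitz bound excludes it.\<close>
    then have eq: "ennreal (u (fst z) - u (snd z)) = ennreal (proj_norm d (fst z - snd z))"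
      by (simp add: u_def)
    show ?case
    proof (cases "0 \<le> u (fst z) - u (snd z)")
      case True
      then show ?thesis using eq by (simp add: proj_norm_nonneg)
    next
      case False
      then have "proj_norm d (fst z - snd z) = 0" using eq proj_norm_nonneg[of d "fst z - snd z"]
        by (simp add: ennreal_neg)
      then show ?thesis using lip[of "fst z" "snd z"] by simp
    qed
  qed
  show ?thesis by (intro exI[of _ u] conjI allI lip ae) (simp add: u_def P_P)
qed

lemma continuous_if_proj_lipschitz:
  assumes "\<And>x y. \<bar>u x - u y\<bar> \<le> proj_norm d (x - y)"
  shows "continuous_on UNIV (u :: 'a \<Rightarrow> real)"
proof (rule continuous_at_imp_continuous_on, rule ballI)
  fix x
  have "continuous (at x) (\<lambda>y. proj_norm d (y - x))"
    using continuous_on_compose2[OF continuous_proj_norm, of UNIV "\<lambda>y. y - x" UNIV d]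
    by (simp add: continuous_on_eq_continuous_at continuous_on_diff continuous_on_id continuous_on_const)
  then have "((\<lambda>y. proj_norm d (y - x)) \<longlongrightarrow> proj_norm d (x - x)) (at x)" by (simp add: continuous_at)
  then have "((\<lambda>y. proj_norm d (y - x)) \<longlongrightarrow> 0) (at x)" by (simp add: proj_norm_def blinfun.zero_right)
  then have "((\<lambda>y. u y - u x) \<longlongrightarrow> 0) (at x)"
    by (rule Lim_null_comparison[rotated]) (simp add: assms)
  then show "continuous (at x) u" by (simp add: continuous_at LIM_zero_iff)
qed

lemma integrable_proj_dist:
  assumes \<rho>: "borel_prob \<rho>" and fin: "(\<integral>\<^sup>+z. ennreal (proj_norm d (fst z - snd z)) \<partial>\<rho>) < \<infinity>"
  shows "integrable \<rho> (\<lambda>z. proj_norm d (fst z - snd z))"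
proof (rule integrableI_bounded)
  show "(\<lambda>z. proj_norm d (fst z - snd z)) \<in> borel_measurable \<rho>"
    using proj_dist_measurable borel_prob_sets[OF \<rho>] by (simp cong: measurable_cong_sets)
qed (use fin in \<open>simp add: proj_norm_nonneg\<close>)

text \<open>Since \<open>u\<close> factors through \<open>P d\<close>, the optimal plan and \<open>\<pi>\<close> have the same laws of \<open>u (fst z)\<close> and of
  \<open>u (snd z)\<close>, hence the same integral of the difference; for the optimal plan it is the cost.\<close>
lemma integral_potential_difference:
  assumes d: "d \<ge> 1" and lip: "\<And>x y. \<bar>u x - u y\<bar> \<le> proj_norm d (x - y)" and uP: "\<And>x. u (P d x) = u x"
    and ae: "AE z in plan d. u (fst z) - u (snd z) = proj_norm d (fst z - snd z)"
  shows "(\<integral>z. u (fst z) - u (snd z) \<partial>\<pi>) = enn2real (W d)"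
proof -
  let ?c = "\<lambda>z. proj_norm d (fst z - snd z)"
  have uc: "continuous_on UNIV u" by (rule continuous_if_proj_lipschitz[OF lip])
  have Wfin: "W d < \<infinity>" using W_le_limit_cost[OF d] limit_cost_finite by (rule le_less_trans)
  have int1: "integrable (plan d) ?c"
    by (rule integrable_proj_dist[OF borel_prob_plan[OF d]]) (use Wfin in \<open>simp add: W_def\<close>)
  have "(\<integral>\<^sup>+z. ennreal (?c z) \<partial>\<pi>) \<le> limit_cost"
    unfolding limit_cost_def by (intro nn_integral_mono proj_norm_le_cm_sup)
  then have int2: "integrable \<pi> ?c"
    by (intro integrable_proj_dist[OF prob_pi] le_less_trans[OF _ limit_cost_finite])
  have clip: "(\<integral>z. clip m (u (h z)) \<partial>plan d) = (\<integral>z. clip m (u (h z)) \<partial>\<pi>)"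
    if h: "h \<in> borel_measurable borel" and \<alpha>: "borel_prob \<alpha>"
      and m: "distr (plan d) borel h = distr \<alpha> borel (P d)" "distr \<pi> borel h = \<alpha>" for m h \<alpha>
  proof -
    have cl: "(\<lambda>x. clip m (u x)) \<in> borel_measurable borel"
      by (intro borel_measurable_continuous_onI continuous_on_clip uc)
    have h': "h \<in> measurable \<pi> borel" using h borel_prob_sets[OF prob_pi] by (simp cong: measurable_cong_sets)
    have "(\<integral>z. clip m (u (h z)) \<partial>plan d) = (\<integral>x. clip m (u x) \<partial>distr (plan d) borel h)"
      using h by (intro integral_distr[symmetric] cl) simp
    also have "\<dots> = (\<integral>x. clip m (u (P d x)) \<partial>\<alpha>)" unfolding m by (rule integral_distr[OF measurable_P'[OF \<alpha>] cl])
    also have "\<dots> = (\<integral>x. clip m (u x) \<partial>distr \<pi> borel h)" by (simp add: uP m)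
    also have "\<dots> = (\<integral>z. clip m (u (h z)) \<partial>\<pi>)" by (rule integral_distr[OF h' cl])
    finally show ?thesis .
  qed
  have fs: "(fst :: 'a \<times> 'a \<Rightarrow> 'a) \<in> borel_measurable borel" "(snd :: 'a \<times> 'a \<Rightarrow> 'a) \<in> borel_measurable borel"
    by (intro borel_measurable_continuous_onI continuous_intros)+
  have "(\<integral>z. u (fst z) - u (snd z) \<partial>plan d) = (\<integral>z. u (fst z) - u (snd z) \<partial>\<pi>)"
  proof (rule integral_potential_difference_cong[OF borel_prob_plan[OF d] prob_pi uc lip int1 int2])
    show "(\<integral>z. clip m (u (fst z)) \<partial>plan d) = (\<integral>z. clip m (u (fst z)) \<partial>\<pi>)" for m
      by (rule clip[OF fs(1) prob_mu]) (use plan_in_plans[OF d] pi_in_plans in \<open>simp_all add: plans_def\<close>)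
    show "(\<integral>z. clip m (u (snd z)) \<partial>plan d) = (\<integral>z. clip m (u (snd z)) \<partial>\<pi>)" for m
      by (rule clip[OF fs(2) prob_nu]) (use plan_in_plans[OF d] pi_in_plans in \<open>simp_all add: plans_def\<close>)
  qed
  moreover have "(\<integral>z. u (fst z) - u (snd z) \<partial>plan d) = (\<integral>z. ?c z \<partial>plan d)"
  proof (rule integral_cong_AE[OF _ _ ae])
    have "(\<lambda>z::'a\<times>'a. u (fst z) - u (snd z)) \<in> borel_measurable borel"
      by (intro borel_measurable_continuous_onI continuous_intros continuous_on_compose2[OF uc]) auto
    then show "(\<lambda>z. u (fst z) - u (snd z)) \<in> borel_measurable (plan d)" by simp
  qed (use int1 in simp)
  moreover have "W d = ennreal (\<integral>z. ?c z \<partial>plan d)"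
    unfolding W_def by (rule nn_integral_eq_integral[OF int1]) (simp add: proj_norm_nonneg)
  then have "enn2real (W d) = (\<integral>z. ?c z \<partial>plan d)"
    by (simp add: proj_norm_nonneg)
  ultimately show ?thesis by simp
qed

lemma cm_sup_measurable: "(\<lambda>z. cm_sup (fst z - snd z)) \<in> borel_measurable (borel :: ('a \<times> 'a) measure)"
  unfolding cm_sup_def by (intro borel_measurable_SUP measurable_compose[OF proj_dist_measurable]) auto

text \<open>The cost of \<open>\<pi>\<close> minus the integral of the potential difference is the gap between the limit cost and
  a projected optimal cost, so the nonnegative integrands tend to 0 in \<open>L\<^sup>1(\<pi>)\<close>. The set \<open>G\<close> makes
  the Cameron--Martin norm of \<open>x - y\<close> the supremum of the projected norms, the integrand used here.\<close>
lemma ex_cyclically_monotone_AE: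
  obtains \<Gamma>0 where "cm_cyclically_monotone \<gamma> \<Gamma>0" "AE z in \<pi>. z \<in> \<Gamma>0"
proof -
  \<comment> \<open>The shift guarantees \<open>D n \<ge> 1\<close>: at level 0, which \<open>r\<close> may take, nothing is known about the map.\<close>
  define D where "D n = r (Suc n)" for n
  have D1: "D n \<ge> 1" for n using r_ge[of "Suc n"] by (simp add: D_def)
  have ex: "\<forall>n. \<exists>u. (\<forall>x y. \<bar>u x - u y\<bar> \<le> proj_norm (D n) (x - y)) \<and> (\<forall>x. u (P (D n) x) = u x) \<and>
    (AE z in plan (D n). u (fst z) - u (snd z) = proj_norm (D n) (fst z - snd z))"
    by (rule allI, rule ex_potential[OF D1])
  from choice[OF ex] obtain u where "\<forall>n. (\<forall>x y. \<bar>u n x - u n y\<bar> \<le> proj_norm (D n) (x - y)) \<and> (\<forall>x. u n (P (D n) x) = u n x) \<and>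
    (AE z in plan (D n). u n (fst z) - u n (snd z) = proj_norm (D n) (fst z - snd z))"
    by (rule exE)
  then have u: "\<And>n x y. \<bar>u n x - u n y\<bar> \<le> proj_norm (D n) (x - y)" "\<And>n x. u n (P (D n) x) = u n x"
    "\<And>n. AE z in plan (D n). u n (fst z) - u n (snd z) = proj_norm (D n) (fst z - snd z)"
    by blast+
  have uc: "continuous_on UNIV (u n)" for n by (rule continuous_if_proj_lipschitz[OF u(1)])
  let ?c = "\<lambda>z. enn2real (cm_sup (fst z - snd z))"
  let ?v = "\<lambda>n z. u n (fst z) - u n (snd z)"
  have cm: "(\<lambda>z. cm_sup (fst z - snd z)) \<in> borel_measurable \<pi>"
    using cm_sup_measurable borel_prob_sets[OF prob_pi] by (simp cong: measurable_cong_sets)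
  have fin: "AE z in \<pi>. cm_sup (fst z - snd z) \<noteq> \<infinity>"
    by (rule nn_integral_PInf_AE[OF cm]) (use limit_cost_finite in \<open>simp add: limit_cost_def\<close>)
  have vle: "?v n z \<le> ?c z" if "cm_sup (fst z - snd z) \<noteq> \<infinity>" for n z
  proof -
    have "ennreal \<bar>?v n z\<bar> \<le> cm_sup (fst z - snd z)"
      by (rule order_trans[OF ennreal_leI[OF u(1)] proj_norm_le_cm_sup])
    then have "\<bar>?v n z\<bar> \<le> ?c z" using that
      by (cases "cm_sup (fst z - snd z)") auto
    then show ?thesis by simp
  qed
  have nnc: "(\<integral>\<^sup>+z. ennreal (?c z) \<partial>\<pi>) = limit_cost"
    unfolding limit_cost_def
    by (rule nn_integral_cong_AE) (use fin in eventually_elim, auto simp: less_top)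
  have intc: "integrable \<pi> ?c"
    by (rule integrableI_bounded) (use cm nnc limit_cost_finite in auto)
  have cint: "ennreal (\<integral>z. ?c z \<partial>\<pi>) = limit_cost"
    using nn_integral_eq_integral[OF intc] nnc by simp
  have intv: "integrable \<pi> (?v n)" for n
  proof (rule Bochner_Integration.integrable_bound[OF intc])
    have "?v n \<in> borel_measurable borel"
      by (intro borel_measurable_continuous_onI continuous_intros continuous_on_compose2[OF uc]) auto
    then show "?v n \<in> borel_measurable \<pi>" using borel_prob_sets[OF prob_pi] by (simp cong: measurable_cong_sets)
    show "AE z in \<pi>. norm (?v n z) \<le> norm (?c z)"
      using fin
    proof eventually_elim
      case (elim z)
      have "ennreal \<bar>?v n z\<bar> \<le> cm_sup (fst z - snd z)"
        by (rule order_trans[OF ennreal_leI[OF u(1)] proj_norm_le_cm_sup])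
      then show ?case using elim by (cases "cm_sup (fst z - snd z)") auto
    qed
  qed
  have WD: "(\<lambda>n. W (D n)) \<longlonglongrightarrow> limit_cost"
    unfolding D_def by (rule LIMSEQ_Suc[OF W_r_tendsto])
  have L1: "(\<lambda>n. \<integral>z. norm (?c z - ?v n z) \<partial>\<pi>) \<longlonglongrightarrow> 0"
  proof -
    have eq: "(\<integral>z. norm (?c z - ?v n z) \<partial>\<pi>) = (\<integral>z. ?c z \<partial>\<pi>) - (\<integral>z. ?v n z \<partial>\<pi>)" for n
    proof -
      have "(\<integral>z. norm (?c z - ?v n z) \<partial>\<pi>) = (\<integral>z. ?c z - ?v n z \<partial>\<pi>)"
      proof (rule integral_cong_AE)
        show "AE z in \<pi>. norm (?c z - ?v n z) = ?c z - ?v n z"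
          using fin by eventually_elim (use vle in simp)
      qed (use borel_measurable_integrable[OF intc] borel_measurable_integrable[OF intv] in auto)
      also have "\<dots> = (\<integral>z. ?c z \<partial>\<pi>) - (\<integral>z. ?v n z \<partial>\<pi>)" by (rule Bochner_Integration.integral_diff[OF intc intv])
      finally show ?thesis .
    qed
    have "(\<lambda>n. W (D n)) \<longlonglongrightarrow> ennreal (\<integral>z. ?c z \<partial>\<pi>)" using WD by (simp only: cint)
    then have "(\<lambda>n. enn2real (W (D n))) \<longlonglongrightarrow> (\<integral>z. ?c z \<partial>\<pi>)"
      by (rule tendsto_enn2real) simp
    then have "(\<lambda>n. \<integral>z. ?v n z \<partial>\<pi>) \<longlonglongrightarrow> (\<integral>z. ?c z \<partial>\<pi>)"
      unfolding integral_potential_difference[OF D1 u(1,2,3)] by simp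
    from tendsto_diff[OF tendsto_const[of "\<integral>z. ?c z \<partial>\<pi>"] this]
    show ?thesis unfolding eq by simp
  qed
  obtain s where s: "strict_mono (s :: nat \<Rightarrow> nat)" "AE z in \<pi>. (\<lambda>k. ?c z - ?v (s k) z) \<longlonglongrightarrow> 0"
    using tendsto_L1_AE_subseq[OF Bochner_Integration.integrable_diff[OF intc intv] L1] by blast
  obtain G where G: "AE x in \<gamma>. x \<in> G" "\<And>x y. x \<in> G \<Longrightarrow> y \<in> G \<Longrightarrow> cm_norm \<gamma> (x - y) = cm_sup (x - y)"
    by (rule cm_norm_diff_eq_cm_sup_AE) blast
  have Gmu: "AE x in \<mu>. x \<in> G"
    using absolutely_continuous_AE[OF _ ac_mu G(1)] borel_prob_sets[OF prob_mu] by simp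
  have Gnu: "AE x in \<nu>. x \<in> G"
    using absolutely_continuous_AE[OF _ ac_nu G(1)] borel_prob_sets[OF prob_nu] by simp
  define \<Gamma>0 where "\<Gamma>0 = {z. fst z \<in> G \<and> snd z \<in> G \<and> cm_sup (fst z - snd z) \<noteq> \<infinity> \<and> (\<lambda>k. ?c z - ?v (s k) z) \<longlonglongrightarrow> 0}"
  have "AE z in \<pi>. z \<in> \<Gamma>0"
    using fin s(2) plans_AE_fst[OF pi_in_plans Gmu] plans_AE_snd[OF pi_in_plans Gnu]
    by eventually_elim (simp add: \<Gamma>0_def)
  moreover have "cm_cyclically_monotone \<gamma> \<Gamma>0"
    unfolding cm_cyclically_monotone_def
  proof (intro allI impI)
    fix n :: nat and x y :: "nat \<Rightarrow> 'a"
    assume xy: "\<forall>i\<le>n. (x i, y i) \<in> \<Gamma>0"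
    let ?\<sigma> = "\<lambda>i. if i = n then 0 else Suc i"
    show "(\<Sum>i\<le>n. cm_norm \<gamma> (x i - y i)) \<le> (\<Sum>i\<le>n. cm_norm \<gamma> (x (?\<sigma> i) - y i))"
    proof (cases "\<exists>i\<le>n. cm_norm \<gamma> (x (?\<sigma> i) - y i) = \<infinity>")
      case True
      then obtain i where i: "i \<le> n" "cm_norm \<gamma> (x (?\<sigma> i) - y i) = \<infinity>" by blast
      have "cm_norm \<gamma> (x (?\<sigma> i) - y i) \<le> (\<Sum>i\<le>n. cm_norm \<gamma> (x (?\<sigma> i) - y i))"
        by (rule member_le_sum) (use i(1) in auto)
      then have "(\<Sum>i\<le>n. cm_norm \<gamma> (x (?\<sigma> i) - y i)) = top"
        by (simp only: i(2) infinity_ennreal_def top_unique)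
      then show ?thesis by (simp only: top_greatest)
    next
      case False
      define a where "a i = ?c (x i, y i)" for i
      define b where "b i = enn2real (cm_norm \<gamma> (x (?\<sigma> i) - y i))" for i
      have a: "cm_norm \<gamma> (x i - y i) = ennreal (a i)" if "i \<le> n" for i
        using xy that G(2)[of "x i" "y i"] by (auto simp: \<Gamma>0_def a_def less_top)
      have b: "cm_norm \<gamma> (x (?\<sigma> i) - y i) = ennreal (b i)" if "i \<le> n" for i
        using False that by (auto simp: b_def less_top)
      have "(\<lambda>k. a i - (u (s k) (x i) - u (s k) (y i))) \<longlonglongrightarrow> 0" if "i \<le> n" for i
        using xy that by (auto simp: \<Gamma>0_def a_def)
      then have "(\<lambda>k. a i - (a i - (u (s k) (x i) - u (s k) (y i)))) \<longlonglongrightarrow> a i - 0" if "i \<le> n" for i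
        using that by (intro tendsto_intros) auto
      then have "(\<lambda>k. \<Sum>i\<le>n. u (s k) (x i) - u (s k) (y i)) \<longlonglongrightarrow> (\<Sum>i\<le>n. a i)"
        by (intro tendsto_sum) auto
      moreover have "(\<Sum>i\<le>n. u (s k) (x i) - u (s k) (y i)) \<le> (\<Sum>i\<le>n. b i)" for k
      proof -
        have "(\<Sum>i\<le>n. u (s k) (x i) - u (s k) (y i)) = (\<Sum>i\<le>n. u (s k) (x (?\<sigma> i)) - u (s k) (y i))"
          using sum_rotate[of "\<lambda>i. u (s k) (x i)" n] by (simp add: sum_subtractf)
        also have "\<dots> \<le> (\<Sum>i\<le>n. b i)"
        proof (rule sum_mono)
          fix i assume "i \<in> {..n}"
          have "ennreal \<bar>u (s k) (x (?\<sigma> i)) - u (s k) (y i)\<bar> \<le> cm_norm \<gamma> (x (?\<sigma> i) - y i)"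
            by (rule order_trans[OF ennreal_leI[OF u(1)] proj_norm_le_cm_norm])
          also have "\<dots> = ennreal (b i)" by (rule b) (use \<open>i \<in> {..n}\<close> in simp)
          finally have "\<bar>u (s k) (x (?\<sigma> i)) - u (s k) (y i)\<bar> \<le> b i"
            by (rule ennreal_le_iff[THEN iffD1, rotated]) (simp add: b_def)
          then show "u (s k) (x (?\<sigma> i)) - u (s k) (y i) \<le> b i" by linarith
        qed
        finally show ?thesis .
      qed
      ultimately have "(\<Sum>i\<le>n. a i) \<le> (\<Sum>i\<le>n. b i)" by (intro LIMSEQ_le_const2) auto
      moreover have "(\<Sum>i\<le>n. cm_norm \<gamma> (x i - y i)) = ennreal (\<Sum>i\<le>n. a i)"
        using a by (simp add: a_def)
      moreover have "(\<Sum>i\<le>n. cm_norm \<gamma> (x (?\<sigma> i) - y i)) = ennreal (\<Sum>i\<le>n. b i)"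
      proof -
        have "(\<Sum>i\<le>n. cm_norm \<gamma> (x (?\<sigma> i) - y i)) = (\<Sum>i\<le>n. ennreal (b i))"
          by (rule sum.cong) (use b in auto)
        then show ?thesis by (simp add: b_def)
      qed
      ultimately show ?thesis by (simp add: ennreal_leI)
    qed
  qed
  ultimately show thesis using that by blast
qed

end

section \<open>Evolution\<close>

lemma continuous_on_interp: "continuous_on S (interp t :: 'a::real_normed_vector \<times> 'a \<Rightarrow> 'a)"
  unfolding interp_def case_prod_beta by (intro continuous_intros)

text \<open>One half of the portmanteau theorem, for a compact set inside an open one, by testing against a
  continuous function between the two indicators.\<close>
lemma weak_limit_open_lower_bound:
  fixes L :: "'b::metric_space measure"
  assumes M: "\<And>n. borel_prob (M n)" and L: "borel_prob L" and w: "weakly_converges M L"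
    and K: "compact K" "K \<subseteq> U" "open U" and \<eta>: "\<eta> > 0"
  shows "eventually (\<lambda>n. measure L K - \<eta> < measure (M n) U) sequentially"
proof (cases "K = {}")
  case True
  then show ?thesis using \<eta> by (intro always_eventually allI) (simp add: less_le_trans[OF _ measure_nonneg])
next
  case ne: False
  obtain \<delta> where \<delta>: "\<delta> > 0" "(\<Union>x\<in>K. ball x \<delta>) \<subseteq> U"
    using compact_subset_open_imp_ball_epsilon_subset[OF K(1,3,2)] .
  define g where "g z = max 0 (1 - infdist z K / \<delta>)" for z
  have gc: "continuous_on UNIV g" unfolding g_def using \<delta>(1) by (intro continuous_intros) auto
  have g01: "0 \<le> g z" "g z \<le> 1" for z using \<delta>(1) by (auto simp: g_def infdist_nonneg)
  have gK: "indicator K z \<le> g z" for z by (auto simp: indicator_def g_def)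
  have gU: "g z \<le> indicator U z" for z
  proof (cases "z \<in> U")
    case False
    have "\<delta> \<le> dist z x" if "x \<in> K" for x
      using \<delta>(2) that False by (force simp: dist_commute)
    then have "\<delta> \<le> infdist z K"
      using ne by (simp add: infdist_notempty cINF_greatest)
    then show ?thesis using \<delta>(1) False by (simp add: g_def)
  qed (use g01 in simp)
  have int: "integrable N g" if "borel_prob N" for N
    by (rule integrable_bounded_continuous[OF that gc, of 1]) (use g01 in auto)
  have meas: "K \<in> sets borel" "U \<in> sets borel" using K by (auto intro: borel_compact)
  have ind: "integrable N (indicator A :: _ \<Rightarrow> real)" "(\<integral>z. indicator A z \<partial>N) = measure N A"
    if "borel_prob N" "A \<in> sets borel" for N A
  proof -
    interpret prob_space N using that by (simp add: borel_prob_def)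
    show "integrable N (indicator A :: _ \<Rightarrow> real)" "(\<integral>z. indicator A z \<partial>N) = measure N A"
      using that(2) borel_prob_sets[OF that(1)] by (simp_all add: emeasure_eq_measure borel_prob_space[OF that(1)])
  qed
  have "measure L K \<le> (\<integral>z. g z \<partial>L)"
    unfolding ind(2)[OF L meas(1), symmetric] by (rule integral_mono[OF ind(1)[OF L meas(1)] int[OF L] gK])
  moreover have "(\<lambda>n. \<integral>z. g z \<partial>M n) \<longlonglongrightarrow> (\<integral>z. g z \<partial>L)"
    using w gc g01 unfolding weakly_converges_def by (auto intro!: boundedI[of _ 1])
  ultimately have "eventually (\<lambda>n. measure L K - \<eta> < (\<integral>z. g z \<partial>M n)) sequentially"
    using \<eta> by (intro order_tendstoD(1)) auto
  moreover have "(\<integral>z. g z \<partial>M n) \<le> measure (M n) U" for n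
    unfolding ind(2)[OF M meas(2), symmetric] by (rule integral_mono[OF int[OF M] ind(1)[OF M meas(2)] gU])
  ultimately show ?thesis by (auto elim!: eventually_mono intro: less_le_trans)
qed

context transport_limit
begin

lemma ex_sigma_compact_monotone:
  "\<exists>K :: nat \<Rightarrow> ('a \<times> 'a) set. (\<forall>m. compact (K m)) \<and> incseq K \<and>
    cm_cyclically_monotone \<gamma> (\<Union>m. K m) \<and> emeasure \<pi> (\<Union>m. K m) = 1"
proof -
  interpret \<pi>: prob_space \<pi> using prob_pi by (simp add: borel_prob_def)
  note spi = borel_prob_sets[OF prob_pi] and sppi = borel_prob_space[OF prob_pi]
  obtain \<Gamma>0 where \<Gamma>0: "cm_cyclically_monotone \<gamma> \<Gamma>0" "AE z in \<pi>. z \<in> \<Gamma>0"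
    by (rule ex_cyclically_monotone_AE)
  from \<Gamma>0(2) obtain N where N: "{z \<in> space \<pi>. \<not> z \<in> \<Gamma>0} \<subseteq> N" "emeasure \<pi> N = 0" "N \<in> sets \<pi>"
    by (rule AE_E)
  define B where "B = - N"
  have B: "B \<subseteq> \<Gamma>0" "B \<in> sets borel" using N(1,3) spi by (auto simp: B_def sppi)
  have "measure \<pi> N = 0" using N(2) by (simp add: measure_def)
  then have mB: "measure \<pi> B = 1"
    using \<pi>.prob_compl[OF N(3)] by (simp add: B_def sppi Compl_eq_Diff_UNIV)
  have "\<exists>C. compact C \<and> C \<subseteq> B \<and> measure \<pi> B < measure \<pi> C + 1 / real (Suc m)" for m
    using inner_regular_compact[OF prob_pi B(2), of "1 / real (Suc m)"] by (metis of_nat_0_less_iff zero_less_Suc zero_less_divide_1_iff)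
  then obtain C where C: "\<And>m. compact (C m)" "\<And>m. C m \<subseteq> B" "\<And>m. measure \<pi> B < measure \<pi> (C m) + 1 / real (Suc m)"
    by metis
  define K where "K m = (\<Union>i\<le>m. C i)" for m
  have Kc: "compact (K m)" for m unfolding K_def using C(1) by (intro compact_UN) auto
  have Kinc: "incseq K" unfolding K_def by (intro incseq_SucI UN_mono) auto
  have Ksub: "(\<Union>m. K m) \<subseteq> \<Gamma>0" using C(2) B(1) by (auto simp: K_def)
  have cyc: "cm_cyclically_monotone \<gamma> (\<Union>m. K m)"
    using \<Gamma>0(1) Ksub unfolding cm_cyclically_monotone_def by (meson subsetD)
  have Cs: "C m \<in> sets \<pi>" for m using C(1) spi by (auto intro: borel_compact)
  have Ks: "(\<Union>m. K m) \<in> sets \<pi>" unfolding K_def using Cs by auto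
  have "1 \<le> measure \<pi> (\<Union>m. K m) + 1 / real (Suc m)" for m
  proof -
    have "measure \<pi> (C m) \<le> measure \<pi> (\<Union>m. K m)"
      using Ks by (intro \<pi>.finite_measure_mono) (auto simp: K_def)
    then show ?thesis using C(3)[of m] mB by linarith
  qed
  then have "1 \<le> measure \<pi> (\<Union>m. K m)"
  proof -
    assume *: "\<And>m. 1 \<le> measure \<pi> (\<Union>m. K m) + 1 / real (Suc m)"
    have "(\<lambda>m. measure \<pi> (\<Union>m. K m) + 1 / real (Suc m)) \<longlonglongrightarrow> measure \<pi> (\<Union>m. K m) + 0"
      by (intro tendsto_intros LIMSEQ_Suc[OF lim_1_over_n])
    then show ?thesis using * by (intro LIMSEQ_le_const) auto
  qed
  then have "measure \<pi> (\<Union>m. K m) = 1" by (rule antisym[OF \<pi>.prob_le_1])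
  then have "emeasure \<pi> (\<Union>m. K m) = 1" by (simp add: \<pi>.emeasure_eq_measure)
  then show ?thesis using Kc Kinc cyc by blast
qed

text \<open>The mass that the approximating plan gives to \<open>interp t -` U\<close> is the mass of the starting points whose
  transported position at time \<open>t\<close> lies in \<open>U\<close>. The assumed bound applies to a compact set of such points.\<close>
lemma evolution_of_compact:
  assumes C: "C > 0" and bound: "\<And>d. d \<ge> 1 \<Longrightarrow> evolution_bound (distr \<gamma> borel (P d)) (mu_d d) (graph_on (range (P d)) (T d)) t C"
    and L: "compact L"
  shows "C * measure \<pi> L \<le> measure \<gamma> (interp t ` L)"
proof (rule compact_measure_ge)
  show "compact (interp t ` L)" by (rule compact_continuous_image[OF continuous_on_interp L])
  fix U :: "'a set" and \<epsilon> :: real assume U: "open U" "interp t ` L \<subseteq> U" and \<epsilon>: "\<epsilon> > 0"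
  \<comment> \<open>One \<open>\<eta>\<close> is lost to weak convergence and another to the compact set of starting points.\<close>
  define \<eta> where "\<eta> = \<epsilon> / (2 * C)"
  have \<eta>: "\<eta> > 0" using \<epsilon> C by (simp add: \<eta>_def)
  define Q where "Q = (interp t -` U :: ('a \<times> 'a) set)"
  have Q: "open Q" "L \<subseteq> Q" unfolding Q_def
    using U(2) by (auto intro: open_vimage[OF U(1) continuous_on_interp])
  have key: "C * measure \<pi> L - \<epsilon> \<le> measure \<gamma> (P d -` U)"
    if d: "d \<ge> 1" and Qd: "measure \<pi> L - \<eta> < measure (plan d) Q" for d
  proof -
    define B where "B = (\<lambda>x. (x, T d x)) -` Q"
    have Bs: "B \<in> sets borel"
      using measurable_sets[OF measurable_graph[OF d], of Q] Q(1) by (auto simp: B_def)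
    have "measure (plan d) Q = measure (mu_d d) B"
      using measure_distr[OF measurable_graph[OF d], of Q] Q(1) by (auto simp: B_def)
    moreover obtain A where A: "compact A" "A \<subseteq> B" "measure (mu_d d) B < measure (mu_d d) A + \<eta>"
      by (rule inner_regular_compact[OF borel_prob_mu_d Bs \<eta>])
    ultimately have "measure \<pi> L - 2 * \<eta> \<le> measure (mu_d d) A" using Qd by linarith
    then have "C * (measure \<pi> L - 2 * \<eta>) \<le> C * measure (mu_d d) A" using C by (intro mult_left_mono) auto
    moreover have "C * (measure \<pi> L - 2 * \<eta>) = C * measure \<pi> L - \<epsilon>"
      using C by (simp add: \<eta>_def field_simps)
    moreover have "C * measure (mu_d d) A \<le> measure \<gamma> (P d -` U)"
    proof -
      let ?g = "distr \<gamma> borel (P d)"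
      interpret m: prob_space "mu_d d" using borel_prob_mu_d by (simp add: borel_prob_def)
      have sub: "interp t ` (graph_on (range (P d)) (T d) \<inter> (A \<times> UNIV)) \<subseteq> U"
        using A(2) by (auto simp: graph_on_def B_def Q_def)
      have Us: "U \<in> sets ?g" using U(1) by simp
      have "ennreal (C * measure (mu_d d) A) = ennreal C * emeasure (mu_d d) A"
        using C by (simp add: m.emeasure_eq_measure ennreal_mult)
      also have "\<dots> \<le> emeasure (completion ?g) (interp t ` (graph_on (range (P d)) (T d) \<inter> (A \<times> UNIV)))"
        using bound[OF d] A(1) by (simp add: evolution_bound_def)
      also have "\<dots> \<le> emeasure (completion ?g) U"
        by (rule emeasure_mono[OF sub]) (use Us in \<open>simp add: sets_completionI_sets\<close>)
      also have "\<dots> = emeasure ?g U" by (simp add: emeasure_completion[OF sets_completionI_sets[OF Us]] main_part[OF Us])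
      also have "\<dots> = emeasure \<gamma> (P d -` U)"
        using U(1) by (subst emeasure_distr) auto
      finally show ?thesis by (simp add: emeasure_eq_measure)
    qed
    ultimately show ?thesis by linarith
  qed
  have "eventually (\<lambda>n. measure \<pi> L - \<eta> < measure (plan (r (Suc n))) Q) sequentially"
  proof (rule weak_limit_open_lower_bound[OF _ prob_pi _ L Q(2,1) \<eta>])
    show "borel_prob (plan (r (Suc n)))" for n
      by (rule borel_prob_plan) (use r_ge[of "Suc n"] in simp)
    show "weakly_converges (\<lambda>n. plan (r (Suc n))) \<pi>"
      using weak unfolding weakly_converges_def by (auto intro: LIMSEQ_Suc)
  qed
  then obtain N where N: "\<And>n. n \<ge> N \<Longrightarrow> measure \<pi> L - \<eta> < measure (plan (r (Suc n))) Q"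
    by (auto simp: eventually_sequentially)
  show "\<exists>\<^sub>F d in sequentially. C * measure \<pi> L - \<epsilon> \<le> measure \<gamma> (P d -` U)"
    unfolding frequently_sequentially
  proof (intro allI exI conjI)
    fix m
    show "m \<le> r (Suc (max N m))" using r_ge[of "Suc (max N m)"] by simp
    show "C * measure \<pi> L - \<epsilon> \<le> measure \<gamma> (P (r (Suc (max N m))) -` U)"
      by (rule key) (use r_ge[of "Suc (max N m)"] N in auto)
  qed
qed

text \<open>Exhausting \<open>\<Gamma>\<close> by compact sets reduces the bound to the compact case. The part of \<open>\<Gamma>\<close> over \<open>A\<close> has
  the full mass \<open>\<mu> A\<close> because the first marginal of \<open>\<pi>\<close> is \<open>\<mu>\<close>.\<close>
lemma ex_monotone_set_with_evolution_bounds: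
  "\<exists>\<Gamma>. cm_cyclically_monotone \<gamma> \<Gamma> \<and> emeasure \<pi> \<Gamma> = 1 \<and>
    (\<forall>t C. C > 0 \<longrightarrow>
      (\<forall>d\<ge>1. evolution_bound (distr \<gamma> borel (P d)) (mu_d d) (graph_on (range (P d)) (T d)) t C) \<longrightarrow>
      evolution_bound \<gamma> \<mu> \<Gamma> t C)"
proof -
  obtain K where K: "\<And>m. compact (K m)" "incseq K" "cm_cyclically_monotone \<gamma> (\<Union>m. K m)" "emeasure \<pi> (\<Union>m. K m) = 1"
    using ex_sigma_compact_monotone by blast
  interpret \<pi>: prob_space \<pi> using prob_pi by (simp add: borel_prob_def)
  interpret \<mu>: prob_space \<mu> using prob_mu by (simp add: borel_prob_def)
  note spi[simp] = borel_prob_sets[OF prob_pi] and sppi[simp] = borel_prob_space[OF prob_pi]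
  have "evolution_bound \<gamma> \<mu> (\<Union>m. K m) t C"
    if C: "C > 0" and bound: "\<And>d. d \<ge> 1 \<Longrightarrow> evolution_bound (distr \<gamma> borel (P d)) (mu_d d) (graph_on (range (P d)) (T d)) t C" for t C
    unfolding evolution_bound_def
  proof (intro allI impI)
    fix A :: "'a set" assume A: "compact A"
    define S where "S m = K m \<inter> (A \<times> UNIV)" for m
    have Acl: "closed (A \<times> (UNIV :: 'a set))" using compact_imp_closed[OF A] by (intro closed_Times) auto
    have Sc: "compact (S m)" for m unfolding S_def by (rule compact_Int_closed[OF K(1) Acl])
    have Sinc: "incseq S" using K(2) by (auto simp: S_def incseq_def)
    have Ss: "S m \<in> sets \<pi>" for m using Sc by (auto intro: borel_compact)
    let ?I = "interp t ` ((\<Union>m. K m) \<inter> (A \<times> UNIV))"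
    have I: "?I = (\<Union>m. interp t ` S m)" by (auto simp: S_def)
    have Im: "interp t ` S m \<in> sets borel" for m
      by (intro borel_compact compact_continuous_image[OF continuous_on_interp Sc])
    have Is: "?I \<in> sets \<gamma>" unfolding I using Im by simp
    have US: "(\<Union>m. S m) = (\<Union>m. K m) \<inter> (A \<times> UNIV)" by (auto simp: S_def)
    have As: "A \<times> UNIV \<in> sets \<pi>" using Acl by simp
    have Ks: "(\<Union>m. K m) \<in> sets \<pi>" using K(1) by (auto intro: borel_compact)
    have full: "measure \<pi> (\<Union>m. S m) = measure \<mu> A"
    proof -
      have "measure \<pi> (\<Union>m. K m) = 1" using K(4) by (simp add: measure_def)
      then have "measure \<pi> ((A \<times> UNIV) \<inter> (\<Union>m. K m)) = measure \<pi> (A \<times> UNIV)"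
        using \<pi>.measure_space_inter[OF As Ks] \<pi>.prob_space by simp
      also have "\<dots> = measure (distr \<pi> borel fst) A"
      proof -
        have "fst \<in> measurable \<pi> borel"
          unfolding plans_measurable_cong[OF pi_in_plans] by (intro borel_measurable_continuous_onI continuous_intros)
        then have "measure (distr \<pi> borel fst) A = measure \<pi> (fst -` A \<inter> space \<pi>)"
          by (rule measure_distr) (use A in \<open>auto intro: borel_compact\<close>)
        also have "fst -` A \<inter> space \<pi> = A \<times> (UNIV :: 'a set)" by auto
        finally show ?thesis by simp
      qed
      also have "distr \<pi> borel fst = \<mu>" using pi_in_plans by (simp add: plans_def)
      finally show ?thesis unfolding US by (simp add: Int_commute)
    qed
    have "(\<lambda>m. measure \<pi> (S m)) \<longlonglongrightarrow> measure \<pi> (\<Union>m. S m)"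
      by (rule \<pi>.finite_Lim_measure_incseq[OF _ Sinc]) (use Ss in auto)
    then have lim: "(\<lambda>m. C * measure \<pi> (S m)) \<longlonglongrightarrow> C * measure \<mu> A"
      unfolding full by (rule tendsto_mult_left)
    have "C * measure \<pi> (S m) \<le> measure \<gamma> ?I" for m
    proof -
      have "C * measure \<pi> (S m) \<le> measure \<gamma> (interp t ` S m)"
        by (rule evolution_of_compact[OF C bound Sc])
      also have "\<dots> \<le> measure \<gamma> ?I"
        unfolding I by (rule finite_measure_mono) (use Im in auto)
      finally show ?thesis .
    qed
    then have "C * measure \<mu> A \<le> measure \<gamma> ?I" by (intro LIMSEQ_le_const2[OF lim]) auto
    then have "ennreal C * emeasure \<mu> A \<le> emeasure \<gamma> ?I"
      using C by (simp add: emeasure_eq_measure \<mu>.emeasure_eq_measure ennreal_mult[symmetric] ennreal_leI)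
    also have "\<dots> = emeasure (completion \<gamma>) ?I"
      by (simp add: emeasure_completion[OF sets_completionI_sets[OF Is]] main_part[OF Is])
    finally show "ennreal C * emeasure \<mu> A \<le> emeasure (completion \<gamma>) ?I" .
  qed
  then show ?thesis using K(3,4) by blast
qed

end

theorem theorem6p2:
  fixes \<gamma> \<mu> \<nu> :: "'a::{banach,second_countable_topology} measure"
    and e' :: "nat \<Rightarrow> 'a \<Rightarrow>\<^sub>L real" and e :: "nat \<Rightarrow> 'a"
    and P :: "nat \<Rightarrow> 'a \<Rightarrow> 'a" and \<gamma>d \<mu>d \<nu>d :: "nat \<Rightarrow> 'a measure"
    and T :: "nat \<Rightarrow> 'a \<Rightarrow> 'a" and \<Gamma>d :: "nat \<Rightarrow> ('a \<times> 'a) set"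
    and \<pi>d :: "nat \<Rightarrow> ('a \<times> 'a) measure" and \<pi> :: "('a \<times> 'a) measure"
    and r :: "nat \<Rightarrow> nat"
  assumes inf_dim: "\<not> (\<exists>B :: 'a set. finite B \<and> span B = UNIV)"
    and gauss: "centred_gaussian \<gamma>" "nondegenerate \<gamma>"
    and prob: "borel_prob \<mu>" "borel_prob \<nu>"
    and ac: "absolutely_continuous \<gamma> \<mu>" "absolutely_continuous \<gamma> \<nu>"
    and fin_cost: "\<exists>\<rho>\<in>plans \<mu> \<nu>. transport_cost \<gamma> \<rho> < \<infinity>"
    and basis: "cm_orthonormal_basis \<gamma> e" "\<And>i. e i = R_op \<gamma> (blinfun_apply (e' i))"
    and P_def: "P = proj_d e' e"
    and \<gamma>d_def: "\<gamma>d = (\<lambda>d. distr \<gamma> borel (P d))"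
    and \<mu>d_def: "\<mu>d = (\<lambda>d. distr \<mu> borel (P d))"
    and \<nu>d_def: "\<nu>d = (\<lambda>d. distr \<nu> borel (P d))"
    and T: "\<And>d. d \<ge> 1 \<Longrightarrow> ray_monotone_optimal_map \<gamma> (range (P d)) (\<mu>d d) (\<nu>d d) (T d)"
    and \<Gamma>d_def: "\<Gamma>d = (\<lambda>d. graph_on (range (P d)) (T d))"
    and \<pi>d_def: "\<pi>d = (\<lambda>d. distr (\<mu>d d) borel (\<lambda>x. (x, T d x)))"
    and limit: "borel_prob \<pi>" "strict_mono r" "weakly_converges (\<lambda>n. \<pi>d (r n)) \<pi>"
  shows "\<exists>\<Gamma>. cm_cyclically_monotone \<gamma> \<Gamma> \<and> emeasure \<pi> \<Gamma> = 1 \<and>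
           (\<forall>t\<in>{0..1}. \<forall>C>0.
              (\<forall>d\<ge>1. evolution_bound (\<gamma>d d) (\<mu>d d) (\<Gamma>d d) t C) \<longrightarrow>
              evolution_bound \<gamma> \<mu> \<Gamma> t C)"
proof -
  interpret transport_limit \<gamma> e e' \<mu> \<nu> T \<pi> r
    by unfold_locales
      (use gauss prob ac fin_cost basis T limit in \<open>simp_all add: P_def \<mu>d_def \<nu>d_def \<pi>d_def\<close>)
  show ?thesis
    using ex_monotone_set_with_evolution_bounds unfolding P_def \<gamma>d_def \<mu>d_def \<Gamma>d_def by blast
qed

end
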